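(* Let $F$ be a field of characteristic $0$ and let $r\ge 2$. For each permutation matrix $w\in\mathrm{GL}(r,F)$ (with associated permutation $\pi\in\mathfrak S_r$) there exists a birational map $R=R_w$, $$V_w\simeq F^{|V_w|}\ \xrightarrow{\ R\ }\ \{u_{i,j}\mid (i,j)\in \mathrm{Inv}(\pi^{-1})\}\simeq F^{|V_w|},$$ from the affine space with coordinates $n_{i,j}$, $(i,j)\in\mathrm{Inv}(\pi^{-1})$, to the affine space with coordinates $u_{i,j}$, $(i,j)\in\mathrm{Inv}(\pi^{-1})$, with the following properties. (i) $R$ is smooth, of maximal rank, on $(F^\times)^{|V_w|}$ (i.e. each $u_{i,j}$ is a rational function of the $n_\alpha$ that is regular on $(F^\times)^{|V_w|}$, and the Jacobian matrix of $R$ is invertible at each point there). (ii) Let $wu$ denote the matrix obtained from $wn$ by replacing each $n_\alpha\in V_w$ with $u_\alpha$. If each $n_{i,j}\neq 0$ (for $n_{i,j}\in V_w$), then $wu$ decomposes as $x\cdot b$, where $x\in N$ and $b\in B_-$. The $i$-th superdiagonal entry of $x$ is $$x_{i,i+1}=\sum_{n_\alpha\in B_w(i+1)}\frac1{n_\alpha}\qquad(1\le i\le r-1),$$ where the sets $B_w(i)\subseteq V_w$, $2\le i\le r$, defined in the context, form a partition of $V_w$. Thus $\sum_{i=1}^{r-1}x_{i,i+1}=\sum_{n_\alpha\in V_w}\frac1{n_\alpha}$. (iii) The $i$-th diagonal entry $b_{i,i}$ of $b$ is $$b_{i,i}=(-1)^{i+\pi^{-1}(i)}\cdot\frac{\prod_{(a,i)\in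 \mathrm{Inv}(\pi^{-1})}(-n_{a,i})}{\prod_{(i,b)\in \mathrm{Inv}(\pi^{-1})}n_{i,b}}.$$ (iv) Under $u=R(n)$ the measure $\prod_{(i,j)\in \mathrm{Inv}(\pi^{-1})}du_{i,j}$ transforms to $\prod_{(i,j)\in \mathrm{Inv}(\pi^{-1})}|n_{i,j}|^{j-i-1}\,dn_{i,j}$; that is, the Jacobian determinant of $R$ equals $\pm\prod_{(i,j)\in \mathrm{Inv}(\pi^{-1})}n_{i,j}^{\,j-i-1}$. (v) For any pair of indices $\alpha,\beta\in\mathrm{Inv}(\pi^{-1})$, the rational function $n_\alpha\frac{\partial}{\partial n_\alpha}u_\beta$ has the form of a finite sum $$\sum_i c_i(\alpha)f_i,\quad\text{where } c_i(\alpha)\in\mathbb Z\bigl[\{n_\delta,n_\delta^{-1}\mid\delta\prec\alpha\}\bigr]\ \text{ and }\ f_i\in\mathbb Z\bigl[\{u_\gamma\mid n_\gamma\in V_w\}\bigr].$$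
   Context: $N$ is the group of upper triangular unipotent $r\times r$ matrices over $F$ and $B_-$ is the group of invertible lower triangular $r\times r$ matrices. A permutation matrix $w=(w_{i,j})$ corresponds to the permutation $\pi\in\mathfrak S_r$ with $w_{i,j}=1$ if $j=\pi(i)$ and $w_{i,j}=0$ otherwise. Put $\mathrm{Inv}(\pi^{-1})=\{(i,j)\mid 1\le i<j\le r,\ \pi^{-1}(i)>\pi^{-1}(j)\}$ and $V_w=\{n_{i,j}\mid (i,j)\in\mathrm{Inv}(\pi^{-1})\}$, a set of independent variables (the free variables). Let $n\in N$ be the matrix whose $(i,j)$ entry ($i<j$) is the variable $n_{i,j}$ if $(i,j)\in\mathrm{Inv}(\pi^{-1})$ and $0$ otherwise. Then $wn$ has entries $(wn)_{k,j}=n_{\pi(k),j}$ (with $n_{j,j}=1$), so $n_{a,b}$ stands in row $\pi^{-1}(a)$ and column $b$ of $wn$. The entry $1$ in column $j$ of $wn$ stands in row $\pi^{-1}(j)$ and is denoted $1_j$. Single-letter indices $\alpha,\beta,\gamma,\delta$ denote elements of $\mathrm{Inv}(\pi^{-1})$. Ordering: $(i_1,j_1)\succ(i_2,j_2)$ if $j_1<j_2$, or if $j_1=j_2$ and $\pi^{-1}(i_1)<\pi^{-1}(i_2)$; $\delta\prec\alpha$ means $\alpha\succ\delta$. Level: for $1\le a,b\le r$ let $h(a,b)=|\{j\mid j>b,\ \pi^{-1}(j)>a\}|$. For $n_{a,b}\in V_w$ its level is $\|n_{a,b}\|=\pi^{-1}(a)+b+h(\pi^{-1}(a),b)-r$.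 For each $i$, $B_w(i)=\{n_{a,b}\in V_w\mid \|n_{a,b}\|=i\}$. *)

theory Defs
  imports
    "Jordan_Normal_Form.Determinant"
    "HOL-Library.Poly_Mapping"
    "HOL-Library.Product_Lexorder"
    "HOL-Library.Disjoint_Sets"
    "HOL-Computational_Algebra.Fraction_Field"
begin

unbundle no m_inv_syntax

section \<open>Rational functions in the variables indexed by pairs\<close>

text \<open>
  Polynomials over \<open>'a\<close> in variables indexed by pairs of natural numbers are finitely
  supported functions from monomials (exponent vectors) to coefficients.  The lexicographic
  order on pairs is imported only because the library needs a linear order on the indices to
  show that this polynomial ring is an integral domain.  The fraction field has variables for all
  pairs; the subfields \<open>ratfuns V\<close> below restrict them to the relevant ones.
\<close>

type_synonym 'a mpoly = "(nat \<times> nat \<Rightarrow>\<^sub>0 nat) \<Rightarrow>\<^sub>0 'a"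
type_synonym 'a ratfun = "'a mpoly fract"

definition mp_vars :: "'a::zero mpoly \<Rightarrow> (nat \<times> nat) set" where
  "mp_vars p = (\<Union>m\<in>Poly_Mapping.keys p. Poly_Mapping.keys m)"

definition ratfuns :: "(nat \<times> nat) set \<Rightarrow> 'a::idom ratfun set" where
  "ratfuns V = {Fract p q | p q. q \<noteq> 0 \<and> mp_vars p \<subseteq> V \<and> mp_vars q \<subseteq> V}"

definition rat_const :: "'a::idom \<Rightarrow> 'a ratfun" where
  "rat_const c = Fract (Poly_Mapping.single 0 c) 1"

definition rat_var :: "nat \<times> nat \<Rightarrow> 'a::idom ratfun" where
  "rat_var \<alpha> = Fract (Poly_Mapping.single (Poly_Mapping.single \<alpha> 1) 1) 1"

subsection \<open>Evaluation\<close>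

text \<open>
  Values are taken in a field \<open>'b\<close> containing \<open>'a\<close> via \<open>\<phi>\<close>.  With
  \<open>\<phi> = id\<close> this is evaluation at a point over \<open>'a\<close>; with \<open>\<phi> = rat_const\<close> it is
  substitution of rational functions, that is, composition of rational maps.
  A rational function is regular at \<open>z\<close> if some fraction representing it has a denominator that
  does not vanish at \<open>z\<close>; the value does not depend on that fraction, by
  \<open>rat_eval_Fract\<close> below.
\<close>

definition mp_eval :: "('a::comm_ring_1 \<Rightarrow> 'b::field) \<Rightarrow> (nat \<times> nat \<Rightarrow> 'b) \<Rightarrow> 'a mpoly \<Rightarrow> 'b" where
  "mp_eval \<phi> z p = (\<Sum>m\<in>Poly_Mapping.keys p. \<phi> (Poly_Mapping.lookup p m) * (\<Prod>\<alpha>\<in>Poly_Mapping.keys m. z \<alpha> ^ Poly_Mapping.lookup m \<alpha>))"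

definition rat_regular :: "('a::idom \<Rightarrow> 'b::field) \<Rightarrow> (nat \<times> nat \<Rightarrow> 'b) \<Rightarrow> 'a ratfun \<Rightarrow> bool" where
  "rat_regular \<phi> z f \<longleftrightarrow> (\<exists>p q. f = Fract p q \<and> mp_eval \<phi> z q \<noteq> 0)"

definition rat_eval :: "('a::idom \<Rightarrow> 'b::field) \<Rightarrow> (nat \<times> nat \<Rightarrow> 'b) \<Rightarrow> 'a ratfun \<Rightarrow> 'b" where
  "rat_eval \<phi> z f =
     (THE v. \<exists>p q. f = Fract p q \<and> mp_eval \<phi> z q \<noteq> 0 \<and> v = mp_eval \<phi> z p / mp_eval \<phi> z q)"

lemma mp_induct [case_names zero single add]:
  fixes p :: "'k \<Rightarrow>\<^sub>0 'c::comm_monoid_add"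
  assumes z: "P 0" and s: "\<And>m c. P (Poly_Mapping.single m c)"
    and a: "\<And>p q. P p \<Longrightarrow> P q \<Longrightarrow> P (p + q)"
  shows "P p"
proof -
  have "P (\<Sum>m\<in>A. Poly_Mapping.single m (Poly_Mapping.lookup p m))" if "finite A" for A
    using that by (induction A) (auto intro: assms)
  moreover have "p = (\<Sum>m\<in>Poly_Mapping.keys p. Poly_Mapping.single m (Poly_Mapping.lookup p m))"
    by (rule poly_mapping_eqI)
       (auto simp: lookup_sum lookup_single when_def sum.delta in_keys_iff)
  ultimately show ?thesis by (metis finite_keys)
qed

lemma mp_eval_add:
  assumes "\<phi> 0 = 0" "\<And>a b. \<phi> (a + b) = \<phi> a + \<phi> b"
  shows "mp_eval \<phi> z (p + q) = mp_eval \<phi> z p + mp_eval \<phi> z q"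
  unfolding mp_eval_def
  by (rule setsum_keys_plus_distrib) (simp_all add: assms algebra_simps)

lemma mp_eval_single:
  assumes "\<phi> 0 = 0"
  shows "mp_eval \<phi> z (Poly_Mapping.single m c) = \<phi> c * (\<Prod>\<alpha>\<in>Poly_Mapping.keys m. z \<alpha> ^ Poly_Mapping.lookup m \<alpha>)"
  using assms by (cases "c = 0") (simp_all add: mp_eval_def)

lemma mono_eval_add:
  fixes z :: "nat \<times> nat \<Rightarrow> 'b::field"
  shows "(\<Prod>\<alpha>\<in>Poly_Mapping.keys (m + n). z \<alpha> ^ Poly_Mapping.lookup (m + n) \<alpha>) =
    (\<Prod>\<alpha>\<in>Poly_Mapping.keys m. z \<alpha> ^ Poly_Mapping.lookup m \<alpha>) * (\<Prod>\<alpha>\<in>Poly_Mapping.keys n. z \<alpha> ^ Poly_Mapping.lookup n \<alpha>)"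
proof -
  let ?A = "Poly_Mapping.keys m \<union> Poly_Mapping.keys n"
  have *: "(\<Prod>\<alpha>\<in>Poly_Mapping.keys k. z \<alpha> ^ Poly_Mapping.lookup k \<alpha>) = (\<Prod>\<alpha>\<in>?A. z \<alpha> ^ Poly_Mapping.lookup k \<alpha>)" if "Poly_Mapping.keys k \<subseteq> ?A" for k
    using that by (intro prod.mono_neutral_left) (auto simp: in_keys_iff)
  show ?thesis
    by (subst (1 2 3) *) (auto simp: lookup_add power_add prod.distrib dest: subsetD[OF keys_add])
qed

lemma mp_eval_mult:
  assumes "\<phi> 0 = 0" "\<And>a b. \<phi> (a + b) = \<phi> a + \<phi> b" "\<And>a b. \<phi> (a * b) = \<phi> a * \<phi> b"
  shows "mp_eval \<phi> z (p * q) = mp_eval \<phi> z p * mp_eval \<phi> z q"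
proof (induction p rule: mp_induct)
  case zero
  show ?case by (simp add: mp_eval_def)
next
  case (add p1 p2)
  then show ?case by (simp add: distrib_right mp_eval_add assms(1,2))
next
  case (single m c)
  show ?case
  proof (induction q rule: mp_induct)
    case zero
    show ?case by (simp add: mp_eval_def)
  next
    case (add p1 p2)
    then show ?case by (simp add: distrib_left mp_eval_add assms(1,2))
  next
    case (single n d)
    show ?case
      by (simp add: mult_single mp_eval_single assms mono_eval_add)
  qed
qed

lemma rat_eval_Fract:
  fixes \<phi> :: "'a::idom \<Rightarrow> 'b::field"
  assumes "\<phi> 0 = 0" "\<And>a b. \<phi> (a + b) = \<phi> a + \<phi> b" "\<And>a b. \<phi> (a * b) = \<phi> a * \<phi> b"
    and q: "mp_eval \<phi> z q \<noteq> 0"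
  shows "rat_eval \<phi> z (Fract p q) = mp_eval \<phi> z p / mp_eval \<phi> z q"
  unfolding rat_eval_def
proof (rule the_equality)
  show "\<exists>p' q'. Fract p q = Fract p' q' \<and> mp_eval \<phi> z q' \<noteq> 0 \<and>
      mp_eval \<phi> z p / mp_eval \<phi> z q = mp_eval \<phi> z p' / mp_eval \<phi> z q'"
    using q by blast
next
  fix v
  assume "\<exists>p' q'. Fract p q = Fract p' q' \<and> mp_eval \<phi> z q' \<noteq> 0 \<and> v = mp_eval \<phi> z p' / mp_eval \<phi> z q'"
  then obtain p' q' where e: "Fract p q = Fract p' q'" and q': "mp_eval \<phi> z q' \<noteq> 0"
    and v: "v = mp_eval \<phi> z p' / mp_eval \<phi> z q'" by blast
  have "q \<noteq> 0" "q' \<noteq> 0" using q q' by (auto simp: mp_eval_def)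
  with e have "p * q' = p' * q" by (simp add: eq_fract)
  then have "mp_eval \<phi> z p * mp_eval \<phi> z q' = mp_eval \<phi> z p' * mp_eval \<phi> z q"
    by (metis mp_eval_mult[of \<phi>, OF assms(1-3)])
  then show "v = mp_eval \<phi> z p / mp_eval \<phi> z q"
    unfolding v using q q' by (simp add: frac_eq_eq)
qed

subsection \<open>Partial derivatives\<close>

text \<open>If \<open>\<alpha>\<close> does not occur in \<open>m\<close>, the truncated subtraction of exponents is harmless because
  the coefficient is zero.\<close>

definition mp_pderiv :: "nat \<times> nat \<Rightarrow> 'a::comm_ring_1 mpoly \<Rightarrow> 'a mpoly" where
  "mp_pderiv \<alpha> p =
     (\<Sum>m\<in>Poly_Mapping.keys p. Poly_Mapping.single (m - Poly_Mapping.single \<alpha> 1) (of_nat (Poly_Mapping.lookup m \<alpha>) * Poly_Mapping.lookup p m))"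

lemma mp_pderiv_0 [simp]: "mp_pderiv \<alpha> 0 = 0"
  by (simp add: mp_pderiv_def)

lemma mp_pderiv_add: "mp_pderiv \<alpha> (p + q) = mp_pderiv \<alpha> p + mp_pderiv \<alpha> q"
  unfolding mp_pderiv_def
  by (rule setsum_keys_plus_distrib) (simp_all add: algebra_simps single_add)

lemma mp_pderiv_single:
  "mp_pderiv \<alpha> (Poly_Mapping.single m c) =
     Poly_Mapping.single (m - Poly_Mapping.single \<alpha> 1) (of_nat (Poly_Mapping.lookup m \<alpha>) * c)"
  by (cases "c = 0") (simp_all add: mp_pderiv_def)

lemma mono_shift:
  fixes c :: "'a::comm_ring_1"
  shows "Poly_Mapping.single ((m - Poly_Mapping.single \<alpha> 1) + n) (of_nat (Poly_Mapping.lookup m \<alpha>) * c) =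
   Poly_Mapping.single ((m + n) - Poly_Mapping.single \<alpha> (1::nat)) (of_nat (Poly_Mapping.lookup m \<alpha>) * c)"
proof (cases "Poly_Mapping.lookup m \<alpha> = 0")
  case False
  then have "(m - Poly_Mapping.single \<alpha> 1) + n = (m + n) - Poly_Mapping.single \<alpha> 1"
    by (intro poly_mapping_eqI) (auto simp: lookup_add lookup_minus lookup_single when_def)
  then show ?thesis by simp
qed simp

lemma mp_pderiv_mult:
  "mp_pderiv \<alpha> (p * q) = mp_pderiv \<alpha> p * q + p * mp_pderiv \<alpha> q"
proof (induction p rule: mp_induct)
  case zero
  show ?case by simp
next
  case (add p1 p2)
  then show ?case by (simp add: distrib_right distrib_left mp_pderiv_add)
next
  case (single m c)
  show ?case
  proof (induction q rule: mp_induct)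
    case zero
    show ?case by simp
  next
    case (add p1 p2)
    then show ?case by (simp add: distrib_right distrib_left mp_pderiv_add)
  next
    case (single n d)
    have 1: "mp_pderiv \<alpha> (Poly_Mapping.single m c) * Poly_Mapping.single n d =
        Poly_Mapping.single ((m + n) - Poly_Mapping.single \<alpha> 1) (of_nat (Poly_Mapping.lookup m \<alpha>) * (c * d))"
      using mono_shift[of m \<alpha> n "c * d"] by (simp add: mp_pderiv_single mult_single mult.assoc)
    have 2: "Poly_Mapping.single m c * mp_pderiv \<alpha> (Poly_Mapping.single n d) =
        Poly_Mapping.single ((m + n) - Poly_Mapping.single \<alpha> 1) (of_nat (Poly_Mapping.lookup n \<alpha>) * (c * d))"
      using mono_shift[of n \<alpha> m "c * d"]
      by (simp add: mp_pderiv_single mult_single ac_simps)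
    show ?case unfolding 1 2
      by (simp add: mult_single mp_pderiv_single lookup_add flip: single_add)
         (simp add: algebra_simps)
  qed
qed

text \<open>The quotient rule; independence of the representing fraction is \<open>rat_pderiv_Fract\<close>.\<close>

definition rat_pderiv :: "nat \<times> nat \<Rightarrow> 'a::idom ratfun \<Rightarrow> 'a ratfun" where
  "rat_pderiv \<alpha> f = (THE g. \<exists>p q. q \<noteq> 0 \<and> f = Fract p q \<and>
     g = Fract (mp_pderiv \<alpha> p * q - p * mp_pderiv \<alpha> q) (q * q))"

lemma quotient_rule_wd:
  fixes p q p' q' :: "'a::idom mpoly"
  assumes q: "q \<noteq> 0" "q' \<noteq> 0" and eq: "Fract p q = Fract p' q'"
  shows "Fract (mp_pderiv \<alpha> p * q - p * mp_pderiv \<alpha> q) (q * q) =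
    Fract (mp_pderiv \<alpha> p' * q' - p' * mp_pderiv \<alpha> q') (q' * q')"
proof -
  have e: "p * q' = p' * q" using q eq by (simp add: eq_fract)
  let ?d = "mp_pderiv \<alpha>"
  have d: "?d p * q' + p * ?d q' = ?d p' * q + p' * ?d q"
    using arg_cong[OF e, of ?d] by (simp add: mp_pderiv_mult)
  have "(?d p * q - p * ?d q) * (q' * q') = (?d p * q') * (q * q') - (p * q') * (?d q * q')"
    by (simp add: algebra_simps)
  also have "?d p * q' = ?d p' * q + p' * ?d q - p * ?d q'"
    using d by (simp add: algebra_simps)
  also have "(?d p' * q + p' * ?d q - p * ?d q') * (q * q') - (p * q') * (?d q * q')
      = ?d p' * q' * (q * q) + (p' * q) * (?d q * q') - (p * q') * (?d q' * q) - (p * q') * (?d q * q')"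
    by (simp add: algebra_simps)
  also have "\<dots> = (?d p' * q' - p' * ?d q') * (q * q)"
    unfolding e by (simp add: algebra_simps)
  finally have "(?d p * q - p * ?d q) * (q' * q') = (?d p' * q' - p' * ?d q') * (q * q)" .
  with q show ?thesis by (simp add: eq_fract)
qed

lemma rat_pderiv_Fract:
  fixes p q :: "'a::idom mpoly"
  assumes "q \<noteq> 0"
  shows "rat_pderiv \<alpha> (Fract p q) = Fract (mp_pderiv \<alpha> p * q - p * mp_pderiv \<alpha> q) (q * q)"
  unfolding rat_pderiv_def
proof (rule the_equality, goal_cases)
  case 1
  show ?case using assms by blast
next
  case (2 g)
  then obtain p' q' where "q' \<noteq> 0" "Fract p q = Fract p' q'"
    "g = Fract (mp_pderiv \<alpha> p' * q' - p' * mp_pderiv \<alpha> q') (q' * q')" by blast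
  then show ?case using quotient_rule_wd[OF assms] by metis
qed

subsection \<open>Rational maps\<close>

text \<open>
  A family \<open>R\<close> of rational functions in the variables \<open>V\<close>, indexed by \<open>V\<close>, is a rational map from
  affine \<open>V\<close>-space to itself.  It is birational if it has an inverse \<open>S\<close> among such
  maps, where both composites have to be defined.  Only the values of \<open>R\<close> on \<open>V\<close> matter.
\<close>

definition birational_map :: "(nat \<times> nat) set \<Rightarrow> (nat \<times> nat \<Rightarrow> 'a::idom ratfun) \<Rightarrow> bool" where
  "birational_map V R \<longleftrightarrow> (\<forall>\<beta>\<in>V. R \<beta> \<in> ratfuns V) \<and>
     (\<exists>S. (\<forall>\<alpha>\<in>V. S \<alpha> \<in> ratfuns V) \<and>
       (\<forall>\<alpha>\<in>V. rat_regular rat_const R (S \<alpha>) \<and> rat_eval rat_const R (S \<alpha>) = rat_var \<alpha>) \<and>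
       (\<forall>\<beta>\<in>V. rat_regular rat_const S (R \<beta>) \<and> rat_eval rat_const S (R \<beta>) = rat_var \<beta>))"

text \<open>Rows and columns are enumerated in the same order, so neither the determinant nor
  invertibility depends on the enumeration.\<close>

definition jacobian :: "(nat \<times> nat) set \<Rightarrow> (nat \<times> nat \<Rightarrow> 'a::idom ratfun) \<Rightarrow> 'a ratfun mat" where
  "jacobian V R = (let xs = sorted_list_of_set V in
     mat (length xs) (length xs) (\<lambda>(k, l). rat_pderiv (xs ! l) (R (xs ! k))))"

text \<open>The subring generated by \<open>S\<close>, written \<open>\<int>[S]\<close>.\<close>

inductive_set int_adjoin :: "'a::ring_1 set \<Rightarrow> 'a set" for S where
  gen: "x \<in> S \<Longrightarrow> x \<in> int_adjoin S"
| one: "1 \<in> int_adjoin S"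
| diff: "x \<in> int_adjoin S \<Longrightarrow> y \<in> int_adjoin S \<Longrightarrow> x - y \<in> int_adjoin S"
| mult: "x \<in> int_adjoin S \<Longrightarrow> y \<in> int_adjoin S \<Longrightarrow> x * y \<in> int_adjoin S"

section \<open>Permutations and matrices\<close>

text \<open>
  Row, column and permutation indices run over \<open>{1..r}\<close>.  The matrix library counts
  from \<open>0\<close>, so the \<open>(i, j)\<close> entry of \<open>A\<close> is \<open>A $$ (i - 1, j - 1)\<close>.  The variable \<open>n\<^sub>i\<^sub>j\<close> is
  identified with its index pair, so \<open>V\<^sub>w\<close> is \<open>Inv r (inv \<pi>)\<close>.
\<close>

definition Inv :: "nat \<Rightarrow> (nat \<Rightarrow> nat) \<Rightarrow> (nat \<times> nat) set" where
  "Inv r \<sigma> = {(i, j). 1 \<le> i \<and> i < j \<and> j \<le> r \<and> \<sigma> i > \<sigma> j}"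

abbreviation Vw :: "nat \<Rightarrow> (nat \<Rightarrow> nat) \<Rightarrow> (nat \<times> nat) set" where
  "Vw r \<pi> \<equiv> Inv r (inv \<pi>)"

definition perm_matrix :: "nat \<Rightarrow> (nat \<Rightarrow> nat) \<Rightarrow> 'a::zero_neq_one mat" where
  "perm_matrix r \<pi> = mat r r (\<lambda>(i, j). if j + 1 = \<pi> (i + 1) then 1 else 0)"

text \<open>The matrix \<open>n\<close> with the entries \<open>z\<close> in place of the free variables.\<close>

definition n_matrix :: "nat \<Rightarrow> (nat \<Rightarrow> nat) \<Rightarrow> (nat \<times> nat \<Rightarrow> 'a::zero_neq_one) \<Rightarrow> 'a mat" where
  "n_matrix r \<pi> z = mat r r (\<lambda>(i, j).
     if i = j then 1 else if (i + 1, j + 1) \<in> Vw r \<pi> then z (i + 1, j + 1) else 0)"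

definition unipotent_upper :: "nat \<Rightarrow> 'a::semiring_1 mat set" where
  "unipotent_upper r = {A \<in> carrier_mat r r. upper_triangular A \<and> (\<forall>i<r. A $$ (i, i) = 1)}"

definition borel_lower :: "nat \<Rightarrow> 'a::semiring_1 mat set" where
  "borel_lower r = {A \<in> carrier_mat r r. upper_triangular (transpose_mat A) \<and> invertible_mat A}"

text \<open>\<open>idx_less \<pi> \<delta> \<alpha>\<close> is \<open>\<delta> \<prec> \<alpha>\<close>; note that a larger column index makes an index smaller.\<close>

definition idx_less :: "(nat \<Rightarrow> nat) \<Rightarrow> nat \<times> nat \<Rightarrow> nat \<times> nat \<Rightarrow> bool" where
  "idx_less \<pi> \<delta> \<alpha> \<longleftrightarrow> snd \<alpha> < snd \<delta> \<or>
     (snd \<alpha> = snd \<delta> \<and> inv \<pi> (fst \<alpha>) < inv \<pi> (fst \<delta>))"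

definition h_count :: "nat \<Rightarrow> (nat \<Rightarrow> nat) \<Rightarrow> nat \<Rightarrow> nat \<Rightarrow> nat" where
  "h_count r \<pi> a b = card {j \<in> {1..r}. j > b \<and> inv \<pi> j > a}"

definition level :: "nat \<Rightarrow> (nat \<Rightarrow> nat) \<Rightarrow> nat \<times> nat \<Rightarrow> int" where
  "level r \<pi> = (\<lambda>(a, b). int (inv \<pi> a) + int b
     + int (h_count r \<pi> (inv \<pi> a) b) - int r)"

definition Bw :: "nat \<Rightarrow> (nat \<Rightarrow> nat) \<Rightarrow> nat \<Rightarrow> (nat \<times> nat) set" where
  "Bw r \<pi> i = {\<alpha> \<in> Vw r \<pi>. level r \<pi> \<alpha> = int i}"

end

theory Submission
  imports Defs
begin

text \<open>
  Write \<open>\<rho>\<close> for the inverse of \<open>\<pi>\<close>, and call the column of the pivot \<open>1\<close> of a row of \<open>wn\<close> the label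
  of that row.  With rows named by their labels, \<open>wu\<close> is an upper unitriangular matrix \<open>u\<close> whose nonzero
  entries off the diagonal stand at the free positions, and \<open>\<rho> a\<close> tells how far down row \<open>a\<close> stands.

  The matrix \<open>x\<close> is a product of elementary matrices \<open>1 + E\<^sub>i\<^sub>,\<^sub>i\<^sub>+\<^sub>1 / n\<^sub>\<alpha>\<close> along a reduced word of \<open>w\<close>, one
  factor for each free variable, with \<open>i + 1\<close> the level of \<open>\<alpha>\<close>.  Such products lie in
  \<open>N \<inter> B\<^sub>- w B\<^sub>-\<close>, so that \<open>w u \<in> x B\<^sub>-\<close> for a unique \<open>u\<close> with entries at the free positions: this \<open>u\<close> is
  \<open>R n\<close>.  Superdiagonals of unipotent matrices add up under multiplication, which gives the formula for
  \<open>x\<^sub>i\<^sub>,\<^sub>i\<^sub>+\<^sub>1\<close>; and the level of \<open>(a, b)\<close> is simply the rank of row \<open>a\<close> among the rows with labels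
  up to \<open>b\<close> (\<open>level_eq_row_rank\<close>).

  The product is built up column by column.  The free variables in column \<open>j\<close> contribute a cycle
  \<open>s\<^sub>k \<dots> s\<^sub>j\<^sub>-\<^sub>1\<close> on the left of the word, and solving \<open>w u \<in> x B\<^sub>-\<close> for the new \<open>u\<close>
  turns this cycle into one row operation for each variable \<open>n = n\<^sub>p\<^sub>,\<^sub>j\<close>, from the top row downwards:
  row \<open>p\<close> becomes \<open>n\<close> times the difference of the row directly above it and row \<open>p\<close>, after which column operations
  from right to left restore the shape of \<open>u\<close> (\<open>step_other_row\<close>, \<open>step_own_row\<close>).  Read backwards,
  the old row \<open>p\<close> is the new row above it minus \<open>1 / n\<close> times the new row \<open>p\<close>
  (\<open>column_transformation\<close>), which exhibits the elementary factors of \<open>x\<close> (\<open>factored_Suc\<close>).  Each column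
  operation divides one pivot by \<open>-n\<close>, and the new last pivot is the product of the variables in column \<open>j\<close>;
  this is the diagonal of \<open>b\<close>.

  In coordinates a single step multiplies each entry of \<open>u\<close> by \<open>1\<close>, \<open>-n\<close>, \<open>-1/n\<close> or, for the new entry,
  by the entry above it, and adds a polynomial in entries of smaller height.  Such triangular substitutions are automorphisms
  of the field of rational functions (\<open>ratfuns_aut_triangular\<close>), so the composite \<open>R\<close> is birational, and by
  the chain rule its Jacobian determinant is the product of all the factors (\<open>det_jacobian_step\<close>,
  \<open>exponent_count\<close>).  For the logarithmic derivatives the order of the steps is decisive: when \<open>n\<^sub>\<alpha>\<close> enters, it only
  scales a row by \<open>n\<^sub>\<alpha>\<close> and a column by its inverse, so every \<open>n\<^sub>\<alpha> \<partial>u\<^sub>\<beta>/\<partial>n\<^sub>\<alpha>\<close> is \<open>u\<^sub>\<beta>\<close>, \<open>-u\<^sub>\<beta>\<close>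
  or \<open>0\<close> (\<open>log_closed_own_step\<close>); all later steps have variables \<open>\<delta> \<prec> \<alpha>\<close> and can be inverted over the
  Laurent polynomials in these (\<open>log_closed_later_step\<close>).
\<close>

section \<open>Rational functions regular at a point\<close>

locale coeff_hom =
  fixes \<phi> :: "'a::idom \<Rightarrow> 'b::field"
  assumes zero: "\<phi> 0 = 0" and one: "\<phi> 1 = 1"
    and add: "\<phi> (a + b) = \<phi> a + \<phi> b" and mult: "\<phi> (a * b) = \<phi> a * \<phi> b"
begin

lemma mp_eval_0: "mp_eval \<phi> z 0 = 0"
  by (simp add: mp_eval_def)

lemma mp_eval_1: "mp_eval \<phi> z 1 = 1"
  using mp_eval_single[of \<phi> z 0 1, OF zero] by (simp add: one)

lemma mp_eval_var: "mp_eval \<phi> z (Poly_Mapping.single (Poly_Mapping.single \<alpha> 1) 1) = z \<alpha>"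
  by (simp add: mp_eval_single zero one)

lemmas mp_eval_hom = mp_eval_add[of \<phi>, OF zero add] mp_eval_mult[of \<phi>, OF zero add mult]

lemma regular_Fract: "mp_eval \<phi> z q \<noteq> 0 \<Longrightarrow> rat_regular \<phi> z (Fract p q)"
  by (auto simp: rat_regular_def)

lemma eval_Fract: "mp_eval \<phi> z q \<noteq> 0 \<Longrightarrow> rat_eval \<phi> z (Fract p q) = mp_eval \<phi> z p / mp_eval \<phi> z q"
  by (rule rat_eval_Fract) (auto simp: zero add mult)

lemma regularE:
  assumes "rat_regular \<phi> z f"
  obtains p q where "f = Fract p q" "q \<noteq> 0" "mp_eval \<phi> z q \<noteq> 0" "rat_eval \<phi> z f = mp_eval \<phi> z p / mp_eval \<phi> z q"
  using assms unfolding rat_regular_def by (metis eval_Fract mp_eval_0)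

lemma regular_diff:
  assumes "rat_regular \<phi> z f" "rat_regular \<phi> z g"
  shows "rat_regular \<phi> z (f - g) \<and> rat_eval \<phi> z (f - g) = rat_eval \<phi> z f - rat_eval \<phi> z g"
proof -
  obtain p q p' q' where *: "f = Fract p q" "q \<noteq> 0" "mp_eval \<phi> z q \<noteq> 0" "rat_eval \<phi> z f = mp_eval \<phi> z p / mp_eval \<phi> z q"
     "g = Fract p' q'" "q' \<noteq> 0" "mp_eval \<phi> z q' \<noteq> 0" "rat_eval \<phi> z g = mp_eval \<phi> z p' / mp_eval \<phi> z q'"
    using assms by (metis regularE)
  have "f - g = Fract (p * q' - p' * q) (q * q')" using * by simp
  moreover have "mp_eval \<phi> z (p * q' - p' * q) = mp_eval \<phi> z (p * q') - mp_eval \<phi> z (p' * q)"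
    using mp_eval_hom(1)[of z "p * q' - p' * q" "p' * q"] by simp
  ultimately show ?thesis
    using * by (auto simp: mp_eval_hom regular_Fract eval_Fract field_simps)
qed

lemma regular_mult:
  assumes "rat_regular \<phi> z f" "rat_regular \<phi> z g"
  shows "rat_regular \<phi> z (f * g) \<and> rat_eval \<phi> z (f * g) = rat_eval \<phi> z f * rat_eval \<phi> z g"
proof -
  obtain p q p' q' where *: "f = Fract p q" "q \<noteq> 0" "mp_eval \<phi> z q \<noteq> 0" "rat_eval \<phi> z f = mp_eval \<phi> z p / mp_eval \<phi> z q"
     "g = Fract p' q'" "q' \<noteq> 0" "mp_eval \<phi> z q' \<noteq> 0" "rat_eval \<phi> z g = mp_eval \<phi> z p' / mp_eval \<phi> z q'"
    using assms by (metis regularE)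
  have "f * g = Fract (p * p') (q * q')" using * by simp
  then show ?thesis
    using * by (auto simp: mp_eval_hom regular_Fract eval_Fract)
qed

lemma regular_one: "rat_regular \<phi> z 1 \<and> rat_eval \<phi> z 1 = 1"
  unfolding One_fract_def by (simp add: regular_Fract eval_Fract mp_eval_1)

lemma regular_zero: "rat_regular \<phi> z 0 \<and> rat_eval \<phi> z 0 = 0"
  unfolding Zero_fract_def by (simp add: regular_Fract eval_Fract mp_eval_1 mp_eval_0)

lemma regular_var: "rat_regular \<phi> z (rat_var \<alpha>) \<and> rat_eval \<phi> z (rat_var \<alpha>) = z \<alpha>"
  unfolding rat_var_def using mp_eval_var[of z \<alpha>]
  by (simp add: regular_Fract eval_Fract mp_eval_1)

lemma regular_const: "rat_regular \<phi> z (rat_const c) \<and> rat_eval \<phi> z (rat_const c) = \<phi> c"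
  unfolding rat_const_def by (simp add: regular_Fract eval_Fract mp_eval_1 mp_eval_single zero)

lemma regular_inverse:
  assumes "rat_regular \<phi> z f" "rat_eval \<phi> z f \<noteq> 0"
  shows "rat_regular \<phi> z (inverse f) \<and> rat_eval \<phi> z (inverse f) = inverse (rat_eval \<phi> z f)"
  using assms(1)
proof (rule regularE)
  fix p q assume *: "f = Fract p q" "q \<noteq> 0" "mp_eval \<phi> z q \<noteq> 0" "rat_eval \<phi> z f = mp_eval \<phi> z p / mp_eval \<phi> z q"
  then have "mp_eval \<phi> z p \<noteq> 0" using assms(2) by auto
  then show ?thesis using * by (simp add: regular_Fract eval_Fract)
qed

lemma regular_add:
  assumes "rat_regular \<phi> z f" "rat_regular \<phi> z g"
  shows "rat_regular \<phi> z (f + g) \<and> rat_eval \<phi> z (f + g) = rat_eval \<phi> z f + rat_eval \<phi> z g"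
  using regular_diff[OF assms(1) conjunct1[OF regular_diff[OF conjunct1[OF regular_zero] assms(2)]]]
    regular_diff[OF conjunct1[OF regular_zero] assms(2)]
  by (simp add: regular_zero)

lemma regular_sum:
  assumes "\<And>i. i \<in> A \<Longrightarrow> rat_regular \<phi> z (f i)"
  shows "rat_regular \<phi> z (sum f A) \<and> rat_eval \<phi> z (sum f A) = (\<Sum>i\<in>A. rat_eval \<phi> z (f i))"
  using assms by (induction A rule: infinite_finite_induct) (auto simp: regular_zero regular_add)

lemma regular_prod:
  assumes "\<And>i. i \<in> A \<Longrightarrow> rat_regular \<phi> z (f i)"
  shows "rat_regular \<phi> z (prod f A) \<and> rat_eval \<phi> z (prod f A) = (\<Prod>i\<in>A. rat_eval \<phi> z (f i))"
  using assms by (induction A rule: infinite_finite_induct) (auto simp: regular_one regular_mult)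

lemma regular_power:
  assumes "rat_regular \<phi> z f"
  shows "rat_regular \<phi> z (f ^ k) \<and> rat_eval \<phi> z (f ^ k) = rat_eval \<phi> z f ^ k"
  using assms by (induction k) (auto simp: regular_one regular_mult)

lemma regular_pderiv:
  assumes "rat_regular \<phi> z f"
  shows "rat_regular \<phi> z (rat_pderiv \<alpha> f)"
  using assms
  by (rule regularE) (auto simp: rat_pderiv_Fract mp_eval_hom intro!: regular_Fract)

lemma regular_compose:
  assumes "\<And>\<gamma>. rat_regular \<phi> z (y \<gamma>)"
  shows "rat_regular \<phi> z (mp_eval rat_const y q) \<and>
     rat_eval \<phi> z (mp_eval rat_const y q) = mp_eval \<phi> (\<lambda>\<gamma>. rat_eval \<phi> z (y \<gamma>)) q"
proof -
  have "rat_regular \<phi> z (rat_const (Poly_Mapping.lookup q m) * (\<Prod>\<alpha>\<in>Poly_Mapping.keys m. y \<alpha> ^ Poly_Mapping.lookup m \<alpha>)) \<and>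
    rat_eval \<phi> z (rat_const (Poly_Mapping.lookup q m) * (\<Prod>\<alpha>\<in>Poly_Mapping.keys m. y \<alpha> ^ Poly_Mapping.lookup m \<alpha>)) =
    \<phi> (Poly_Mapping.lookup q m) * (\<Prod>\<alpha>\<in>Poly_Mapping.keys m. rat_eval \<phi> z (y \<alpha>) ^ Poly_Mapping.lookup m \<alpha>)" for m
    using assms by (auto simp: regular_mult regular_const regular_prod regular_power)
  then show ?thesis unfolding mp_eval_def by (simp add: regular_sum)
qed

end

interpretation rat_const: coeff_hom "rat_const :: 'a::idom \<Rightarrow> 'a ratfun"
  by unfold_locales (simp_all add: rat_const_def Zero_fract_def One_fract_def single_add mult_single)

interpretation eval_id: coeff_hom "id :: 'a::field \<Rightarrow> 'a"
  by unfold_locales simp_all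

section \<open>Endomorphisms of the field of rational functions\<close>

lemma mp_eval_rat_var: "mp_eval rat_const rat_var p = (Fract p 1 :: 'a::idom ratfun)"
proof (induction p rule: mp_induct)
  case zero
  show ?case by (simp add: rat_const.mp_eval_0 Zero_fract_def)
next
  case (add p q)
  then show ?case by (simp add: rat_const.mp_eval_hom)
next
  case (single m c)
  have pw: "rat_var \<alpha> ^ k = (Fract (Poly_Mapping.single (Poly_Mapping.single \<alpha> k) 1) 1 :: 'a ratfun)" for \<alpha> k
    by (induction k) (simp_all add: One_fract_def rat_var_def mult_single flip: single_add)
  have "(\<Prod>\<alpha>\<in>A. rat_var \<alpha> ^ Poly_Mapping.lookup m \<alpha>) =
    (Fract (Poly_Mapping.single (\<Sum>\<alpha>\<in>A. Poly_Mapping.single \<alpha> (Poly_Mapping.lookup m \<alpha>)) 1) 1 :: 'a ratfun)" if "finite A" for A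
    using that by (induction A) (simp_all add: One_fract_def pw mult_single)
  moreover have "(\<Sum>\<alpha>\<in>Poly_Mapping.keys m. Poly_Mapping.single \<alpha> (Poly_Mapping.lookup m \<alpha>)) = m"
    by (rule poly_mapping_eqI)
       (auto simp: lookup_sum lookup_single when_def sum.delta in_keys_iff)
  ultimately show ?case
    by (simp add: rat_const.zero mp_eval_single) (simp add: rat_const_def mult_single)
qed

locale field_endo =
  fixes \<Theta> :: "'a::idom ratfun \<Rightarrow> 'a ratfun"
  assumes one: "\<Theta> 1 = 1" and diff: "\<Theta> (f - g) = \<Theta> f - \<Theta> g" and mult: "\<Theta> (f * g) = \<Theta> f * \<Theta> g"
    and const: "\<Theta> (rat_const c) = rat_const c"
begin

lemma zero: "\<Theta> 0 = 0" using diff[of 0 0] by simp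
lemma add: "\<Theta> (f + g) = \<Theta> f + \<Theta> g" using diff[of f "0 - g"] diff[of 0 g] by (simp add: zero)
lemma nonzero: "f \<noteq> 0 \<Longrightarrow> \<Theta> f \<noteq> 0"
  using mult[of f "inverse f"] by (auto simp: one)
lemma inverse: "\<Theta> (inverse f) = inverse (\<Theta> f)"
proof (cases "f = 0")
  case False
  then have "\<Theta> f * \<Theta> (inverse f) = 1" using mult[of f "inverse f"] by (simp add: one)
  then show ?thesis by (rule inverse_unique[symmetric])
qed (simp add: zero)
lemma sum: "\<Theta> (sum h A) = (\<Sum>i\<in>A. \<Theta> (h i))"
  by (induction A rule: infinite_finite_induct) (simp_all add: zero add)
lemma prod: "\<Theta> (prod h A) = (\<Prod>i\<in>A. \<Theta> (h i))"
  by (induction A rule: infinite_finite_induct) (simp_all add: one mult)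
lemma power: "\<Theta> (f ^ k) = \<Theta> f ^ k"
  by (induction k) (simp_all add: one mult)

lemma polynomial: "\<Theta> (Fract p 1) = mp_eval rat_const (\<lambda>\<gamma>. \<Theta> (rat_var \<gamma>)) p"
  unfolding mp_eval_rat_var[symmetric] mp_eval_def
  by (simp add: sum mult prod power const)

lemma Fract: "\<Theta> (Fract p q) = \<Theta> (Fract p 1) / \<Theta> (Fract q 1)"
proof -
  have "Fract p q = Fract p 1 * inverse (Fract q 1)" by simp
  then show ?thesis by (simp only: mult inverse divide_inverse)
qed

text \<open>An endomorphism is the substitution of the images of the variables, and this substitution meets
  no vanishing denominators because homomorphisms of fields are injective.\<close>

lemma substitution:
  "rat_regular rat_const (\<lambda>\<gamma>. \<Theta> (rat_var \<gamma>)) f \<and> rat_eval rat_const (\<lambda>\<gamma>. \<Theta> (rat_var \<gamma>)) f = \<Theta> f"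
proof (cases f)
  case hyps: (Fract p q)
  then have "Fract q 1 \<noteq> 0" by (simp add: Zero_fract_def eq_fract)
  then have "mp_eval rat_const (\<lambda>\<gamma>. \<Theta> (rat_var \<gamma>)) q \<noteq> 0"
    using nonzero by (simp flip: polynomial)
  then show ?thesis
    using hyps Fract[of p q]
    by (simp add: rat_const.regular_Fract rat_const.eval_Fract polynomial)
qed

end

text \<open>If the substitution of \<open>y\<close> has a left inverse on the variables, then no nonzero polynomial vanishes at \<open>y\<close>:
  it would vanish identically after the second substitution.\<close>

lemma field_endo_of_left_inverse:
  assumes "\<And>\<gamma>. rat_regular rat_const y' (y \<gamma>)" "\<And>\<gamma>. rat_eval rat_const y' (y \<gamma>) = rat_var \<gamma>"
  shows "field_endo (rat_eval rat_const y :: 'a::idom ratfun \<Rightarrow> 'a ratfun)" "rat_eval rat_const y (rat_var \<gamma>) = y \<gamma>"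
proof -
  have reg: "rat_regular rat_const y f" for f :: "'a ratfun"
  proof (cases f)
    case (Fract p q)
    have "rat_eval rat_const y' (mp_eval rat_const y q) = Fract q 1"
      using rat_const.regular_compose[of y' y q] assms by (simp add: mp_eval_rat_var)
    with Fract have "mp_eval rat_const y q \<noteq> 0"
      by (auto simp: rat_const.regular_zero Zero_fract_def[symmetric] eq_fract) 
         (simp add: Zero_fract_def eq_fract)
    then show ?thesis using Fract by (simp add: rat_const.regular_Fract)
  qed
  show "field_endo (rat_eval rat_const y)"
    by unfold_locales (simp_all add: reg rat_const.regular_one rat_const.regular_diff rat_const.regular_mult rat_const.regular_const)
  show "rat_eval rat_const y (rat_var \<gamma>) = y \<gamma>" by (simp add: rat_const.regular_var)
qed

lemma field_endo_eqI:
  assumes "field_endo \<Theta>" "field_endo \<Theta>'" "\<And>\<gamma>. \<Theta> (rat_var \<gamma>) = \<Theta>' (rat_var \<gamma>)"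
  shows "\<Theta> f = \<Theta>' f"
proof -
  have "(\<lambda>\<gamma>. \<Theta> (rat_var \<gamma>)) = (\<lambda>\<gamma>. \<Theta>' (rat_var \<gamma>))" using assms(3) by auto
  then show ?thesis
    using field_endo.substitution[OF assms(1), of f] field_endo.substitution[OF assms(2), of f] by simp
qed

lemma field_endo_id: "field_endo (\<lambda>f. f)"
  by unfold_locales simp_all

lemma field_endo_comp: "field_endo \<Theta> \<Longrightarrow> field_endo \<Theta>' \<Longrightarrow> field_endo (\<lambda>f. \<Theta> (\<Theta>' f))"
  unfolding field_endo_def by simp

section \<open>Partial derivatives of rational functions\<close>

lemma rat_pderiv_diff: "rat_pderiv \<alpha> (f - g) = rat_pderiv \<alpha> f - rat_pderiv \<alpha> g"
proof (cases f)
  case f: (Fract p q)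
  show ?thesis
  proof (cases g)
    case g: (Fract p' q')
    have "mp_pderiv \<alpha> (p * q' - p' * q) = mp_pderiv \<alpha> (p * q') - mp_pderiv \<alpha> (p' * q)"
      using mp_pderiv_add[of \<alpha> "p * q' - p' * q" "p' * q"] by (simp add: algebra_simps)
    then show ?thesis using f g
      by (simp add: rat_pderiv_Fract mp_pderiv_mult eq_fract) (simp add: algebra_simps)
  qed
qed

lemma rat_pderiv_mult: "rat_pderiv \<alpha> (f * g) = rat_pderiv \<alpha> f * g + f * rat_pderiv \<alpha> g"
proof (cases f)
  case f: (Fract p q)
  show ?thesis
  proof (cases g)
    case g: (Fract p' q')
    show ?thesis using f g
      by (simp add: rat_pderiv_Fract mp_pderiv_mult eq_fract) (simp add: algebra_simps)
  qed
qed

lemma rat_pderiv_1 [simp]: "rat_pderiv \<alpha> 1 = 0"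
proof -
  have "rat_pderiv \<alpha> 1 + rat_pderiv \<alpha> 1 = rat_pderiv \<alpha> 1 + 0"
    using rat_pderiv_mult[of \<alpha> 1 1] by (metis mult_1_left mult_1_right add_0_right)
  then show ?thesis by (simp only: add_left_cancel)
qed

lemma rat_pderiv_0 [simp]: "rat_pderiv \<alpha> 0 = 0"
  using rat_pderiv_diff[of \<alpha> 0 0] by simp

lemma rat_pderiv_add: "rat_pderiv \<alpha> (f + g) = rat_pderiv \<alpha> f + rat_pderiv \<alpha> g"
  using rat_pderiv_diff[of \<alpha> f "0 - g"] rat_pderiv_diff[of \<alpha> 0 g] by simp

lemma rat_pderiv_minus: "rat_pderiv \<alpha> (- f) = - rat_pderiv \<alpha> f"
  using rat_pderiv_diff[of \<alpha> 0 f] by simp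

lemma rat_pderiv_inverse:
  assumes "f \<noteq> 0"
  shows "rat_pderiv \<alpha> (inverse f) = - rat_pderiv \<alpha> f * (inverse f * inverse f)"
proof -
  have "f * rat_pderiv \<alpha> (inverse f) = - (rat_pderiv \<alpha> f * inverse f)"
    using rat_pderiv_mult[of \<alpha> f "inverse f"] assms by (simp add: eq_neg_iff_add_eq_0 add.commute)
  then have "inverse f * (f * rat_pderiv \<alpha> (inverse f)) = inverse f * - (rat_pderiv \<alpha> f * inverse f)"
    by simp
  then show ?thesis using assms by (simp add: field_simps)
qed

lemma rat_pderiv_var: "rat_pderiv \<alpha> (rat_var \<beta>) = (if \<alpha> = \<beta> then 1 else 0)"
  unfolding rat_var_def One_fract_def Zero_fract_def
  by (simp add: rat_pderiv_Fract mp_pderiv_single lookup_single when_def)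
     (simp add: mp_pderiv_def)

lemma rat_var_nonzero [simp]: "rat_var \<alpha> \<noteq> (0 :: 'a::idom ratfun)"
  using rat_pderiv_var[of \<alpha> \<alpha>, where 'a='a] by force

section \<open>Subrings and subfields of rational functions\<close>

definition subring_of :: "'k::field set \<Rightarrow> bool" where
  "subring_of X \<longleftrightarrow> 1 \<in> X \<and> (\<forall>x\<in>X. \<forall>y\<in>X. x - y \<in> X \<and> x * y \<in> X)"

lemma subring_of_closed:
  assumes "subring_of X"
  shows "1 \<in> X" "0 \<in> X" "\<And>x y. x \<in> X \<Longrightarrow> y \<in> X \<Longrightarrow> x - y \<in> X" "\<And>x y. x \<in> X \<Longrightarrow> y \<in> X \<Longrightarrow> x * y \<in> X"
    "\<And>x. x \<in> X \<Longrightarrow> - x \<in> X" "\<And>x y. x \<in> X \<Longrightarrow> y \<in> X \<Longrightarrow> x + y \<in> X"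
proof -
  show 1: "1 \<in> X" and d: "\<And>x y. x \<in> X \<Longrightarrow> y \<in> X \<Longrightarrow> x - y \<in> X"
    and "\<And>x y. x \<in> X \<Longrightarrow> y \<in> X \<Longrightarrow> x * y \<in> X"
    using assms by (auto simp: subring_of_def)
  show 0: "0 \<in> X" using d[OF 1 1] by simp
  show m: "- x \<in> X" if "x \<in> X" for x using d[OF 0 that] by simp
  show "x + y \<in> X" if "x \<in> X" "y \<in> X" for x y using d[OF that(1) m[OF that(2)]] by simp
qed

lemma subring_of_sum: "subring_of X \<Longrightarrow> (\<And>i. i \<in> A \<Longrightarrow> f i \<in> X) \<Longrightarrow> sum f A \<in> X"
  by (induction A rule: infinite_finite_induct) (auto simp: subring_of_closed)

lemma subring_of_prod: "subring_of X \<Longrightarrow> (\<And>i. i \<in> A \<Longrightarrow> f i \<in> X) \<Longrightarrow> prod f A \<in> X"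
  by (induction A rule: infinite_finite_induct) (auto simp: subring_of_closed)

lemma subring_of_power: "subring_of X \<Longrightarrow> f \<in> X \<Longrightarrow> f ^ k \<in> X"
  by (induction k) (auto simp: subring_of_closed)

lemma mp_vars_diff: "mp_vars (p - q) \<subseteq> mp_vars p \<union> mp_vars (q :: 'a::ab_group_add mpoly)"
  using keys_diff[of p q] by (auto simp: mp_vars_def)

lemma mp_vars_mult: "mp_vars (p * q) \<subseteq> mp_vars p \<union> mp_vars (q :: 'a::comm_ring_1 mpoly)"
proof
  fix x assume "x \<in> mp_vars (p * q)"
  then obtain m where m: "m \<in> Poly_Mapping.keys (p * q)" "x \<in> Poly_Mapping.keys m"
    by (auto simp: mp_vars_def)
  then obtain a b where "m = a + b" "a \<in> Poly_Mapping.keys p" "b \<in> Poly_Mapping.keys q"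
    using keys_mult[of p q] by auto
  then show "x \<in> mp_vars p \<union> mp_vars q"
    using m(2) keys_add[of a b] by (auto simp: mp_vars_def)
qed

lemma mp_vars_const: "mp_vars (Poly_Mapping.single 0 c) = {}"
  by (simp add: mp_vars_def)

lemma ratfunsE:
  assumes "f \<in> ratfuns V"
  obtains p q where "f = Fract p q" "q \<noteq> 0" "mp_vars p \<subseteq> V" "mp_vars q \<subseteq> V"
  using assms unfolding ratfuns_def by auto

lemma ratfunsI: "q \<noteq> 0 \<Longrightarrow> mp_vars p \<subseteq> V \<Longrightarrow> mp_vars q \<subseteq> V \<Longrightarrow> Fract p q \<in> ratfuns V"
  unfolding ratfuns_def by auto

lemma ratfuns_subring: "subring_of (ratfuns V :: 'a::idom ratfun set)"
  unfolding subring_of_def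
proof (intro conjI ballI)
  have "1 = Fract 1 (1 :: 'a mpoly)" "mp_vars (1 :: 'a mpoly) = {}"
    using mp_vars_const[of "1 :: 'a"] by (simp_all add: One_fract_def)
  then show "1 \<in> (ratfuns V :: 'a ratfun set)"
    unfolding ratfuns_def using zero_neq_one by fastforce
next
  fix f g :: "'a ratfun" assume fg: "f \<in> ratfuns V" "g \<in> ratfuns V"
  obtain p q where *: "f = Fract p q" "q \<noteq> 0" "mp_vars p \<subseteq> V" "mp_vars q \<subseteq> V"
    using fg(1) by (rule ratfunsE)
  obtain p' q' where **: "g = Fract p' q'" "q' \<noteq> 0" "mp_vars p' \<subseteq> V" "mp_vars q' \<subseteq> V"
    using fg(2) by (rule ratfunsE)
  note * = * **
  have "f - g = Fract (p * q' - p' * q) (q * q')" "f * g = Fract (p * p') (q * q')"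
    using * by simp_all
  moreover have "mp_vars (p * q' - p' * q) \<subseteq> V" "mp_vars (p * p') \<subseteq> V" "mp_vars (q * q') \<subseteq> V"
    using * mp_vars_diff[of "p * q'" "p' * q"] mp_vars_mult[of p q'] mp_vars_mult[of p' q]
      mp_vars_mult[of p p'] mp_vars_mult[of q q'] by blast+
  ultimately show "f - g \<in> ratfuns V" "f * g \<in> ratfuns V"
    unfolding ratfuns_def using * mult_eq_0_iff[of q q'] by blast+
qed

lemma ratfuns_inverse:
  assumes "f \<in> ratfuns V" shows "inverse f \<in> (ratfuns V :: 'a::idom ratfun set)"
proof (cases "f = 0")
  case True
  then show ?thesis using assms by simp
next
  case False
  obtain p q where *: "f = Fract p q" "q \<noteq> 0" "mp_vars p \<subseteq> V" "mp_vars q \<subseteq> V"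
    using assms by (rule ratfunsE)
  then have "p \<noteq> 0" using False by (auto simp: Zero_fract_def eq_fract)
  with * show ?thesis unfolding ratfuns_def by auto
qed

lemma ratfuns_var: "\<alpha> \<in> V \<Longrightarrow> rat_var \<alpha> \<in> (ratfuns V :: 'a::idom ratfun set)"
proof -
  assume "\<alpha> \<in> V"
  then have "mp_vars (Poly_Mapping.single (Poly_Mapping.single \<alpha> 1) 1 :: 'a mpoly) \<subseteq> V"
    by (simp add: mp_vars_def)
  moreover have "mp_vars (1 :: 'a mpoly) \<subseteq> V" using mp_vars_const[of "1 :: 'a"] by simp
  ultimately show ?thesis unfolding rat_var_def by (intro ratfunsI) simp_all
qed

lemma ratfuns_const: "rat_const c \<in> (ratfuns V :: 'a::idom ratfun set)"
proof -
  have "mp_vars (Poly_Mapping.single 0 c) \<subseteq> V" "mp_vars (1 :: 'a mpoly) \<subseteq> V"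
    using mp_vars_const[of "1 :: 'a"] by (simp_all add: mp_vars_const)
  then show ?thesis unfolding rat_const_def by (intro ratfunsI) simp_all
qed

lemma ratfuns_mono: "V \<subseteq> W \<Longrightarrow> ratfuns V \<subseteq> ratfuns W"
  unfolding ratfuns_def by blast

lemma mp_eval_mem_subring:
  assumes "subring_of X" "\<And>c. \<phi> c \<in> X" "\<And>\<gamma>. \<gamma> \<in> mp_vars p \<Longrightarrow> z \<gamma> \<in> X"
  shows "mp_eval \<phi> z p \<in> X"
  unfolding mp_eval_def
  by (intro subring_of_sum subring_of_closed(4) subring_of_prod subring_of_power assms)
     (auto simp: mp_vars_def)

lemma field_endo_ratfuns:
  assumes "field_endo \<Theta>" "\<And>\<gamma>. \<gamma> \<in> V \<Longrightarrow> \<Theta> (rat_var \<gamma>) \<in> ratfuns W" "f \<in> ratfuns V"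
  shows "\<Theta> f \<in> ratfuns W"
proof -
  obtain p q where *: "f = Fract p q" "mp_vars p \<subseteq> V" "mp_vars q \<subseteq> V"
    using assms(3) by (rule ratfunsE)
  have "mp_eval rat_const (\<lambda>\<gamma>. \<Theta> (rat_var \<gamma>)) s \<in> ratfuns W" if "mp_vars s \<subseteq> V" for s
    using that assms(2) by (intro mp_eval_mem_subring ratfuns_subring ratfuns_const) auto
  then have "\<Theta> (Fract p 1) \<in> ratfuns W" "\<Theta> (Fract q 1) \<in> ratfuns W"
    using * by (simp_all add: field_endo.polynomial[OF assms(1)])
  then show ?thesis
    unfolding * field_endo.Fract[OF assms(1), of p q] divide_inverse
    by (intro subring_of_closed(4)[OF ratfuns_subring] ratfuns_inverse)
qed

text \<open>Although \<open>y\<close> is arbitrary outside \<open>V\<close>, the denominator of \<open>f\<close> is substituted by itself and so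
  cannot vanish.\<close>

lemma regular_ratfuns_fixed:
  assumes "\<And>\<gamma>. \<gamma> \<in> V \<Longrightarrow> y \<gamma> = rat_var \<gamma>" "f \<in> ratfuns V"
  shows "rat_regular rat_const y f \<and> rat_eval rat_const y f = (f :: 'a::idom ratfun)"
proof -
  obtain p q where *: "f = Fract p q" "q \<noteq> 0" "mp_vars p \<subseteq> V" "mp_vars q \<subseteq> V"
    using assms(2) by (rule ratfunsE)
  have e: "mp_eval rat_const y s = Fract s 1" if "mp_vars s \<subseteq> V" for s
  proof -
    have "y \<alpha> = rat_var \<alpha>" if "m \<in> Poly_Mapping.keys s" "\<alpha> \<in> Poly_Mapping.keys m" for m \<alpha>
      using that assms(1) \<open>mp_vars s \<subseteq> V\<close> unfolding mp_vars_def by blast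
    then show ?thesis
      unfolding mp_eval_rat_var[symmetric] mp_eval_def by (simp cong: sum.cong prod.cong)
  qed
  have "mp_eval rat_const y q \<noteq> 0" using * by (simp add: e Zero_fract_def eq_fract)
  with * show ?thesis by (simp add: e rat_const.regular_Fract rat_const.eval_Fract)
qed

section \<open>Triangular substitutions\<close>

text \<open>Both directions have to preserve the subfield \<open>ratfuns V\<close>, since a birational map and its inverse
  have their components there.\<close>

definition inverse_endos :: "(nat \<times> nat) set \<Rightarrow> ('a::idom ratfun \<Rightarrow> 'a ratfun) \<Rightarrow> ('a ratfun \<Rightarrow> 'a ratfun) \<Rightarrow> bool" where
  "inverse_endos V \<Theta> \<Psi> \<longleftrightarrow> field_endo \<Theta> \<and> field_endo \<Psi> \<and> (\<forall>f\<in>ratfuns V. \<Theta> f \<in> ratfuns V) \<and>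
     (\<forall>f\<in>ratfuns V. \<Psi> f \<in> ratfuns V) \<and> (\<forall>f. \<Psi> (\<Theta> f) = f) \<and> (\<forall>f. \<Theta> (\<Psi> f) = f)"

definition ratfuns_aut :: "(nat \<times> nat) set \<Rightarrow> ('a::idom ratfun \<Rightarrow> 'a ratfun) \<Rightarrow> bool" where
  "ratfuns_aut V \<Theta> \<longleftrightarrow> (\<exists>\<Psi>. inverse_endos V \<Theta> \<Psi>)"

lemma ratfuns_aut_endo: "ratfuns_aut V \<Theta> \<Longrightarrow> field_endo \<Theta>"
  unfolding ratfuns_aut_def inverse_endos_def by blast

lemma ratfuns_aut_id: "ratfuns_aut V (\<lambda>f. f)"
  unfolding ratfuns_aut_def inverse_endos_def using field_endo_id by (intro exI[of _ "\<lambda>f. f"]) simp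

lemma ratfuns_aut_comp:
  assumes "ratfuns_aut V \<Theta>" "ratfuns_aut V \<Theta>'"
  shows "ratfuns_aut V (\<lambda>f. \<Theta> (\<Theta>' f))"
proof -
  obtain \<Psi> \<Psi>' where "inverse_endos V \<Theta> \<Psi>" "inverse_endos V \<Theta>' \<Psi>'"
    using assms unfolding ratfuns_aut_def by blast
  then have "inverse_endos V (\<lambda>f. \<Theta> (\<Theta>' f)) (\<lambda>f. \<Psi>' (\<Psi> f))"
    unfolding inverse_endos_def by (simp add: field_endo_comp)
  then show ?thesis unfolding ratfuns_aut_def by blast
qed

text \<open>The inverse of an automorphism supplies the inverse rational map.\<close>

lemma birational_map_of_aut:
  fixes \<Theta> :: "'a::idom ratfun \<Rightarrow> 'a ratfun"
  assumes "ratfuns_aut V \<Theta>"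
  shows "birational_map V (\<lambda>\<beta>. \<Theta> (rat_var \<beta>))"
proof -
  obtain \<Psi> where P: "inverse_endos V \<Theta> \<Psi>"
    using assms unfolding ratfuns_aut_def by blast
  have s: "rat_regular rat_const (\<lambda>\<gamma>. \<Theta> (rat_var \<gamma>)) f \<and> rat_eval rat_const (\<lambda>\<gamma>. \<Theta> (rat_var \<gamma>)) f = \<Theta> f"
    "rat_regular rat_const (\<lambda>\<gamma>. \<Psi> (rat_var \<gamma>)) f \<and> rat_eval rat_const (\<lambda>\<gamma>. \<Psi> (rat_var \<gamma>)) f = \<Psi> f" for f
    using P field_endo.substitution[of \<Theta> f] field_endo.substitution[of \<Psi> f] unfolding inverse_endos_def by simp_all
  show ?thesis unfolding birational_map_def
    using P by (intro conjI exI[of _ "\<lambda>\<alpha>. \<Psi> (rat_var \<alpha>)"]) (simp_all add: s inverse_endos_def ratfuns_var)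
qed

text \<open>Rescaling and shifting the variables in \<open>S\<close> by functions of the others is undone by the formula
  solving \<open>y = a x + g\<close> for \<open>x\<close>.\<close>

lemma ratfuns_aut_parallel:
  fixes a g :: "nat \<times> nat \<Rightarrow> 'a::idom ratfun"
  assumes S: "S \<subseteq> V" and ag: "\<And>\<beta>. \<beta> \<in> S \<Longrightarrow> a \<beta> \<noteq> 0 \<and> a \<beta> \<in> ratfuns (V - S) \<and> g \<beta> \<in> ratfuns (V - S)"
  shows "\<exists>\<Theta>. ratfuns_aut V \<Theta> \<and>
    (\<forall>\<beta>. \<Theta> (rat_var \<beta>) = (if \<beta> \<in> S then a \<beta> * rat_var \<beta> + g \<beta> else rat_var \<beta>)) \<and>
    (\<forall>f\<in>ratfuns (- S). \<Theta> f = f)"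
proof -
  define y where "y \<beta> = (if \<beta> \<in> S then a \<beta> * rat_var \<beta> + g \<beta> else rat_var \<beta>)" for \<beta>
  define y' where "y' \<beta> = (if \<beta> \<in> S then inverse (a \<beta>) * (rat_var \<beta> - g \<beta>) else rat_var \<beta>)" for \<beta>
  have fix1: "rat_regular rat_const y f \<and> rat_eval rat_const y f = f" if "f \<in> ratfuns (- S)" for f
    using that by (intro regular_ratfuns_fixed[of "- S"]) (auto simp: y_def)
  have fix2: "rat_regular rat_const y' f \<and> rat_eval rat_const y' f = f" if "f \<in> ratfuns (- S)" for f
    using that by (intro regular_ratfuns_fixed[of "- S"]) (auto simp: y'_def)
  have sub: "ratfuns (V - S) \<subseteq> ratfuns (- S)" "ratfuns (V - S) \<subseteq> ratfuns V" by (intro ratfuns_mono; blast)+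
  have 1: "rat_regular rat_const y' (y \<gamma>) \<and> rat_eval rat_const y' (y \<gamma>) = rat_var \<gamma>" for \<gamma>
  proof (cases "\<gamma> \<in> S")
    case True
    with ag[OF True] fix2 sub(1) have "rat_regular rat_const y' (a \<gamma>)" "rat_eval rat_const y' (a \<gamma>) = a \<gamma>"
      "rat_regular rat_const y' (g \<gamma>)" "rat_eval rat_const y' (g \<gamma>) = g \<gamma>" by blast+
    then show ?thesis using ag[OF True] True
      by (simp add: y_def rat_const.regular_add rat_const.regular_mult rat_const.regular_var)
         (simp add: y'_def mult.assoc[symmetric])
  qed (simp add: y_def rat_const.regular_var, simp add: y'_def)
  have 2: "rat_regular rat_const y (y' \<gamma>) \<and> rat_eval rat_const y (y' \<gamma>) = rat_var \<gamma>" for \<gamma>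
  proof (cases "\<gamma> \<in> S")
    case True
    with ag[OF True] fix1 sub(1) have "rat_regular rat_const y (a \<gamma>)" "rat_eval rat_const y (a \<gamma>) = a \<gamma>"
      "rat_regular rat_const y (g \<gamma>)" "rat_eval rat_const y (g \<gamma>) = g \<gamma>" by blast+
    then show ?thesis using ag[OF True] True
      by (simp add: y'_def rat_const.regular_diff rat_const.regular_mult rat_const.regular_var rat_const.regular_inverse)
         (simp add: y_def mult.assoc[symmetric])
  qed (simp add: y'_def rat_const.regular_var, simp add: y_def)
  let ?T = "rat_eval rat_const y" and ?P = "rat_eval rat_const y'"
  have e: "field_endo ?T" "field_endo ?P" "\<And>\<gamma>. ?T (rat_var \<gamma>) = y \<gamma>" "\<And>\<gamma>. ?P (rat_var \<gamma>) = y' \<gamma>"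
    using 1 2 by (simp_all add: field_endo_of_left_inverse[of y' y] field_endo_of_left_inverse[of y y'])
  have i: "?P (?T f) = f" for f
    by (rule field_endo_eqI[OF field_endo_comp[OF e(2,1)] field_endo_id]) (use 1 in \<open>simp add: e(3)\<close>)
  have i': "?T (?P f) = f" for f
    by (rule field_endo_eqI[OF field_endo_comp[OF e(1,2)] field_endo_id]) (use 2 in \<open>simp add: e(4)\<close>)
  have "y \<gamma> \<in> ratfuns V" "y' \<gamma> \<in> ratfuns V" if "\<gamma> \<in> V" for \<gamma>
    using that ag[of \<gamma>] sub(2) unfolding y_def y'_def
    by (auto intro!: subring_of_closed[OF ratfuns_subring] ratfuns_var ratfuns_inverse)
  then have "\<And>f. f \<in> ratfuns V \<Longrightarrow> ?T f \<in> ratfuns V" "\<And>f. f \<in> ratfuns V \<Longrightarrow> ?P f \<in> ratfuns V"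
    using field_endo_ratfuns[OF e(1), of V V] field_endo_ratfuns[OF e(2), of V V] by (simp_all add: e)
  then have "inverse_endos V ?T ?P" unfolding inverse_endos_def using e i i' by simp
  then have "ratfuns_aut V ?T" unfolding ratfuns_aut_def by blast
  moreover have "?T (rat_var \<beta>) = (if \<beta> \<in> S then a \<beta> * rat_var \<beta> + g \<beta> else rat_var \<beta>)" for \<beta>
    by (simp add: e y_def)
  ultimately show ?thesis using fix1 by blast
qed

text \<open>The levels of \<open>h\<close> are treated from the lowest upwards.  The images found so far are rational functions in
  variables of lower levels, hence fixed by the substitution for the next level.\<close>

lemma ratfuns_aut_triangular:
  fixes a g :: "nat \<times> nat \<Rightarrow> 'a::idom ratfun" and h :: "nat \<times> nat \<Rightarrow> nat"
  assumes "finite V" and ag: "\<And>\<beta>. \<beta> \<in> V \<Longrightarrow> a \<beta> \<noteq> 0 \<and>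
     a \<beta> \<in> ratfuns {\<gamma> \<in> V. h \<gamma> < h \<beta>} \<and> g \<beta> \<in> ratfuns {\<gamma> \<in> V. h \<gamma> < h \<beta>}"
  shows "\<exists>\<Theta>. ratfuns_aut V \<Theta> \<and>
    (\<forall>\<beta>. \<Theta> (rat_var \<beta>) = (if \<beta> \<in> V then a \<beta> * rat_var \<beta> + g \<beta> else rat_var \<beta>))"
proof -
  have "\<exists>\<Theta>. ratfuns_aut V \<Theta> \<and>
    (\<forall>\<beta>. \<Theta> (rat_var \<beta>) = (if \<beta> \<in> V \<and> h \<beta> < n then a \<beta> * rat_var \<beta> + g \<beta> else rat_var \<beta>))" for n
  proof (induction n)
    case 0
    then show ?case using ratfuns_aut_id by auto
  next
    case (Suc n)
    then obtain \<Theta> where T: "ratfuns_aut V \<Theta>"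
      "\<And>\<beta>. \<Theta> (rat_var \<beta>) = (if \<beta> \<in> V \<and> h \<beta> < n then a \<beta> * rat_var \<beta> + g \<beta> else rat_var \<beta>)" by blast
    define S where "S = {\<beta> \<in> V. h \<beta> = n}"
    have "{\<gamma> \<in> V. h \<gamma> < n} \<subseteq> V - S" by (auto simp: S_def)
    then have S: "S \<subseteq> V" "\<And>\<beta>. \<beta> \<in> S \<Longrightarrow> a \<beta> \<noteq> 0 \<and> a \<beta> \<in> ratfuns (V - S) \<and> g \<beta> \<in> ratfuns (V - S)"
      using ag ratfuns_mono[of "{\<gamma> \<in> V. h \<gamma> < n}" "V - S"] by (auto simp: S_def)
    obtain \<Psi> where P: "ratfuns_aut V \<Psi>"
      "\<And>\<beta>. \<Psi> (rat_var \<beta>) = (if \<beta> \<in> S then a \<beta> * rat_var \<beta> + g \<beta> else rat_var \<beta>)"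
      "\<And>f. f \<in> ratfuns (- S) \<Longrightarrow> \<Psi> f = f"
      using ratfuns_aut_parallel[OF S(1), of a g, OF S(2)] by blast
    have "\<Psi> (\<Theta> (rat_var \<beta>)) = (if \<beta> \<in> V \<and> h \<beta> < Suc n then a \<beta> * rat_var \<beta> + g \<beta> else rat_var \<beta>)" for \<beta>
    proof (cases "\<beta> \<in> V \<and> h \<beta> < n")
      case True
      then have "{\<gamma> \<in> V. h \<gamma> < h \<beta>} \<subseteq> - S" "\<beta> \<in> - S" by (auto simp: S_def)
      then have "a \<beta> * rat_var \<beta> + g \<beta> \<in> ratfuns (- S)"
        using ag[of \<beta>] True ratfuns_mono[of "{\<gamma> \<in> V. h \<gamma> < h \<beta>}" "- S"]
        by (auto intro!: subring_of_closed[OF ratfuns_subring] ratfuns_var)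
      then show ?thesis using True by (simp add: T P(3))
    next
      case False
      then have "\<beta> \<in> S \<longleftrightarrow> \<beta> \<in> V \<and> h \<beta> < Suc n" by (auto simp: S_def)
      then show ?thesis using False by (simp add: T(2) P(2))
    qed
    then show ?case using ratfuns_aut_comp[OF P(1) T(1)] by blast
  qed
  from this[of "Suc (Max (insert 0 (h ` V)))"] obtain \<Theta> where T: "ratfuns_aut V \<Theta>"
    "\<And>\<beta>. \<Theta> (rat_var \<beta>) = (if \<beta> \<in> V \<and> h \<beta> < Suc (Max (insert 0 (h ` V))) then a \<beta> * rat_var \<beta> + g \<beta> else rat_var \<beta>)"
    by blast
  have "h \<beta> < Suc (Max (insert 0 (h ` V)))" if "\<beta> \<in> V" for \<beta>
    using that \<open>finite V\<close> by (auto intro!: le_imp_less_Suc Max_ge)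
  then show ?thesis using T by (intro exI[of _ \<Theta>]) auto
qed

section \<open>Homomorphisms on subrings\<close>

definition hom_on :: "'b::field set \<Rightarrow> ('b \<Rightarrow> 'c::field) \<Rightarrow> bool" where
  "hom_on X f \<longleftrightarrow> subring_of X \<and> f 1 = 1 \<and> (\<forall>x\<in>X. \<forall>y\<in>X. f (x - y) = f x - f y \<and> f (x * y) = f x * f y)"

lemma hom_on:
  assumes "hom_on X f"
  shows "subring_of X" "f 1 = 1" "f 0 = 0" "x \<in> X \<Longrightarrow> y \<in> X \<Longrightarrow> f (x - y) = f x - f y"
    "x \<in> X \<Longrightarrow> y \<in> X \<Longrightarrow> f (x * y) = f x * f y" "x \<in> X \<Longrightarrow> f (- x) = - f x"
    "x \<in> X \<Longrightarrow> y \<in> X \<Longrightarrow> f (x + y) = f x + f y"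
proof -
  have X: "subring_of X" and d: "\<And>x y. x \<in> X \<Longrightarrow> y \<in> X \<Longrightarrow> f (x - y) = f x - f y"
    and m: "\<And>x y. x \<in> X \<Longrightarrow> y \<in> X \<Longrightarrow> f (x * y) = f x * f y" and "f 1 = 1"
    using assms by (auto simp: hom_on_def)
  have z: "f 0 = 0" using d[of 1 1] subring_of_closed(1)[OF X] by simp
  have n: "f (- x) = - f x" if "x \<in> X" for x using d[of 0 x] that z subring_of_closed[OF X] by simp
  have "f (x + y) = f x + f y" if "x \<in> X" "y \<in> X" for x y
    using d[of x "- y"] n[of y] that subring_of_closed(5)[OF X] by simp
  with X d m \<open>f 1 = 1\<close> z n show "subring_of X" "f 1 = 1" "f 0 = 0" "x \<in> X \<Longrightarrow> y \<in> X \<Longrightarrow> f (x - y) = f x - f y"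
    "x \<in> X \<Longrightarrow> y \<in> X \<Longrightarrow> f (x * y) = f x * f y" "x \<in> X \<Longrightarrow> f (- x) = - f x"
    "x \<in> X \<Longrightarrow> y \<in> X \<Longrightarrow> f (x + y) = f x + f y" by blast+
qed

section \<open>The ring generated by integers and a set\<close>

lemma int_adjoin_subring: "subring_of (int_adjoin S)"
  by (auto simp: subring_of_def intro: int_adjoin.intros)

lemma int_adjoin_least:
  assumes "subring_of X" "S \<subseteq> X" "x \<in> int_adjoin S"
  shows "x \<in> X"
  using assms(3) by induction (use assms(1,2) in \<open>auto simp: subring_of_closed\<close>)

text \<open>Sums of products of two factors form a ring, because multiplying out two of them and regrouping the four factors of each
  term gives such a sum again.\<close>

lemma int_adjoin_Un:
  fixes x :: "'k::field"
  assumes "x \<in> int_adjoin (G \<union> H)"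
  shows "\<exists>(m::nat) c f. (\<forall>k<m. c k \<in> int_adjoin G \<and> f k \<in> int_adjoin H) \<and> x = (\<Sum>k<m. c k * f k)"
proof -
  define L where "L = {xs :: ('k \<times> 'k) list. set xs \<subseteq> int_adjoin G \<times> int_adjoin H}"
  define T where "T = (\<lambda>xs. \<Sum>(c, f)\<leftarrow>xs. c * f) ` L"
  note r = subring_of_closed[OF int_adjoin_subring]
  have "subring_of T"
    unfolding subring_of_def
  proof (intro conjI ballI)
    have "[(1, 1)] \<in> L" by (simp add: L_def r)
    then show "1 \<in> T" unfolding T_def by force
  next
    fix x y assume "x \<in> T" "y \<in> T"
    then obtain xs ys where *: "xs \<in> L" "ys \<in> L" "x = (\<Sum>(c, f)\<leftarrow>xs. c * f)" "y = (\<Sum>(c, f)\<leftarrow>ys. c * f)"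
      unfolding T_def by blast
    have neg: "(\<Sum>(c, f)\<leftarrow>map (\<lambda>(c, f). (- c, f)) zs. c * f) = - (\<Sum>(c, f)\<leftarrow>zs. c * f)" for zs :: "('k \<times> 'k) list"
      by (induction zs) auto
    have "xs @ map (\<lambda>(c, f). (- c, f)) ys \<in> L" using *(1,2) by (auto simp: L_def r)
    moreover have "x - y = (\<Sum>(c, f)\<leftarrow>xs @ map (\<lambda>(c, f). (- c, f)) ys. c * f)"
      using neg[of ys] by (simp add: *)
    ultimately show "x - y \<in> T" unfolding T_def by blast
    have mul1: "(\<Sum>(c, f)\<leftarrow>map (\<lambda>(c', f'). (a * c', b * f')) zs. c * f) = a * b * (\<Sum>(c, f)\<leftarrow>zs. c * f)"
      for a b and zs :: "('k \<times> 'k) list"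
      by (induction zs) (auto simp: algebra_simps)
    have mul: "(\<Sum>(c, f)\<leftarrow>concat (map (\<lambda>(a, b). map (\<lambda>(c', f'). (a * c', b * f')) ys) zs). c * f) =
        (\<Sum>(c, f)\<leftarrow>zs. c * f) * y" for zs
    proof (induction zs)
      case (Cons ab zs)
      then show ?case using mul1[of "fst ab" "snd ab" ys]
        by (simp add: case_prod_unfold comp_def *(4) distrib_right)
    qed simp
    have "concat (map (\<lambda>(a, b). map (\<lambda>(c', f'). (a * c', b * f')) ys) xs) \<in> L"
      using *(1,2) by (fastforce simp: L_def r)
    then show "x * y \<in> T" unfolding T_def *(3) using mul[of xs, symmetric] by blast
  qed
  moreover have "G \<union> H \<subseteq> T"
  proof
    fix x assume "x \<in> G \<union> H"
    then have "[(x, 1)] \<in> L \<or> [(1, x)] \<in> L" by (auto simp: L_def r intro: int_adjoin.gen)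
    then show "x \<in> T" unfolding T_def by force
  qed
  ultimately have "x \<in> T" using int_adjoin_least assms by blast
  then obtain xs where xs: "set xs \<subseteq> int_adjoin G \<times> int_adjoin H" "x = (\<Sum>(c, f)\<leftarrow>xs. c * f)"
    unfolding T_def L_def by blast
  have "\<forall>k<length xs. fst (xs ! k) \<in> int_adjoin G \<and> snd (xs ! k) \<in> int_adjoin H"
    using xs(1) by (metis mem_Sigma_iff nth_mem prod.collapse subsetD)
  moreover have "x = (\<Sum>k<length xs. fst (xs ! k) * snd (xs ! k))"
    unfolding xs(2) by (simp add: sum_list_sum_nth case_prod_beta atLeast0LessThan)
  ultimately show ?thesis by (intro exI) (rule conjI)
qed

section \<open>The chain rule for triangular substitutions\<close>

text \<open>A permutation with a nonzero term in the Leibniz expansion never increases the height of an index and decreases it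
  unless the index is fixed.  As the total height is invariant, only the identity remains.\<close>

lemma det_triangular_height:
  fixes h :: "nat \<Rightarrow> nat"
  assumes M: "M \<in> carrier_mat n n"
    and tri: "\<And>k l. k < n \<Longrightarrow> l < n \<Longrightarrow> k \<noteq> l \<Longrightarrow> \<not> h l < h k \<Longrightarrow> M $$ (k, l) = 0"
  shows "det M = (\<Prod>k<n. M $$ (k, k))"
proof -
  have zero: "(\<Prod>i = 0..<n. M $$ (i, p i)) = 0" if p: "p permutes {0..<n}" and ne: "p \<noteq> id" for p
  proof (rule ccontr)
    assume prod: "(\<Prod>i = 0..<n. M $$ (i, p i)) \<noteq> 0"
    have nz: "M $$ (i, p i) \<noteq> 0" if "i < n" for i
    proof
      assume "M $$ (i, p i) = 0"
      then have "\<exists>i\<in>{0..<n}. M $$ (i, p i) = 0" using that by (intro bexI[of _ i]) auto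
      then have "(\<Prod>i = 0..<n. M $$ (i, p i)) = 0" by (intro prod_zero) auto
      then show False using prod by contradiction
    qed
    have pn: "p i < n" if "i < n" for i using that permutes_in_image[OF p, of i] by simp
    have step: "p i = i \<or> h (p i) < h i" if "i < n" for i
      using tri[OF that pn[OF that]] nz[OF that] by (cases "i = p i") auto
    obtain i where "p i \<noteq> i" using ne by (auto simp: fun_eq_iff)
    then have "i < n" using permutes_not_in[OF p] by fastforce
    then have "(\<Sum>i = 0..<n. h (p i)) < (\<Sum>i = 0..<n. h i)"
    proof (intro sum_strict_mono_ex1 ballI bexI[of _ i])
      show "h (p k) \<le> h k" if "k \<in> {0..<n}" for k using step[of k] that by auto
      show "h (p i) < h i" using step[of i] \<open>i < n\<close> \<open>p i \<noteq> i\<close> by simp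
    qed (use \<open>i < n\<close> in auto)
    moreover have "(\<Sum>i = 0..<n. h (p i)) = (\<Sum>i = 0..<n. h i)"
      using sum.permute[OF p, of h] by (simp add: comp_def)
    ultimately show False by simp
  qed
  have "det M = (\<Sum>p\<in>{p. p permutes {0..<n}}. signof p * (\<Prod>i = 0..<n. M $$ (i, p i)))"
    by (rule det_def'[OF M])
  also have "\<dots> = (\<Sum>p\<in>{id}. signof p * (\<Prod>i = 0..<n. M $$ (i, p i)))"
    by (rule sum.mono_neutral_right) (auto simp: finite_permutations permutes_id zero)
  finally show ?thesis by (simp add: sign_id atLeast0LessThan)
qed

lemma jacobian_carrier: "jacobian V R \<in> carrier_mat (card V) (card V)"
  by (simp add: jacobian_def Let_def)

text \<open>The chain rule presents the new Jacobian matrix as a product whose left factor is triangular with respect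
  to \<open>h\<close> and has the diagonal \<open>a\<close>.\<close>

lemma det_jacobian_triangular:
  fixes u u' :: "nat \<times> nat \<Rightarrow> 'a::idom ratfun"
  assumes V: "finite V"
    and grad: "\<And>\<beta>. \<beta> \<in> V \<Longrightarrow> \<exists>g. \<forall>\<gamma>. rat_pderiv \<gamma> (u' \<beta>) = a \<beta> * rat_pderiv \<gamma> (u \<beta>) +
        (\<Sum>\<delta>\<in>{\<delta> \<in> V. h \<delta> < (h \<beta> :: nat)}. g \<delta> * rat_pderiv \<gamma> (u \<delta>))"
  shows "det (jacobian V u') = (\<Prod>\<beta>\<in>V. a \<beta>) * det (jacobian V u)"
proof -
  define xs where "xs = sorted_list_of_set V"
  define n where "n = length xs"
  have bij: "bij_betw ((!) xs) {..<n} V"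
    using V by (intro bij_betw_nth) (auto simp: xs_def n_def)
  have inV: "xs ! k \<in> V" if "k < n" for k using bij_betwE[OF bij] that by simp
  have inj: "xs ! k = xs ! l \<longleftrightarrow> k = l" if "k < n" "l < n" for k l
    using bij_betw_imp_inj_on[OF bij] that by (auto simp: inj_on_def)
  obtain g where g: "\<And>\<beta> \<gamma>. \<beta> \<in> V \<Longrightarrow> rat_pderiv \<gamma> (u' \<beta>) = a \<beta> * rat_pderiv \<gamma> (u \<beta>) +
        (\<Sum>\<delta>\<in>{\<delta> \<in> V. h \<delta> < h \<beta>}. g \<beta> \<delta> * rat_pderiv \<gamma> (u \<delta>))"
    using bchoice[of V "\<lambda>\<beta> g. \<forall>\<gamma>. rat_pderiv \<gamma> (u' \<beta>) = a \<beta> * rat_pderiv \<gamma> (u \<beta>) +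
        (\<Sum>\<delta>\<in>{\<delta> \<in> V. h \<delta> < h \<beta>}. g \<delta> * rat_pderiv \<gamma> (u \<delta>))"] grad by blast
  define m where "m \<beta> \<delta> = (if \<delta> = \<beta> then a \<beta> else if h \<delta> < h \<beta> then g \<beta> \<delta> else 0)" for \<beta> \<delta>
  have m: "rat_pderiv \<gamma> (u' \<beta>) = (\<Sum>\<delta>\<in>V. m \<beta> \<delta> * rat_pderiv \<gamma> (u \<delta>))" if "\<beta> \<in> V" for \<beta> \<gamma>
  proof -
    have "(\<Sum>\<delta>\<in>V. m \<beta> \<delta> * rat_pderiv \<gamma> (u \<delta>)) =
      (\<Sum>\<delta>\<in>insert \<beta> {\<delta> \<in> V. h \<delta> < h \<beta>}. m \<beta> \<delta> * rat_pderiv \<gamma> (u \<delta>))"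
      using V that by (intro sum.mono_neutral_right) (auto simp: m_def)
    also have "\<dots> = m \<beta> \<beta> * rat_pderiv \<gamma> (u \<beta>) + (\<Sum>\<delta>\<in>{\<delta> \<in> V. h \<delta> < h \<beta>}. m \<beta> \<delta> * rat_pderiv \<gamma> (u \<delta>))"
      using V by (intro sum.insert) auto
    also have "(\<Sum>\<delta>\<in>{\<delta> \<in> V. h \<delta> < h \<beta>}. m \<beta> \<delta> * rat_pderiv \<gamma> (u \<delta>)) =
        (\<Sum>\<delta>\<in>{\<delta> \<in> V. h \<delta> < h \<beta>}. g \<beta> \<delta> * rat_pderiv \<gamma> (u \<delta>))"
      by (intro sum.cong) (auto simp: m_def)
    finally show ?thesis by (simp add: g[OF that] m_def)
  qed
  define M where "M = mat n n (\<lambda>(k, l). m (xs ! k) (xs ! l))"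
  have J: "jacobian V w = mat n n (\<lambda>(k, l). rat_pderiv (xs ! l) (w (xs ! k)))" for w :: "nat \<times> nat \<Rightarrow> 'a ratfun"
    by (simp add: jacobian_def xs_def n_def Let_def)
  have "jacobian V u' = M * jacobian V u"
  proof (rule eq_matI)
    fix k l assume "k < dim_row (M * jacobian V u)" "l < dim_col (M * jacobian V u)"
    then have kl: "k < n" "l < n" by (simp_all add: M_def J)
    have "(\<Sum>\<delta>\<in>V. m (xs ! k) \<delta> * rat_pderiv (xs ! l) (u \<delta>)) =
        (\<Sum>i<n. m (xs ! k) (xs ! i) * rat_pderiv (xs ! l) (u (xs ! i)))"
      by (rule sum.reindex_bij_betw[OF bij, symmetric])
    then show "jacobian V u' $$ (k, l) = (M * jacobian V u) $$ (k, l)"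
      using kl by (simp add: J M_def scalar_prod_def m inV atLeast0LessThan)
  qed (simp_all add: J M_def)
  moreover have "det M = (\<Prod>k<n. M $$ (k, k))"
    by (rule det_triangular_height[where h = "\<lambda>k. h (xs ! k)"]) (auto simp: M_def m_def inj)
  moreover have "(\<Prod>k<n. M $$ (k, k)) = (\<Prod>k<n. a (xs ! k))" by (simp add: M_def m_def)
  moreover have "\<dots> = (\<Prod>\<beta>\<in>V. a \<beta>)" by (rule prod.reindex_bij_betw[OF bij])
  moreover have "det (M * jacobian V u) = det M * det (jacobian V u)"
    by (rule det_mult[of _ n]) (simp_all add: M_def J)
  ultimately show ?thesis by simp
qed

text \<open>By the chain rule these include all rational expressions in the functions \<open>u \<delta>\<close>, \<open>\<delta> \<in> D\<close>.  Stating this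
  as closure under field operations avoids writing down partial derivatives of the expressions.\<close>

definition gradient_span :: "(nat \<times> nat) set \<Rightarrow> (nat \<times> nat \<Rightarrow> 'a::idom ratfun) \<Rightarrow> 'a ratfun set" where
  "gradient_span D u = {f. \<exists>g. \<forall>\<gamma>. rat_pderiv \<gamma> f = (\<Sum>\<delta>\<in>D. g \<delta> * rat_pderiv \<gamma> (u \<delta>))}"

lemma gradient_spanI:
  "(\<And>\<gamma>. rat_pderiv \<gamma> f = (\<Sum>\<delta>\<in>D. g \<delta> * rat_pderiv \<gamma> (u \<delta>))) \<Longrightarrow> f \<in> gradient_span D u"
  unfolding gradient_span_def by auto

lemma gradient_span_subring: "subring_of (gradient_span D u)"
  unfolding subring_of_def
proof (intro conjI ballI)
  show "1 \<in> gradient_span D u" by (auto simp: gradient_span_def intro: exI[of _ "\<lambda>_. 0"])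
next
  fix x y assume "x \<in> gradient_span D u" "y \<in> gradient_span D u"
  then obtain g k where g: "\<And>\<gamma>. rat_pderiv \<gamma> x = (\<Sum>\<delta>\<in>D. g \<delta> * rat_pderiv \<gamma> (u \<delta>))"
    and k: "\<And>\<gamma>. rat_pderiv \<gamma> y = (\<Sum>\<delta>\<in>D. k \<delta> * rat_pderiv \<gamma> (u \<delta>))"
    unfolding gradient_span_def by blast
  have "rat_pderiv \<gamma> (x - y) = (\<Sum>\<delta>\<in>D. (g \<delta> - k \<delta>) * rat_pderiv \<gamma> (u \<delta>))" for \<gamma>
    by (simp add: rat_pderiv_diff g k left_diff_distrib sum_subtractf)
  then show "x - y \<in> gradient_span D u" by (rule gradient_spanI)
  have "rat_pderiv \<gamma> (x * y) = (\<Sum>\<delta>\<in>D. (y * g \<delta> + x * k \<delta>) * rat_pderiv \<gamma> (u \<delta>))" for \<gamma>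
  proof -
    have "rat_pderiv \<gamma> (x * y) = y * rat_pderiv \<gamma> x + x * rat_pderiv \<gamma> y"
      by (simp add: rat_pderiv_mult mult.commute)
    then show ?thesis by (simp add: g k distrib_right sum.distrib sum_distrib_left mult.assoc)
  qed
  then show "x * y \<in> gradient_span D u" by (rule gradient_spanI)
qed

lemma gradient_span_inverse: "f \<in> gradient_span D u \<Longrightarrow> inverse f \<in> gradient_span D u"
proof (cases "f = 0")
  case False
  assume "f \<in> gradient_span D u"
  then obtain g where g: "\<And>\<gamma>. rat_pderiv \<gamma> f = (\<Sum>\<delta>\<in>D. g \<delta> * rat_pderiv \<gamma> (u \<delta>))"
    unfolding gradient_span_def by blast
  have "rat_pderiv \<gamma> (inverse f) = (\<Sum>\<delta>\<in>D. (- (inverse f * inverse f) * g \<delta>) * rat_pderiv \<gamma> (u \<delta>))" for \<gamma>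
  proof -
    have "rat_pderiv \<gamma> (inverse f) = - (inverse f * inverse f) * rat_pderiv \<gamma> f"
      using False by (simp add: rat_pderiv_inverse)
    then show ?thesis by (simp only: g sum_distrib_left mult.assoc)
  qed
  then show ?thesis by (rule gradient_spanI)
qed simp

lemma gradient_span_gen:
  assumes "finite D" "\<delta> \<in> D" shows "u \<delta> \<in> gradient_span D u"
proof -
  have "rat_pderiv \<gamma> (u \<delta>) = (\<Sum>\<epsilon>\<in>D. (if \<epsilon> = \<delta> then 1 else 0) * rat_pderiv \<gamma> (u \<epsilon>))" for \<gamma>
    using assms by (simp add: if_distrib[of "\<lambda>x. x * _"] cong: if_cong)
  then show ?thesis by (rule gradient_spanI)
qed

lemma kernel_pderiv:
  "subring_of {f. rat_pderiv \<gamma> f = 0}" "rat_pderiv \<gamma> f = 0 \<Longrightarrow> rat_pderiv \<gamma> (inverse f) = 0"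
  by (simp_all add: subring_of_def rat_pderiv_diff rat_pderiv_mult)
     (cases "f = 0", simp_all add: rat_pderiv_inverse)

section \<open>Determinants over a field and at regular points\<close>

lemma invertible_mat_of_det:
  fixes A :: "'b::field mat"
  assumes A: "A \<in> carrier_mat n n" and "det A \<noteq> 0"
  shows "invertible_mat A"
proof -
  have "A \<in> Units (ring_mat TYPE('b) n ())" by (rule det_non_zero_imp_unit[OF assms])
  then obtain B where "B \<in> carrier_mat n n" "B * A = 1\<^sub>m n" "A * B = 1\<^sub>m n"
    unfolding Units_def by (auto simp: ring_mat_simps)
  then show ?thesis unfolding invertible_mat_def inverts_mat_def using A by auto
qed

lemma prod_const_filter:
  fixes c :: "'b::comm_monoid_mult"
  assumes "finite A" shows "(\<Prod>x\<in>A. if P x then c else 1) = c ^ card {x \<in> A. P x}"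
  using assms by (simp add: prod.inter_filter[symmetric])

context coeff_hom begin

lemma det_regular:
  assumes A: "A \<in> carrier_mat n n" and reg: "\<And>i j. i < n \<Longrightarrow> j < n \<Longrightarrow> rat_regular \<phi> z (A $$ (i, j))"
  shows "rat_regular \<phi> z (det A) \<and> rat_eval \<phi> z (det A) = det (map_mat (rat_eval \<phi> z) A)"
proof -
  have pn: "p i < n" if "p permutes {0..<n}" "i < n" for p i
    using permutes_in_image[OF that(1), of i] that(2) by simp
  have t: "rat_regular \<phi> z (\<Prod>i = 0..<n. A $$ (i, p i)) \<and>
      rat_eval \<phi> z (\<Prod>i = 0..<n. A $$ (i, p i)) = (\<Prod>i = 0..<n. rat_eval \<phi> z (A $$ (i, p i)))"
    if "p permutes {0..<n}" for p
    by (rule regular_prod) (use reg pn[OF that] in simp)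
  have s: "rat_regular \<phi> z (signof p) \<and> rat_eval \<phi> z (signof p) = signof p" for p :: "nat \<Rightarrow> nat"
    using regular_one[of z] regular_diff[of z 0 1] regular_zero[of z] by (cases p rule: sign_cases) auto
  have "rat_regular \<phi> z (signof p * (\<Prod>i = 0..<n. A $$ (i, p i))) \<and>
      rat_eval \<phi> z (signof p * (\<Prod>i = 0..<n. A $$ (i, p i))) = signof p * (\<Prod>i = 0..<n. rat_eval \<phi> z (A $$ (i, p i)))"
    if "p permutes {0..<n}" for p
    using t[OF that] s[of p] regular_mult[of z "signof p" "\<Prod>i = 0..<n. A $$ (i, p i)"] by simp
  moreover have "det (map_mat (rat_eval \<phi> z) A) =
      (\<Sum>p\<in>{p. p permutes {0..<n}}. signof p * (\<Prod>i = 0..<n. rat_eval \<phi> z (A $$ (i, p i))))"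
    using A by (subst det_def'[of _ n]) (auto intro!: sum.cong prod.cong arg_cong2[of _ _ _ _ "(*)"] simp: pn)
  ultimately show ?thesis
    using regular_sum[of "{p. p permutes {0..<n}}" z "\<lambda>p. signof p * (\<Prod>i = 0..<n. A $$ (i, p i))"]
    by (simp add: det_def'[OF A])
qed

lemma regular_hom_on: "hom_on {f. rat_regular \<phi> z f} (rat_eval \<phi> z)"
  using regular_one regular_diff regular_mult by (simp add: hom_on_def subring_of_def)

end

section \<open>Clearing a column against its neighbours\<close>

text \<open>Let \<open>A\<close> be upper unitriangular.  Subtract from column \<open>p\<close> suitable multiples of the columns
  \<open>p - 1, \<dots>, p - k\<close>, in this order, so as to clear its entries in the rows of these numbers.  The result, as a linear combination
  of columns, takes the value \<open>elim A p k v\<close> in a further row \<open>v\<close>.\<close>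

primrec elim :: "(nat \<Rightarrow> nat \<Rightarrow> 'b::comm_ring_1) \<Rightarrow> nat \<Rightarrow> nat \<Rightarrow> (nat \<Rightarrow> 'b) \<Rightarrow> 'b" where
  "elim A p 0 v = v p"
| "elim A p (Suc k) v = elim A p k v - v (p - Suc k) * elim A p k (A (p - Suc k))"

lemma elim_zero: "k \<le> p \<Longrightarrow> (\<And>x. p - k \<le> x \<Longrightarrow> x \<le> p \<Longrightarrow> v x = 0) \<Longrightarrow> elim A p k v = 0"
  by (induction k) (auto simp: Suc_le_eq)

lemma elim_pivot: "k \<le> p \<Longrightarrow> v p = 1 \<Longrightarrow> (\<And>x. x < p \<Longrightarrow> v x = 0) \<Longrightarrow> elim A p k v = 1"
  by (induction k) auto

lemma elim_diff: "elim A p k (\<lambda>d. v d - w d) = elim A p k v - elim A p k w"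
  by (induction k) (auto simp: algebra_simps)

lemma elim_times: "elim A p k (\<lambda>d. m * v d) = m * elim A p k v"
  by (induction k) (auto simp: algebra_simps)

text \<open>Linearity in the row, expressed by unit rows; this is how the combination of columns becomes a matrix.\<close>

lemma elim_expand:
  assumes "k < p" "p \<le> j"
  shows "elim A p k v = (\<Sum>d\<in>{1..j}. v d * elim A p k (\<lambda>x. if x = d then 1 else 0))"
  using assms(1)
proof (induction k)
  case 0
  have "(\<Sum>d\<in>{1..j}. v d * (if p = d then 1 else 0)) = v p"
    using 0 assms(2) by (simp add: if_distrib[of "\<lambda>x. _ * x"] cong: if_cong)
  then show ?case by simp
next
  case (Suc k)
  let ?e = "\<lambda>d x. if x = d then 1 else 0 :: 'a"
  have "p - Suc k \<in> {1..j}" using Suc.prems assms(2) by auto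
  then have v: "v (p - Suc k) = (\<Sum>d\<in>{1..j}. v d * ?e d (p - Suc k))"
    by (simp add: if_distrib[of "\<lambda>x. _ * x"] cong: if_cong)
  have IH: "elim A p k v = (\<Sum>d\<in>{1..j}. v d * elim A p k (?e d))" using Suc by simp
  have "elim A p (Suc k) v = elim A p k v - v (p - Suc k) * elim A p k (A (p - Suc k))" by simp
  also have "\<dots> = (\<Sum>d\<in>{1..j}. v d * elim A p k (?e d)) -
      (\<Sum>d\<in>{1..j}. v d * ?e d (p - Suc k)) * elim A p k (A (p - Suc k))"
    using v IH by simp
  also have "\<dots> = (\<Sum>d\<in>{1..j}. v d * elim A p (Suc k) (?e d))"
    by (simp only: sum_distrib_right sum_subtractf[symmetric] elim.simps right_diff_distrib mult.assoc)
  finally show ?case .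
qed

text \<open>The multiple of column \<open>c\<close> is chosen to clear row \<open>c\<close>, and the columns \<open>d < c\<close> used afterwards
  vanish in that row.\<close>

lemma elim_eliminated:
  assumes "\<And>d. A d d = 1" "\<And>c d. d < c \<Longrightarrow> A c d = 0" "k \<le> p" "p - k \<le> c" "c < p"
  shows "elim A p k (A c) = 0"
  using assms(3,4)
proof (induction k)
  case (Suc k)
  then show ?case using assms(1,2,5) by (cases "c = p - Suc k") auto
qed (use assms(5) in simp)

section \<open>Sweeping through the free variables\<close>

locale perm =
  fixes r :: nat and \<pi> :: "nat \<Rightarrow> nat"
  assumes perm: "\<pi> permutes {1..r}"
begin

abbreviation \<rho> :: "nat \<Rightarrow> nat" where "\<rho> \<equiv> inv \<pi>"
abbreviation V :: "(nat \<times> nat) set" where "V \<equiv> Vw r \<pi>"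

lemma rho_pi [simp]: "\<rho> (\<pi> s) = s" and pi_rho [simp]: "\<pi> (\<rho> a) = a"
  using permutes_inverses[OF perm] by auto

lemma rho_inj [simp]: "\<rho> a = \<rho> b \<longleftrightarrow> a = b"
  by (metis pi_rho)

lemma rho_eq_iff: "\<rho> a = s \<longleftrightarrow> a = \<pi> s"
  by auto

lemma pi_range: "\<pi> s \<in> {1..r} \<longleftrightarrow> s \<in> {1..r}"
  using permutes_in_image[OF perm] .

lemma rho_range: "\<rho> s \<in> {1..r} \<longleftrightarrow> s \<in> {1..r}"
  using permutes_in_image[OF permutes_inv[OF perm]] .

lemma V_iff: "(a, b) \<in> V \<longleftrightarrow> 1 \<le> a \<and> a < b \<and> b \<le> r \<and> \<rho> b < \<rho> a"
  by (auto simp: Inv_def)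

lemma finite_V: "finite V"
  by (rule finite_subset[of _ "{1..r} \<times> {1..r}"]) (auto simp: V_iff)

text \<open>The free variables are processed in decreasing order, so these are the ones that precede \<open>\<alpha>\<close>.\<close>

definition prior :: "nat \<times> nat \<Rightarrow> (nat \<times> nat) set" where
  "prior \<alpha> = {\<beta> \<in> V. idx_less \<pi> \<alpha> \<beta>}"

lemma prior_iff: "(a, b) \<in> prior (p, j) \<longleftrightarrow> (a, b) \<in> V \<and> (b < j \<or> b = j \<and> \<rho> a < \<rho> p)"
  by (auto simp: prior_def idx_less_def)

lemma prior_irrefl: "\<alpha> \<notin> prior \<alpha>"
  by (cases \<alpha>) (simp add: prior_iff)

lemma prior_V: "\<beta> \<in> prior \<alpha> \<Longrightarrow> \<beta> \<in> V"
  by (simp add: prior_def)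

text \<open>Among the rows with labels up to \<open>j\<close>, the one directly above row \<open>p\<close>, for \<open>\<alpha> = (p, j)\<close>.\<close>

definition row_above :: "nat \<times> nat \<Rightarrow> nat" where
  "row_above \<alpha> = \<pi> (Max {s. 1 \<le> s \<and> s < \<rho> (fst \<alpha>) \<and> \<pi> s \<le> snd \<alpha>})"

lemma row_above:
  assumes "(p, j) \<in> V"
  shows "1 \<le> row_above (p, j)" "row_above (p, j) \<le> j" "\<rho> j \<le> \<rho> (row_above (p, j))" "\<rho> (row_above (p, j)) < \<rho> p"
    "\<And>c. 1 \<le> c \<Longrightarrow> c \<le> j \<Longrightarrow> \<rho> c < \<rho> p \<Longrightarrow> \<rho> c \<le> \<rho> (row_above (p, j))" "row_above (p, j) \<noteq> p"
proof -
  let ?S = "{s. 1 \<le> s \<and> s < \<rho> p \<and> \<pi> s \<le> j}"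
  have m: "\<rho> c \<in> ?S" if "1 \<le> c" "c \<le> j" "\<rho> c < \<rho> p" for c
    using that assms rho_range[of c] by (auto simp: V_iff)
  have f: "finite ?S" by (rule finite_subset[of _ "{..\<rho> p}"]) auto
  have j: "\<rho> j \<in> ?S" using assms by (intro m) (auto simp: V_iff)
  have M: "Max ?S \<in> ?S" using Max_in[OF f] j by blast
  have p: "row_above (p, j) = \<pi> (Max ?S)" by (simp add: row_above_def)
  have rp: "\<rho> p \<in> {1..r}" using assms rho_range[of p] by (auto simp: V_iff)
  show "1 \<le> row_above (p, j)" using M rp pi_range[of "Max ?S"] by (simp add: p)
  show "row_above (p, j) \<le> j" "\<rho> (row_above (p, j)) < \<rho> p" using M by (simp_all add: p)
  then show "row_above (p, j) \<noteq> p" by auto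
  show "\<rho> j \<le> \<rho> (row_above (p, j))" using Max_ge[OF f j] by (simp add: p)
  show "\<rho> c \<le> \<rho> (row_above (p, j))" if "1 \<le> c" "c \<le> j" "\<rho> c < \<rho> p" for c
    using Max_ge[OF f m[OF that]] by (simp add: p)
qed

lemma row_above_prior: "(p, j) \<in> V \<Longrightarrow> row_above (p, j) = j \<or> (row_above (p, j), j) \<in> prior (p, j)"
  using row_above[of p j] by (auto simp: prior_iff V_iff le_less)

text \<open>Entries of the partially processed matrix: the free positions outside \<open>P\<close> still count as zero.\<close>

definition entry :: "(nat \<times> nat) set \<Rightarrow> (nat \<times> nat \<Rightarrow> 'b::zero_neq_one) \<Rightarrow> nat \<Rightarrow> nat \<Rightarrow> 'b" where
  "entry P u a b = (if a = b then 1 else if (a, b) \<in> P then u (a, b) else 0)"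

text \<open>For \<open>\<alpha> = (p, j)\<close> and \<open>m = u \<alpha>\<close>, a step replaces row \<open>p\<close> by \<open>m\<close> times the difference of row
  \<open>row_above \<alpha>\<close> and row \<open>p\<close>, and divides column \<open>p\<close> by the new pivot \<open>-m\<close>.  It adds multiples of column \<open>p\<close>,
  first cleared against the columns in between, to the columns on its left in order to remove the entries that row \<open>p\<close> has acquired
  there.  An entry is thereby multiplied by \<open>scale\<close> and increased by \<open>shift\<close>.  The entry at \<open>\<alpha>\<close> itself was zero before
  the step; there \<open>u\<close> stores the variable, and the scaling factor is the entry above.\<close>

definition scale :: "nat \<times> nat \<Rightarrow> (nat \<times> nat \<Rightarrow> 'b::field) \<Rightarrow> nat \<times> nat \<Rightarrow> 'b" where
  "scale \<alpha> u \<beta> =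
     (if \<beta> = \<alpha> then entry (prior \<alpha>) u (row_above \<alpha>) (snd \<alpha>)
      else if \<beta> \<in> prior \<alpha> \<and> fst \<beta> = fst \<alpha> then - u \<alpha>
      else if \<beta> \<in> prior \<alpha> \<and> snd \<beta> = fst \<alpha> then - inverse (u \<alpha>)
      else 1)"

text \<open>Rows above row \<open>p\<close> receive nothing from column \<open>p\<close>, by \<open>elim_above\<close>.  Making this part of the
  formula shows that row \<open>row_above \<alpha>\<close> does not change, which the triangularity of a step rests on.\<close>

definition shift :: "nat \<times> nat \<Rightarrow> (nat \<times> nat \<Rightarrow> 'b::field) \<Rightarrow> nat \<times> nat \<Rightarrow> 'b" where
  "shift \<alpha> u \<beta> =
     (if \<beta> \<in> prior \<alpha> \<and> fst \<beta> = fst \<alpha> then u \<alpha> * entry (prior \<alpha>) u (row_above \<alpha>) (snd \<beta>)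
      else if \<beta> \<in> prior \<alpha> \<and> snd \<beta> < fst \<alpha> \<and> \<rho> (fst \<alpha>) < \<rho> (fst \<beta>) then
        entry (prior \<alpha>) u (row_above \<alpha>) (snd \<beta>) *
        elim (entry (prior \<alpha>) u) (fst \<alpha>) (fst \<alpha> - Suc (snd \<beta>)) (entry (prior \<alpha>) u (fst \<beta>))
      else 0)"

definition step :: "nat \<times> nat \<Rightarrow> (nat \<times> nat \<Rightarrow> 'b::field) \<Rightarrow> nat \<times> nat \<Rightarrow> 'b" where
  "step \<alpha> u \<beta> = scale \<alpha> u \<beta> * u \<beta> + shift \<alpha> u \<beta>"

text \<open>Row \<open>row_above \<alpha>\<close> stays as it is; \<open>\<alpha>\<close> enters the factors of row \<open>p\<close> and column \<open>p\<close>; and a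
  column \<open>b < p\<close> is changed by row \<open>row_above \<alpha>\<close> and by the columns from \<open>b + 1\<close> to \<open>p\<close>.\<close>

definition height :: "nat \<times> nat \<Rightarrow> nat \<times> nat \<Rightarrow> nat" where
  "height \<alpha> \<beta> = (if \<beta> = \<alpha> then 1 else if fst \<beta> = row_above \<alpha> then 0 else if fst \<beta> = fst \<alpha> then 2
     else if snd \<beta> \<le> fst \<alpha> then 2 + (fst \<alpha> - snd \<beta>) else 0)"

lemma step_outside: "\<beta> \<noteq> \<alpha> \<Longrightarrow> \<beta> \<notin> prior \<alpha> \<Longrightarrow> step \<alpha> u \<beta> = u \<beta>"
  by (simp add: step_def scale_def shift_def)

lemma elim_mem:
  assumes "subring_of X" "k \<le> p" "\<And>d. d \<in> {p - k..p} \<Longrightarrow> v d \<in> X" "\<And>c d. d \<in> {p - k..p} \<Longrightarrow> A c d \<in> X"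
  shows "elim A p k v \<in> X"
  using assms(2-)
proof (induction k arbitrary: v)
  case (Suc k)
  have 1: "elim A p k v \<in> X" by (rule Suc.IH) (use Suc.prems in auto)
  have 2: "elim A p k (A (p - Suc k)) \<in> X" by (rule Suc.IH) (use Suc.prems in auto)
  have "v (p - Suc k) \<in> X" using Suc.prems by auto
  with 1 2 show ?case by (simp add: subring_of_closed[OF assms(1)])
qed simp

lemma entry_mem:
  assumes "subring_of X" "(a, b) \<in> P \<Longrightarrow> u (a, b) \<in> X"
  shows "entry P u a b \<in> X"
  using assms(2) by (simp add: entry_def subring_of_closed[OF assms(1)])

text \<open>The shift is an integral polynomial in processed entries of smaller height and, in row \<open>p\<close> only, the new variable.
  With \<open>X\<close> arbitrary, this covers rational functions in given variables, gradients, kernels of derivations and rings of Laurent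
  polynomials at once.\<close>

lemma shift_mem:
  assumes X: "subring_of X" and \<alpha>: "\<alpha> \<in> V"
    and u: "\<And>\<gamma>. \<gamma> \<in> prior \<alpha> \<Longrightarrow> height \<alpha> \<gamma> < height \<alpha> \<beta> \<Longrightarrow> u \<gamma> \<in> X"
    and u\<alpha>: "fst \<beta> = fst \<alpha> \<Longrightarrow> height \<alpha> \<alpha> < height \<alpha> \<beta> \<Longrightarrow> u \<alpha> \<in> X"
  shows "shift \<alpha> u \<beta> \<in> X"
proof -
  obtain p j c b where [simp]: "\<alpha> = (p, j)" "\<beta> = (c, b)" by (metis surj_pair)
  let ?q = "row_above (p, j)" and ?E = "entry (prior (p, j)) u"
  have q: "?q \<noteq> p" "\<rho> ?q < \<rho> p" using row_above[of p j] \<alpha> by auto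
  consider "(c, b) \<in> prior (p, j)" "c = p" | "(c, b) \<in> prior (p, j)" "c \<noteq> p" "b < p" "\<rho> p < \<rho> c"
    | "\<not> ((c, b) \<in> prior (p, j) \<and> (c = p \<or> b < p \<and> \<rho> p < \<rho> c))" by blast
  then show ?thesis
  proof cases
    case 1
    then have ne: "(c, b) \<noteq> \<alpha>" using prior_irrefl[of \<alpha>] by auto
    have "?E ?q b \<in> X"
      using X ne 1 q by (intro entry_mem u) (auto simp: height_def)
    moreover have "u \<alpha> \<in> X" using ne 1 q by (intro u\<alpha>) (auto simp: height_def)
    ultimately show ?thesis using 1 by (simp add: shift_def subring_of_closed[OF X])
  next
    case 2
    then have ne: "(c, b) \<noteq> \<alpha>" "c \<noteq> ?q" using prior_irrefl[of \<alpha>] q by auto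
    have h: "height (p, j) (c, b) = 2 + (p - b)" using ne 2 by (simp add: height_def)
    have "?E ?q b \<in> X" using ne 2 q
      by (intro entry_mem[OF X] u) (auto simp: height_def)
    moreover have E: "?E x d \<in> X" if "b < d" "d \<le> p" for x d
    proof -
      have "height (p, j) (x, d) < 2 + (p - b)" using that 2(3) by (auto simp: height_def)
      then show ?thesis by (intro entry_mem[OF X] u) (simp_all add: h)
    qed
    have "elim ?E p (p - Suc b) (?E c) \<in> X"
      using 2 by (intro elim_mem X E) auto
    ultimately show ?thesis using 2 by (simp add: shift_def subring_of_closed[OF X])
  qed (auto simp: shift_def subring_of_closed[OF X])
qed

lemma scale_mem:
  assumes X: "subring_of X" and \<alpha>: "\<alpha> \<in> V"
    and u: "\<And>\<gamma>. \<gamma> \<in> insert \<alpha> (prior \<alpha>) \<Longrightarrow> height \<alpha> \<gamma> < height \<alpha> \<beta> \<Longrightarrow> u \<gamma> \<in> X"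
    and iu: "height \<alpha> \<alpha> < height \<alpha> \<beta> \<Longrightarrow> inverse (u \<alpha>) \<in> X"
  shows "scale \<alpha> u \<beta> \<in> X"
proof -
  obtain p j c b where [simp]: "\<alpha> = (p, j)" "\<beta> = (c, b)" by (metis surj_pair)
  let ?q = "row_above (p, j)"
  have q: "?q \<noteq> p" "\<rho> ?q < \<rho> p" using row_above[of p j] \<alpha> by auto
  consider "(c, b) = (p, j)" | "(c, b) \<in> prior (p, j)" "(c, b) \<noteq> (p, j)" "c = p"
    | "(c, b) \<in> prior (p, j)" "(c, b) \<noteq> (p, j)" "c \<noteq> p" "b = p" 
    | "(c, b) \<noteq> (p, j)" "\<not> ((c, b) \<in> prior (p, j) \<and> (c = p \<or> b = p))"
    by blast
  then show ?thesis
  proof cases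
    case 1
    have "entry (prior (p, j)) u ?q j \<in> X"
      using 1 q by (intro entry_mem[OF X] u) (auto simp: height_def)
    then show ?thesis using 1 by (simp add: scale_def)
  next
    case 2
    have "u \<alpha> \<in> X" using 2 q by (intro u) (auto simp: height_def)
    then show ?thesis using 2 by (simp add: scale_def subring_of_closed[OF X])
  next
    case 3
    then have "c \<noteq> ?q" using q by (auto simp: prior_iff V_iff)
    then have "inverse (u \<alpha>) \<in> X" using 3 q by (intro iu) (auto simp: height_def)
    then show ?thesis using 3 by (simp add: scale_def subring_of_closed[OF X])
  qed (auto simp: scale_def subring_of_closed[OF X])
qed

lemma scale_nonzero:
  assumes "\<alpha> \<in> V" "\<And>\<gamma>. \<gamma> \<in> V \<Longrightarrow> u \<gamma> \<noteq> 0"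
  shows "scale \<alpha> u \<beta> \<noteq> 0"
proof -
  obtain p j where [simp]: "\<alpha> = (p, j)" by (metis surj_pair)
  have "entry (prior \<alpha>) u (row_above \<alpha>) (snd \<alpha>) \<noteq> 0"
    using assms row_above_prior[of p j] by (auto simp: entry_def prior_iff)
  then show ?thesis using assms by (simp add: scale_def)
qed

text \<open>Column \<open>j\<close> is processed from the top row downwards; positions that are not free are skipped.\<close>

primrec sweep :: "nat \<Rightarrow> nat \<Rightarrow> (nat \<times> nat \<Rightarrow> 'b::field) \<Rightarrow> nat \<times> nat \<Rightarrow> 'b" where
  "sweep j 0 u = u"
| "sweep j (Suc s) u = (if (\<pi> (Suc s), j) \<in> V then step (\<pi> (Suc s), j) (sweep j s u) else sweep j s u)"

primrec sweep_cols :: "nat \<Rightarrow> (nat \<times> nat \<Rightarrow> 'b::field) \<Rightarrow> nat \<times> nat \<Rightarrow> 'b" where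
  "sweep_cols 0 u = u"
| "sweep_cols (Suc j) u = sweep (Suc j) r (sweep_cols j u)"

definition swept :: "nat \<Rightarrow> nat \<Rightarrow> (nat \<times> nat) set" where
  "swept j s = {(a, b) \<in> V. b < j \<or> b = j \<and> \<rho> a \<le> s}"

lemma swept_step: "(\<pi> (Suc s), j) \<in> V \<Longrightarrow> swept j s = prior (\<pi> (Suc s), j)"
  "(\<pi> (Suc s), j) \<in> V \<Longrightarrow> swept j (Suc s) = insert (\<pi> (Suc s), j) (swept j s)"
  "(\<pi> (Suc s), j) \<notin> V \<Longrightarrow> swept j (Suc s) = swept j s"
  by (auto simp: swept_def prior_iff le_Suc_eq less_Suc_eq_le rho_eq_iff)

lemma swept_0: "swept (Suc 0) s = {}"
  by (auto simp: swept_def V_iff)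

lemma rho_bounds: "(a, b) \<in> V \<Longrightarrow> 1 \<le> \<rho> a \<and> \<rho> a \<le> r"
  using rho_range[of a] by (simp add: V_iff)

lemma swept_full: "swept j r = {(a, b) \<in> V. b \<le> j}"
  using rho_bounds by (auto simp: swept_def le_less)

lemma swept_Suc: "swept (Suc j) 0 = swept j r"
  unfolding swept_full by (auto simp: swept_def less_Suc_eq_le dest: rho_bounds)

lemma swept_all: "swept r r = V"
  unfolding swept_full by (auto simp: V_iff)

lemma sweep_1: "sweep (Suc 0) s u = u"
proof -
  have "(a, Suc 0) \<notin> V" for a by (auto simp: V_iff)
  then show ?thesis by (induction s) simp_all
qed

text \<open>Two points, possibly over different fields, are swept in parallel, so that a sweep can be compared with its image under
  evaluation.\<close>

lemma sweep_induct [consumes 0, case_names init step]: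
  assumes init: "Q {} u v"
    and step: "\<And>\<alpha> u v. \<alpha> \<in> V \<Longrightarrow> Q (prior \<alpha>) u v \<Longrightarrow> Q (insert \<alpha> (prior \<alpha>)) (step \<alpha> u) (step \<alpha> v)"
  shows "Q (swept (Suc j) s) (sweep (Suc j) s (sweep_cols j u)) (sweep (Suc j) s (sweep_cols j v))"
proof (induction j arbitrary: s)
  case 0
  then show ?case using init by (simp add: swept_0 sweep_1)
next
  case (Suc j)
  show ?case
  proof (induction s)
    case 0
    then show ?case using Suc[of r] by (simp add: swept_Suc)
  next
    case IH: (Suc s)
    show ?case
    proof (cases "(\<pi> (Suc s), Suc (Suc j)) \<in> V")
      case True
      then show ?thesis using step[OF True] IH by (simp add: swept_step)
    next
      case False
      then show ?thesis using IH by (simp add: swept_step)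
    qed
  qed
qed

lemma sweep_cols_induct [case_names init step]:
  assumes "Q {} u v"
    and "\<And>\<alpha> u v. \<alpha> \<in> V \<Longrightarrow> Q (prior \<alpha>) u v \<Longrightarrow> Q (insert \<alpha> (prior \<alpha>)) (step \<alpha> u) (step \<alpha> v)"
  shows "Q V (sweep_cols r u) (sweep_cols r v)"
  using sweep_induct[of Q u v r 0, OF assms] by (simp add: swept_Suc swept_all)

lemma sweep_cols_induct1 [case_names init step]:
  assumes "Q {} u"
    and "\<And>\<alpha> u. \<alpha> \<in> V \<Longrightarrow> Q (prior \<alpha>) u \<Longrightarrow> Q (insert \<alpha> (prior \<alpha>)) (step \<alpha> u)"
  shows "Q V (sweep_cols r u)"
  by (rule sweep_cols_induct[of "\<lambda>P u v. Q P u" u u]) (use assms in auto)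

section \<open>Sweeping commutes with homomorphisms\<close>

lemma entry_hom: "hom_on X f \<Longrightarrow> f (entry P u a b) = entry P (\<lambda>\<beta>. f (u \<beta>)) a b"
  by (simp add: entry_def hom_on)

lemma elim_hom:
  assumes "hom_on X f" "k \<le> p" "\<And>d. v d \<in> X" "\<And>c d. A c d \<in> X"
  shows "f (elim A p k v) = elim (\<lambda>c d. f (A c d)) p k (\<lambda>d. f (v d))"
  using assms(2,3)
proof (induction k arbitrary: v)
  case (Suc k)
  have "elim A p k v \<in> X" "elim A p k (A (p - Suc k)) \<in> X"
    using Suc.prems assms by (auto intro!: elim_mem hom_on(1))
  moreover have "f (elim A p k v) = elim (\<lambda>c d. f (A c d)) p k (\<lambda>d. f (v d))"
    "f (elim A p k (A (p - Suc k))) = elim (\<lambda>c d. f (A c d)) p k (\<lambda>d. f (A (p - Suc k) d))"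
    using Suc.prems assms(4) by (auto intro!: Suc.IH)
  ultimately show ?case
    using Suc.prems by (simp add: hom_on[OF assms(1)] subring_of_closed[OF hom_on(1)[OF assms(1)]])
qed simp

text \<open>A step uses ring operations and the inverse of \<open>u \<alpha>\<close>, and nothing else.\<close>

lemma step_hom:
  assumes f: "hom_on X f" and \<alpha>: "\<alpha> \<in> V" and u: "\<And>\<beta>. u \<beta> \<in> X"
    and i: "inverse (u \<alpha>) \<in> X" "f (inverse (u \<alpha>)) = inverse (f (u \<alpha>))"
  shows "step \<alpha> u \<beta> \<in> X \<and> f (step \<alpha> u \<beta>) = step \<alpha> (\<lambda>\<beta>. f (u \<beta>)) \<beta>"
proof -
  note X = hom_on(1)[OF f]
  have E: "entry P u a b \<in> X" for P a b by (rule entry_mem[OF X u])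
  have c: "scale \<alpha> u \<beta> \<in> X" and s: "shift \<alpha> u \<beta> \<in> X"
    by (rule scale_mem[OF X \<alpha>], use u i in auto)
      (rule shift_mem[OF X \<alpha>], use u in auto)
  have l: "elim (entry (prior \<alpha>) u) (fst \<alpha>) (fst \<alpha> - Suc b) (entry (prior \<alpha>) u a) \<in> X" for a b
    by (rule elim_mem[OF X]) (use E in auto)
  have fl: "f (elim (entry (prior \<alpha>) u) (fst \<alpha>) (fst \<alpha> - Suc b) (entry (prior \<alpha>) u a)) =
      elim (entry (prior \<alpha>) (\<lambda>\<beta>. f (u \<beta>))) (fst \<alpha>) (fst \<alpha> - Suc b) (entry (prior \<alpha>) (\<lambda>\<beta>. f (u \<beta>)) a)" for a b
    by (subst elim_hom[OF f]) (use E in \<open>auto simp: entry_hom[OF f]\<close>)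
  have fc: "f (scale \<alpha> u \<beta>) = scale \<alpha> (\<lambda>\<beta>. f (u \<beta>)) \<beta>"
    by (simp add: scale_def entry_hom[OF f] hom_on[OF f] u i)
  have fs: "f (shift \<alpha> u \<beta>) = shift \<alpha> (\<lambda>\<beta>. f (u \<beta>)) \<beta>"
    unfolding shift_def by (simp add: entry_hom[OF f] hom_on[OF f] u E l fl)
  show ?thesis
    using c s u by (simp add: step_def hom_on[OF f] subring_of_closed[OF X] fc fs)
qed

text \<open>A single step is a triangular substitution, so the whole sweep is the restriction to the variables of
  an automorphism.\<close>

lemma step_aut:
  assumes \<alpha>: "\<alpha> \<in> V"
  shows "\<exists>\<Theta>. ratfuns_aut V \<Theta> \<and> (\<forall>\<beta>. \<Theta> (rat_var \<beta>) = step \<alpha> (rat_var :: _ \<Rightarrow> 'a::idom ratfun) \<beta>)"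
proof -
  let ?D = "\<lambda>\<beta>. ratfuns {\<gamma> \<in> V. height \<alpha> \<gamma> < height \<alpha> \<beta>} :: 'a ratfun set"
  have m: "rat_var \<gamma> \<in> ?D \<beta>" if "\<gamma> \<in> insert \<alpha> (prior \<alpha>)" "height \<alpha> \<gamma> < height \<alpha> \<beta>" for \<gamma> \<beta>
    using that \<alpha> by (intro ratfuns_var) (auto dest: prior_V)
  have "scale \<alpha> rat_var \<beta> \<noteq> (0 :: 'a ratfun) \<and> scale \<alpha> rat_var \<beta> \<in> ?D \<beta> \<and> shift \<alpha> rat_var \<beta> \<in> ?D \<beta>" for \<beta>
  proof (intro conjI)
    show "scale \<alpha> rat_var \<beta> \<noteq> (0 :: 'a ratfun)"
      by (rule scale_nonzero[OF \<alpha>]) simp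
    show "scale \<alpha> rat_var \<beta> \<in> ?D \<beta>"
      by (rule scale_mem[OF ratfuns_subring \<alpha>]) (use m ratfuns_inverse in blast)+
    show "shift \<alpha> rat_var \<beta> \<in> ?D \<beta>"
      by (rule shift_mem[OF ratfuns_subring \<alpha>]) (use m in blast)+
  qed
  then obtain \<Theta> where T: "ratfuns_aut V \<Theta>" "\<And>\<beta>. \<Theta> (rat_var \<beta>) =
      (if \<beta> \<in> V then scale \<alpha> rat_var \<beta> * rat_var \<beta> + shift \<alpha> rat_var \<beta> else (rat_var \<beta> :: 'a ratfun))"
    using ratfuns_aut_triangular[OF finite_V, of "scale \<alpha> rat_var" "height \<alpha>" "shift \<alpha> rat_var"] by blast
  have "\<Theta> (rat_var \<beta>) = step \<alpha> rat_var \<beta>" for \<beta>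
  proof (cases "\<beta> \<in> V")
    case True
    then show ?thesis by (simp add: T(2) step_def)
  next
    case False
    then have "step \<alpha> rat_var \<beta> = (rat_var \<beta> :: 'a ratfun)"
      using \<alpha> prior_V by (intro step_outside) blast+
    then show ?thesis using False by (simp add: T(2))
  qed
  with T(1) show ?thesis by blast
qed

lemma sweep_cols_aut: "\<exists>\<Theta>. ratfuns_aut V \<Theta> \<and> sweep_cols r (rat_var :: _ \<Rightarrow> 'a::idom ratfun) = (\<lambda>\<beta>. \<Theta> (rat_var \<beta>))"
proof (rule sweep_cols_induct1[of "\<lambda>P u. \<exists>\<Theta>. ratfuns_aut V \<Theta> \<and> u = (\<lambda>\<beta>. \<Theta> (rat_var \<beta>))"])
  show "\<exists>\<Theta>. ratfuns_aut V \<Theta> \<and> rat_var = (\<lambda>\<beta>. \<Theta> (rat_var \<beta>) :: 'a ratfun)"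
    using ratfuns_aut_id by (intro exI[of _ "\<lambda>f. f"]) auto
next
  fix \<alpha> and u :: "nat \<times> nat \<Rightarrow> 'a ratfun"
  assume \<alpha>: "\<alpha> \<in> V" and "\<exists>\<Theta>. ratfuns_aut V \<Theta> \<and> u = (\<lambda>\<beta>. \<Theta> (rat_var \<beta>))"
  then obtain \<Theta> where T: "ratfuns_aut V \<Theta>" "u = (\<lambda>\<beta>. \<Theta> (rat_var \<beta>))" by blast
  obtain \<Psi> where P: "ratfuns_aut V \<Psi>" "\<And>\<beta>. \<Psi> (rat_var \<beta>) = step \<alpha> (rat_var :: _ \<Rightarrow> 'a ratfun) \<beta>"
    using step_aut[OF \<alpha>, where 'a='a] by blast
  have e: "field_endo \<Theta>" using T(1) by (rule ratfuns_aut_endo)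
  have "hom_on UNIV \<Theta>" using field_endo.one[OF e] field_endo.diff[OF e] field_endo.mult[OF e]
    by (simp add: hom_on_def subring_of_def)
  then have "\<Theta> (step \<alpha> rat_var \<beta>) = step \<alpha> u \<beta>" for \<beta>
    using step_hom[of UNIV \<Theta> \<alpha> rat_var \<beta>] \<alpha> field_endo.inverse[OF e] by (simp add: T(2))
  then have "step \<alpha> u = (\<lambda>\<beta>. \<Theta> (\<Psi> (rat_var \<beta>)))" by (auto simp: P(2))
  with ratfuns_aut_comp[OF T(1) P(1)] show "\<exists>\<Theta>. ratfuns_aut V \<Theta> \<and> step \<alpha> u = (\<lambda>\<beta>. \<Theta> (rat_var \<beta>))"
    by (intro exI[of _ "\<lambda>f. \<Theta> (\<Psi> f)"]) simp
qed

section \<open>Logarithmic derivatives\<close>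

text \<open>The variables outside \<open>P\<close> have not been used: each occurs in its own component only, and alone.\<close>

definition fresh :: "(nat \<times> nat) set \<Rightarrow> (nat \<times> nat \<Rightarrow> 'a::idom ratfun) \<Rightarrow> bool" where
  "fresh P u \<longleftrightarrow> (\<forall>\<beta>. \<beta> \<notin> P \<longrightarrow> u \<beta> = rat_var \<beta>) \<and>
     (\<forall>\<gamma>. \<gamma> \<notin> P \<longrightarrow> (\<forall>\<beta>. \<beta> \<noteq> \<gamma> \<longrightarrow> rat_pderiv \<gamma> (u \<beta>) = 0))"

lemma freshD:
  assumes "fresh P u" "\<gamma> \<notin> P"
  shows "u \<gamma> = rat_var \<gamma>" "\<beta> \<noteq> \<gamma> \<Longrightarrow> rat_pderiv \<gamma> (u \<beta>) = 0"
  using assms unfolding fresh_def by blast+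

lemma fresh_init: "fresh {} rat_var"
  by (simp add: fresh_def rat_pderiv_var)

lemma fresh_step:
  fixes u :: "nat \<times> nat \<Rightarrow> 'a::idom ratfun"
  assumes \<alpha>: "\<alpha> \<in> V" and u: "fresh (prior \<alpha>) u"
  shows "fresh (insert \<alpha> (prior \<alpha>)) (step \<alpha> u)"
  unfolding fresh_def
proof (intro conjI allI impI)
  show "step \<alpha> u \<beta> = rat_var \<beta>" if "\<beta> \<notin> insert \<alpha> (prior \<alpha>)" for \<beta>
    using that freshD(1)[OF u, of \<beta>] step_outside[of \<beta> \<alpha> u] by simp
next
  fix \<gamma> \<beta> :: "nat \<times> nat" assume \<gamma>: "\<gamma> \<notin> insert \<alpha> (prior \<alpha>)" and \<beta>: "\<beta> \<noteq> \<gamma>"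
  let ?X = "{f :: 'a ratfun. rat_pderiv \<gamma> f = 0}"
  note X = kernel_pderiv(1)[of \<gamma>]
  have mem: "u \<delta> \<in> ?X" if "\<delta> \<noteq> \<gamma>" for \<delta> using freshD(2)[OF u _ that] \<gamma> by simp
  have mem': "u \<delta> \<in> ?X" if "\<delta> \<in> insert \<alpha> (prior \<alpha>)" for \<delta> using that \<gamma> by (intro mem) blast
  have inv: "inverse (u \<alpha>) \<in> ?X" using mem'[of \<alpha>] kernel_pderiv(2) by simp
  have "scale \<alpha> u \<beta> \<in> ?X"
    using mem' inv by (intro scale_mem[OF X \<alpha>])
  moreover have "shift \<alpha> u \<beta> \<in> ?X"
    using mem' by (intro shift_mem[OF X \<alpha>]) (blast intro: mem')+
  ultimately have "step \<alpha> u \<beta> \<in> ?X"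
    unfolding step_def using mem[OF \<beta>] by (intro subring_of_closed(4,6)[OF X])
  then show "rat_pderiv \<gamma> (step \<alpha> u \<beta>) = 0" by simp
qed

definition units_below :: "nat \<times> nat \<Rightarrow> 'a::idom ratfun set" where
  "units_below \<alpha> = (\<Union>\<delta>\<in>{\<delta> \<in> V. idx_less \<pi> \<delta> \<alpha>}. {rat_var \<delta>, inverse (rat_var \<delta>)})"

definition log_closed :: "nat \<times> nat \<Rightarrow> (nat \<times> nat \<Rightarrow> 'a::idom ratfun) \<Rightarrow> bool" where
  "log_closed \<alpha> u \<longleftrightarrow> (\<forall>\<beta>\<in>V. rat_var \<alpha> * rat_pderiv \<alpha> (u \<beta>) \<in> int_adjoin (units_below \<alpha> \<union> u ` V))"

text \<open>As long as \<open>\<alpha>\<close> has not been used, its only nonzero logarithmic derivative is that of \<open>u \<alpha> = n\<^sub>\<alpha>\<close>,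
  which is \<open>u \<alpha>\<close> again.\<close>

lemma log_closed_fresh:
  assumes "fresh P u" "\<alpha> \<notin> P" "\<alpha> \<in> V"
  shows "log_closed \<alpha> (u :: _ \<Rightarrow> 'a::idom ratfun)"
  unfolding log_closed_def
proof
  fix \<beta> assume "\<beta> \<in> V"
  have "rat_var \<alpha> * rat_pderiv \<alpha> (u \<beta>) = (if \<beta> = \<alpha> then u \<alpha> else 0)"
    using freshD[OF assms(1,2)] by (simp add: rat_pderiv_var)
  then show "rat_var \<alpha> * rat_pderiv \<alpha> (u \<beta>) \<in> int_adjoin (units_below \<alpha> \<union> u ` V)"
    using assms(3) by (auto simp: subring_of_closed[OF int_adjoin_subring] intro: int_adjoin.gen)
qed

text \<open>In the new row \<open>p\<close> the variable is an overall factor, in column \<open>p\<close> its inverse is one, and the other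
  components do not contain it.\<close>

lemma log_closed_own_step:
  fixes u :: "nat \<times> nat \<Rightarrow> 'a::idom ratfun"
  assumes \<alpha>: "\<alpha> \<in> V" and u: "fresh (prior \<alpha>) u"
  shows "log_closed \<alpha> (step \<alpha> u)"
  unfolding log_closed_def
proof
  fix \<beta> assume \<beta>: "\<beta> \<in> V"
  note X = kernel_pderiv(1)[of \<alpha>]
  note r = subring_of_closed[OF int_adjoin_subring]
  have u\<alpha>: "u \<alpha> = rat_var \<alpha>" by (rule freshD(1)[OF u prior_irrefl])
  have d: "rat_pderiv \<alpha> (u \<gamma>) = 0" if "\<gamma> \<noteq> \<alpha>" for \<gamma>
    by (rule freshD(2)[OF u prior_irrefl that])
  have dE: "rat_pderiv \<alpha> (entry (prior \<alpha>) u a b) = 0" for a b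
  proof -
    have "entry (prior \<alpha>) u a b \<in> {f. rat_pderiv \<alpha> f = 0}"
      by (rule entry_mem[OF X]) (use d prior_irrefl in force)
    then show ?thesis by simp
  qed
  have mem: "step \<alpha> u \<beta> \<in> int_adjoin (units_below \<alpha> \<union> step \<alpha> u ` V)"
    using \<beta> by (intro int_adjoin.gen) blast
  let ?L = "rat_var \<alpha> * rat_pderiv \<alpha> (step \<alpha> u \<beta>)"
  consider "\<beta> = \<alpha>" | "\<beta> \<noteq> \<alpha>" "\<beta> \<in> prior \<alpha>" "fst \<beta> = fst \<alpha>"
    | "\<beta> \<noteq> \<alpha>" "\<beta> \<in> prior \<alpha>" "fst \<beta> \<noteq> fst \<alpha>" "snd \<beta> = fst \<alpha>"
    | "\<beta> \<noteq> \<alpha>" "fst \<beta> \<noteq> fst \<alpha> \<or> \<beta> \<notin> prior \<alpha>" "snd \<beta> \<noteq> fst \<alpha> \<or> \<beta> \<notin> prior \<alpha>" by blast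
  then have "?L = step \<alpha> u \<beta> \<or> ?L = - step \<alpha> u \<beta> \<or> ?L = 0"
  proof cases
    case 1
    then have "step \<alpha> u \<beta> = entry (prior \<alpha>) u (row_above \<alpha>) (snd \<alpha>) * rat_var \<alpha>"
      using prior_irrefl by (simp add: step_def scale_def shift_def u\<alpha>)
    then show ?thesis by (simp add: rat_pderiv_mult dE rat_pderiv_var)
  next
    case 2
    then have "step \<alpha> u \<beta> = rat_var \<alpha> * (entry (prior \<alpha>) u (row_above \<alpha>) (snd \<beta>) - u \<beta>)"
      by (simp add: step_def scale_def shift_def u\<alpha> algebra_simps)
    then show ?thesis by (simp add: rat_pderiv_mult rat_pderiv_diff d[OF 2(1)] dE rat_pderiv_var)
  next
    case 3
    then have "step \<alpha> u \<beta> = - (inverse (rat_var \<alpha>) * u \<beta>)"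
      by (simp add: step_def scale_def shift_def u\<alpha>)
    then show ?thesis
      by (simp add: rat_pderiv_mult rat_pderiv_minus d[OF 3(1)] rat_pderiv_inverse rat_pderiv_var)
  next
    case 4
    then have s: "step \<alpha> u \<beta> = u \<beta> + shift \<alpha> u \<beta>"
      by (auto simp: step_def scale_def)
    have "shift \<alpha> u \<beta> \<in> {f. rat_pderiv \<alpha> f = 0}"
    proof (cases "fst \<beta> = fst \<alpha>")
      case True
      then have "shift \<alpha> u \<beta> = 0" using 4 by (auto simp: shift_def)
      then show ?thesis by simp
    next
      case False
      show ?thesis by (rule shift_mem[OF X \<alpha>]) (use d prior_irrefl False in \<open>force+\<close>)
    qed
    then show ?thesis by (simp add: s rat_pderiv_add d[OF 4(1)])
  qed
  then show "?L \<in> int_adjoin (units_below \<alpha> \<union> step \<alpha> u ` V)"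
    using mem by (auto simp: r)
qed

text \<open>By induction on the height, the step with variable \<open>\<delta>\<close> can be solved for the old components over the ring of Laurent
  polynomials in \<open>n\<^sub>\<delta>\<close>, so polynomials in the old components are polynomials in the new ones.  The derivation
  annihilates \<open>n\<^sub>\<delta>\<close>.\<close>

lemma log_closed_later_step:
  fixes u :: "nat \<times> nat \<Rightarrow> 'a::idom ratfun"
  assumes \<delta>: "\<delta> \<in> V" and u: "fresh (prior \<delta>) u" and \<alpha>: "\<alpha> \<in> prior \<delta>" and log: "log_closed \<alpha> u"
  shows "log_closed \<alpha> (step \<delta> u)"
proof -
  let ?B = "int_adjoin (units_below \<alpha> \<union> step \<delta> u ` V)"
  note X = int_adjoin_subring[of "units_below \<alpha> \<union> step \<delta> u ` V"]
  have u\<delta>: "u \<delta> = rat_var \<delta>" by (rule freshD(1)[OF u prior_irrefl])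
  have "idx_less \<pi> \<delta> \<alpha>" using \<alpha> by (simp add: prior_def)
  then have unit: "rat_var \<delta> \<in> ?B" "inverse (rat_var \<delta>) \<in> ?B"
    using \<delta> by (auto simp: units_below_def intro!: int_adjoin.gen)
  have old: "u \<gamma> \<in> ?B" if "\<gamma> \<in> V" for \<gamma>
    using that
  proof (induction "height \<delta> \<gamma>" arbitrary: \<gamma> rule: less_induct)
    case less
    show ?case
    proof (cases "\<gamma> = \<delta>")
      case True
      then show ?thesis using unit by (simp add: u\<delta>)
    next
      case False
      have s: "shift \<delta> u \<gamma> \<in> ?B"
        by (rule shift_mem[OF X \<delta>]) (use less prior_V \<delta> in blast)+
      have c: "inverse (scale \<delta> u \<gamma>) \<in> ?B" "scale \<delta> u \<gamma> \<noteq> 0"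
        using False unit by (auto simp: scale_def u\<delta> subring_of_closed[OF X])
      have "step \<delta> u \<gamma> \<in> ?B" using less.prems by (intro int_adjoin.gen) blast
      then have "inverse (scale \<delta> u \<gamma>) * (step \<delta> u \<gamma> - shift \<delta> u \<gamma>) \<in> ?B"
        using s c by (intro subring_of_closed[OF X])
      then show ?thesis using c(2) by (simp add: step_def mult.assoc[symmetric])
    qed
  qed
  have sub: "x \<in> ?B" if "x \<in> int_adjoin (units_below \<alpha> \<union> u ` V)" for x
  proof (rule int_adjoin_least[OF X _ that])
    have "units_below \<alpha> \<subseteq> ?B" by (intro subsetI int_adjoin.gen) simp
    then show "units_below \<alpha> \<union> u ` V \<subseteq> ?B" using old by blast
  qed
  let ?L = "\<lambda>f. rat_var \<alpha> * rat_pderiv \<alpha> f"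
  define Y where "Y = {f \<in> ?B. ?L f \<in> ?B}"
  have Y: "subring_of Y"
    unfolding subring_of_def
  proof (intro conjI ballI)
    show "1 \<in> Y" by (simp add: Y_def subring_of_closed[OF X])
    fix x y assume xy: "x \<in> Y" "y \<in> Y"
    have "?L (x - y) = ?L x - ?L y" "?L (x * y) = ?L x * y + x * ?L y"
      by (simp_all add: rat_pderiv_diff rat_pderiv_mult algebra_simps)
    then show "x - y \<in> Y" "x * y \<in> Y" using xy by (auto simp: Y_def subring_of_closed[OF X])
  qed
  have uY: "u \<gamma> \<in> Y" if "\<gamma> \<in> V" for \<gamma>
    using log that old sub by (auto simp: Y_def log_closed_def)
  have "\<alpha> \<noteq> \<delta>" using \<alpha> prior_irrefl by blast
  then have iY: "inverse (u \<delta>) \<in> Y"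
    using unit by (simp add: Y_def u\<delta> rat_pderiv_inverse rat_pderiv_var subring_of_closed[OF X])
  have "step \<delta> u \<beta> \<in> Y" if "\<beta> \<in> V" for \<beta>
  proof -
    have "scale \<delta> u \<beta> \<in> Y" by (rule scale_mem[OF Y \<delta>]) (use uY iY prior_V \<delta> in blast)+
    moreover have "shift \<delta> u \<beta> \<in> Y" by (rule shift_mem[OF Y \<delta>]) (use uY prior_V \<delta> in blast)+
    ultimately show ?thesis
      unfolding step_def using uY[OF that] by (intro subring_of_closed(4,6)[OF Y])
  qed
  then show ?thesis by (auto simp: log_closed_def Y_def)
qed

lemma log_closed_sweep:
  assumes \<alpha>: "\<alpha> \<in> V"
  shows "log_closed \<alpha> (sweep_cols r (rat_var :: _ \<Rightarrow> 'a::idom ratfun))"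
proof -
  have "fresh V (sweep_cols r (rat_var :: _ \<Rightarrow> 'a ratfun)) \<and> log_closed \<alpha> (sweep_cols r (rat_var :: _ \<Rightarrow> 'a ratfun))"
  proof (rule sweep_cols_induct1[of "\<lambda>P u. fresh P u \<and> log_closed \<alpha> u"])
    show "fresh {} (rat_var :: _ \<Rightarrow> 'a ratfun) \<and> log_closed \<alpha> (rat_var :: _ \<Rightarrow> 'a ratfun)"
      using fresh_init log_closed_fresh[OF fresh_init _ \<alpha>] by blast
  next
    fix \<delta> and u :: "nat \<times> nat \<Rightarrow> 'a ratfun"
    assume \<delta>: "\<delta> \<in> V" and u: "fresh (prior \<delta>) u \<and> log_closed \<alpha> u"
    have f: "fresh (insert \<delta> (prior \<delta>)) (step \<delta> u)" using fresh_step[OF \<delta> conjunct1[OF u]] .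
    consider "\<alpha> = \<delta>" | "\<alpha> \<in> prior \<delta>" | "\<alpha> \<notin> insert \<delta> (prior \<delta>)" by blast
    then have "log_closed \<alpha> (step \<delta> u)"
      using u \<delta> f \<alpha> log_closed_own_step log_closed_later_step log_closed_fresh by cases blast+
    with f show "fresh (insert \<delta> (prior \<delta>)) (step \<delta> u) \<and> log_closed \<alpha> (step \<delta> u)" by blast
  qed
  then show ?thesis by blast
qed

section \<open>The Jacobian determinant\<close>

lemma det_jacobian_step:
  fixes u :: "nat \<times> nat \<Rightarrow> 'a::idom ratfun"
  assumes \<alpha>: "\<alpha> \<in> V"
  shows "det (jacobian V (step \<alpha> u)) = (\<Prod>\<beta>\<in>V. scale \<alpha> u \<beta>) * det (jacobian V u)"
proof (rule det_jacobian_triangular[OF finite_V, where h = "height \<alpha>"])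
  fix \<beta> assume "\<beta> \<in> V"
  let ?D = "{\<delta> \<in> V. height \<alpha> \<delta> < height \<alpha> \<beta>}"
  let ?X = "gradient_span ?D u"
  have X: "subring_of ?X" by (rule gradient_span_subring)
  have m: "u \<gamma> \<in> ?X" if "\<gamma> \<in> insert \<alpha> (prior \<alpha>)" "height \<alpha> \<gamma> < height \<alpha> \<beta>" for \<gamma>
    using that \<alpha> finite_V by (intro gradient_span_gen) (auto dest: prior_V)
  have "scale \<alpha> u \<beta> \<in> ?X"
    by (rule scale_mem[OF X \<alpha>]) (use m gradient_span_inverse in blast)+
  moreover have "shift \<alpha> u \<beta> \<in> ?X"
    by (rule shift_mem[OF X \<alpha>]) (use m in blast)+
  ultimately obtain g k where g: "\<And>\<gamma>. rat_pderiv \<gamma> (scale \<alpha> u \<beta>) = (\<Sum>\<delta>\<in>?D. g \<delta> * rat_pderiv \<gamma> (u \<delta>))"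
    and k: "\<And>\<gamma>. rat_pderiv \<gamma> (shift \<alpha> u \<beta>) = (\<Sum>\<delta>\<in>?D. k \<delta> * rat_pderiv \<gamma> (u \<delta>))"
    unfolding gradient_span_def by blast
  have "rat_pderiv \<gamma> (step \<alpha> u \<beta>) = scale \<alpha> u \<beta> * rat_pderiv \<gamma> (u \<beta>) +
     (\<Sum>\<delta>\<in>?D. (u \<beta> * g \<delta> + k \<delta>) * rat_pderiv \<gamma> (u \<delta>))" for \<gamma>
  proof -
    have "rat_pderiv \<gamma> (step \<alpha> u \<beta>) = scale \<alpha> u \<beta> * rat_pderiv \<gamma> (u \<beta>) +
       (u \<beta> * rat_pderiv \<gamma> (scale \<alpha> u \<beta>) + rat_pderiv \<gamma> (shift \<alpha> u \<beta>))"
      by (simp add: step_def rat_pderiv_add rat_pderiv_mult mult.commute)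
    then show ?thesis by (simp only: g k distrib_right sum.distrib sum_distrib_left mult.assoc)
  qed
  then show "\<exists>g. \<forall>\<gamma>. rat_pderiv \<gamma> (step \<alpha> u \<beta>) = scale \<alpha> u \<beta> * rat_pderiv \<gamma> (u \<beta>) +
     (\<Sum>\<delta>\<in>?D. g \<delta> * rat_pderiv \<gamma> (u \<delta>))" by (intro exI allI)
qed

lemma finite_prior: "finite (prior \<alpha>)"
  using finite_subset[OF _ finite_V, of "prior \<alpha>"] prior_V by blast

text \<open>In the column being processed, a step multiplies the entry above by its own variable, so the entry of row \<open>a\<close>
  is the product of the variables from the top of the column down to row \<open>a\<close>.  The bound on \<open>snd \<delta>\<close> singles out this column: the
  previous ones have been altered by the steps that followed.\<close>

definition column_form :: "(nat \<times> nat \<Rightarrow> 'b::field) \<Rightarrow> (nat \<times> nat) set \<Rightarrow> (nat \<times> nat \<Rightarrow> 'b) \<Rightarrow> bool" where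
  "column_form z P u \<longleftrightarrow> (\<forall>\<beta>. \<beta> \<notin> P \<longrightarrow> u \<beta> = z \<beta>) \<and>
    (\<forall>j a. (\<forall>\<delta>\<in>P. snd \<delta> \<le> j) \<longrightarrow> (a, j) \<in> P \<longrightarrow>
      u (a, j) = (\<Prod>\<delta>\<in>{\<delta> \<in> P. snd \<delta> = j \<and> \<rho> (fst \<delta>) \<le> \<rho> a}. z \<delta>))"

lemma column_formD:
  assumes "column_form z P u"
  shows "\<beta> \<notin> P \<Longrightarrow> u \<beta> = z \<beta>"
    "(\<And>\<delta>. \<delta> \<in> P \<Longrightarrow> snd \<delta> \<le> j) \<Longrightarrow> (a, j) \<in> P \<Longrightarrow>
      u (a, j) = (\<Prod>\<delta>\<in>{\<delta> \<in> P. snd \<delta> = j \<and> \<rho> (fst \<delta>) \<le> \<rho> a}. z \<delta>)"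
  using assms unfolding column_form_def by blast+

lemma column_form_init: "column_form z {} z"
  by (simp add: column_form_def)

lemma prior_snd_le: "\<delta> \<in> prior (p, j) \<Longrightarrow> snd \<delta> \<le> j"
  by (cases \<delta>) (auto simp: prior_iff)

lemma column_form_row_above:
  assumes \<alpha>: "(p, j) \<in> V" and u: "column_form z (prior (p, j)) u"
  shows "entry (prior (p, j)) u (row_above (p, j)) j = (\<Prod>\<delta>\<in>{\<delta> \<in> prior (p, j). snd \<delta> = j}. z \<delta>)"
proof -
  let ?q = "row_above (p, j)"
  have q: "\<rho> c \<le> \<rho> ?q" if "(c, j) \<in> prior (p, j)" for c
    using that row_above(5)[of p j c] \<alpha> by (auto simp: prior_iff V_iff)
  show ?thesis
  proof (cases "?q = j")
    case True
    have "(c, j) \<notin> prior (p, j)" for c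
      using q[of c] True by (auto simp: prior_iff V_iff)
    then have e: "{\<delta> \<in> prior (p, j). snd \<delta> = j} = {}" by auto
    show ?thesis unfolding e using True by (simp add: entry_def)
  next
    case False
    then have m: "(?q, j) \<in> prior (p, j)" using row_above_prior[OF \<alpha>] by simp
    have "u (?q, j) = (\<Prod>\<delta>\<in>{\<delta> \<in> prior (p, j). snd \<delta> = j \<and> \<rho> (fst \<delta>) \<le> \<rho> ?q}. z \<delta>)"
      by (rule column_formD(2)[OF u prior_snd_le m])
    also have "{\<delta> \<in> prior (p, j). snd \<delta> = j \<and> \<rho> (fst \<delta>) \<le> \<rho> ?q} = {\<delta> \<in> prior (p, j). snd \<delta> = j}"
      using q by auto
    finally show ?thesis using m False by (simp add: entry_def)
  qed
qed

lemma column_form_step: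
  assumes \<alpha>: "\<alpha> \<in> V" and u: "column_form z (prior \<alpha>) u"
  shows "column_form z (insert \<alpha> (prior \<alpha>)) (step \<alpha> u)"
  unfolding column_form_def
proof (intro conjI allI impI)
  fix \<beta> assume "\<beta> \<notin> insert \<alpha> (prior \<alpha>)"
  then show "step \<alpha> u \<beta> = z \<beta>"
    using column_formD(1)[OF u, of \<beta>] step_outside[of \<beta> \<alpha> u] by simp
next
  obtain p j where \<alpha>_eq: "\<alpha> = (p, j)" by (metis surj_pair)
  fix k a assume max: "\<forall>\<delta>\<in>insert \<alpha> (prior \<alpha>). snd \<delta> \<le> k" and a: "(a, k) \<in> insert \<alpha> (prior \<alpha>)"
  have k: "k = j" using max a prior_snd_le[of "(a, k)" p j] by (auto simp: \<alpha>_eq)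
  show "step \<alpha> u (a, k) = (\<Prod>\<delta>\<in>{\<delta> \<in> insert \<alpha> (prior \<alpha>). snd \<delta> = k \<and> \<rho> (fst \<delta>) \<le> \<rho> a}. z \<delta>)"
  proof (cases "a = p")
    case True
    have "{\<delta> \<in> insert \<alpha> (prior \<alpha>). snd \<delta> = k \<and> \<rho> (fst \<delta>) \<le> \<rho> a} = insert \<alpha> {\<delta> \<in> prior \<alpha>. snd \<delta> = j}"
      using True k by (auto simp: \<alpha>_eq prior_iff)
    moreover have "u \<alpha> = z \<alpha>" by (rule column_formD(1)[OF u prior_irrefl])
    moreover have "step \<alpha> u \<alpha> = entry (prior \<alpha>) u (row_above \<alpha>) j * u \<alpha>"
      using prior_irrefl[of \<alpha>] by (simp add: step_def scale_def shift_def \<alpha>_eq)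
    moreover have "\<alpha> \<notin> {\<delta> \<in> prior \<alpha>. snd \<delta> = j}" "finite {\<delta> \<in> prior \<alpha>. snd \<delta> = j}"
      using prior_irrefl[of \<alpha>] finite_prior[of \<alpha>] by simp_all
    moreover have "(a, k) = \<alpha>" using True k by (simp add: \<alpha>_eq)
    ultimately show ?thesis
      using column_form_row_above[of p j z u] \<alpha> u by (simp add: \<alpha>_eq mult.commute)
  next
    case False
    then have m: "(a, j) \<in> prior (p, j)" using a k by (simp add: \<alpha>_eq)
    have "j \<noteq> p" "\<not> j < p" using \<alpha> by (auto simp: V_iff \<alpha>_eq)
    then have "step \<alpha> u (a, k) = u (a, j)"
      using False k by (simp add: step_def scale_def shift_def \<alpha>_eq)
    also have "\<dots> = (\<Prod>\<delta>\<in>{\<delta> \<in> prior (p, j). snd \<delta> = j \<and> \<rho> (fst \<delta>) \<le> \<rho> a}. z \<delta>)"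
      by (rule column_formD(2)[OF u[unfolded \<alpha>_eq] prior_snd_le m])
    also have "{\<delta> \<in> prior (p, j). snd \<delta> = j \<and> \<rho> (fst \<delta>) \<le> \<rho> a} =
        {\<delta> \<in> insert \<alpha> (prior \<alpha>). snd \<delta> = k \<and> \<rho> (fst \<delta>) \<le> \<rho> a}"
      using k m by (auto simp: prior_iff \<alpha>_eq)
    finally show ?thesis .
  qed
qed

lemma prod_scale:
  fixes u :: "nat \<times> nat \<Rightarrow> 'b::field"
  assumes \<alpha>: "\<alpha> \<in> V"
  shows "(\<Prod>\<beta>\<in>V. scale \<alpha> u \<beta>) = entry (prior \<alpha>) u (row_above \<alpha>) (snd \<alpha>) *
    (- u \<alpha>) ^ card {\<beta> \<in> prior \<alpha>. fst \<beta> = fst \<alpha>} * (- inverse (u \<alpha>)) ^ card {\<beta> \<in> prior \<alpha>. snd \<beta> = fst \<alpha>}"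
proof -
  have "scale \<alpha> u \<beta> = (if \<beta> = \<alpha> then entry (prior \<alpha>) u (row_above \<alpha>) (snd \<alpha>) else 1) *
      (if \<beta> \<in> prior \<alpha> \<and> fst \<beta> = fst \<alpha> then - u \<alpha> else 1) *
      (if \<beta> \<in> prior \<alpha> \<and> snd \<beta> = fst \<alpha> then - inverse (u \<alpha>) else 1)" for \<beta>
  proof (cases "\<beta> \<in> prior \<alpha>")
    case True
    then have "fst \<beta> < snd \<beta>" "\<beta> \<noteq> \<alpha>"
      using prior_V[OF True] prior_irrefl[of \<alpha>] V_iff[of "fst \<beta>" "snd \<beta>"] by auto
    then show ?thesis by (simp add: scale_def)
  next
    case False
    then show ?thesis by (simp add: scale_def)
  qed
  moreover have "{\<beta> \<in> V. \<beta> \<in> prior \<alpha> \<and> X \<beta>} = {\<beta> \<in> prior \<alpha>. X \<beta>}" for X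
    using prior_V by blast
  ultimately show ?thesis
    using \<alpha> finite_V by (simp add: prod.distrib prod_const_filter)
qed

definition step_det :: "nat \<times> nat \<Rightarrow> 'a::idom ratfun" where
  "step_det \<alpha> = (\<Prod>\<delta>\<in>{\<delta> \<in> prior \<alpha>. snd \<delta> = snd \<alpha>}. rat_var \<delta>) *
    (- rat_var \<alpha>) ^ card {\<beta> \<in> prior \<alpha>. fst \<beta> = fst \<alpha>} *
    (- inverse (rat_var \<alpha>)) ^ card {\<beta> \<in> prior \<alpha>. snd \<beta> = fst \<alpha>}"

lemma det_jacobian_var: "det (jacobian V (rat_var :: _ \<Rightarrow> 'a::idom ratfun)) = 1"
proof -
  have "jacobian V (rat_var :: _ \<Rightarrow> 'a ratfun) = 1\<^sub>m (card V)"
    by (rule eq_matI)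
       (auto simp: jacobian_def Let_def rat_pderiv_var nth_eq_iff_index_eq finite_V)
  then show ?thesis by simp
qed

lemma det_jacobian_sweep:
  "det (jacobian V (sweep_cols r (rat_var :: _ \<Rightarrow> 'a::idom ratfun))) = (\<Prod>\<alpha>\<in>V. step_det \<alpha>)"
proof -
  let ?z = "rat_var :: _ \<Rightarrow> 'a ratfun"
  have "column_form ?z V (sweep_cols r ?z) \<and> det (jacobian V (sweep_cols r ?z)) = (\<Prod>\<alpha>\<in>V. step_det \<alpha>)"
  proof (rule sweep_cols_induct1[of "\<lambda>P u. column_form ?z P u \<and> det (jacobian V u) = (\<Prod>\<alpha>\<in>P. step_det \<alpha>)"])
    show "column_form ?z {} ?z \<and> det (jacobian V ?z) = (\<Prod>\<alpha>\<in>{}. step_det \<alpha>)"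
      by (simp add: det_jacobian_var column_form_init)
  next
    fix \<alpha> and u :: "nat \<times> nat \<Rightarrow> 'a ratfun"
    assume \<alpha>: "\<alpha> \<in> V" and "column_form ?z (prior \<alpha>) u \<and> det (jacobian V u) = (\<Prod>\<alpha>\<in>prior \<alpha>. step_det \<alpha>)"
    then have u: "column_form ?z (prior \<alpha>) u" and d: "det (jacobian V u) = (\<Prod>\<alpha>\<in>prior \<alpha>. step_det \<alpha>)" by auto
    have "(\<Prod>\<beta>\<in>V. scale \<alpha> u \<beta>) = step_det \<alpha>"
      using column_form_row_above[of "fst \<alpha>" "snd \<alpha>" ?z u] \<alpha> u column_formD(1)[OF u prior_irrefl]
      by (simp add: prod_scale[OF \<alpha>] step_det_def)
    then show "column_form ?z (insert \<alpha> (prior \<alpha>)) (step \<alpha> u) \<and>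
        det (jacobian V (step \<alpha> u)) = (\<Prod>\<alpha>\<in>insert \<alpha> (prior \<alpha>). step_det \<alpha>)"
      using column_form_step[OF \<alpha> u] prior_irrefl[of \<alpha>] finite_prior[of \<alpha>]
      by (simp add: det_jacobian_step[OF \<alpha>] d)
  qed
  then show ?thesis by blast
qed

text \<open>Both sides count the labels strictly between \<open>p\<close> and \<open>j\<close>, together with the labels below \<open>p\<close>
  whose rows stand below row \<open>p\<close>.\<close>

lemma exponent_count:
  assumes \<alpha>: "(p, j) \<in> V"
  shows "card {\<beta> \<in> V. (p, j) \<in> prior \<beta> \<and> snd (p, j) = snd \<beta>} + card {\<beta> \<in> prior (p, j). fst \<beta> = p} =
    (j - p - 1) + card {\<beta> \<in> prior (p, j). snd \<beta> = p}"
proof -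
  have pj: "1 \<le> p" "p < j" "j \<le> r" "\<rho> j < \<rho> p" using \<alpha> by (auto simp: V_iff)
  let ?hi = "{a \<in> {p<..<j}. \<rho> p < \<rho> a}" and ?lo = "{b \<in> {p<..<j}. \<rho> b < \<rho> p}" and ?B = "{c \<in> {1..<p}. \<rho> p < \<rho> c}"
  have "{\<beta> \<in> V. (p, j) \<in> prior \<beta> \<and> snd (p, j) = snd \<beta>} = (\<lambda>a. (a, j)) ` (?B \<union> ?hi)"
  proof (rule Set.set_eqI)
    fix \<beta> :: "nat \<times> nat"
    obtain a b where "\<beta> = (a, b)" by (cases \<beta>)
    then show "\<beta> \<in> {\<beta> \<in> V. (p, j) \<in> prior \<beta> \<and> snd (p, j) = snd \<beta>} \<longleftrightarrow> \<beta> \<in> (\<lambda>a. (a, j)) ` (?B \<union> ?hi)"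
      using \<alpha> pj by (cases a p rule: linorder_cases) (auto simp: prior_iff V_iff image_iff)
  qed
  then have 1: "card {\<beta> \<in> V. (p, j) \<in> prior \<beta> \<and> snd (p, j) = snd \<beta>} = card ?B + card ?hi"
    by (simp add: card_image inj_on_def) (rule card_Un_disjoint; auto)
  have "{\<beta> \<in> prior (p, j). fst \<beta> = p} = (\<lambda>b. (p, b)) ` ?lo"
  proof (rule Set.set_eqI)
    fix \<beta> :: "nat \<times> nat"
    obtain a b where "\<beta> = (a, b)" by (cases \<beta>)
    then show "\<beta> \<in> {\<beta> \<in> prior (p, j). fst \<beta> = p} \<longleftrightarrow> \<beta> \<in> (\<lambda>b. (p, b)) ` ?lo"
      using \<alpha> pj by (auto simp: prior_iff V_iff image_iff)
  qed
  then have 2: "card {\<beta> \<in> prior (p, j). fst \<beta> = p} = card ?lo"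
    by (simp add: card_image inj_on_def)
  have "{\<beta> \<in> prior (p, j). snd \<beta> = p} = (\<lambda>c. (c, p)) ` ?B"
  proof (rule Set.set_eqI)
    fix \<beta> :: "nat \<times> nat"
    obtain a b where "\<beta> = (a, b)" by (cases \<beta>)
    then show "\<beta> \<in> {\<beta> \<in> prior (p, j). snd \<beta> = p} \<longleftrightarrow> \<beta> \<in> (\<lambda>c. (c, p)) ` ?B"
      using \<alpha> pj by (auto simp: prior_iff V_iff image_iff)
  qed
  then have 3: "card {\<beta> \<in> prior (p, j). snd \<beta> = p} = card ?B"
    by (simp add: card_image inj_on_def)
  have "?lo \<union> ?hi = {p<..<j}"
  proof (rule Set.set_eqI)
    show "x \<in> ?lo \<union> ?hi \<longleftrightarrow> x \<in> {p<..<j}" for x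
      by (cases "\<rho> x" "\<rho> p" rule: linorder_cases) auto
  qed
  then have "card ?lo + card ?hi = j - p - 1"
    using card_Un_disjoint[of ?lo ?hi] by (simp add: disjoint_iff)
  then show ?thesis using 1 2 3 by simp
qed

text \<open>The step of a variable \<open>n\<^sub>\<delta>\<close> contributes powers of \<open>-n\<^sub>\<delta>\<close> and its inverse; moreover \<open>n\<^sub>\<delta>\<close> occurs in the
  entry above for every lower row of its column.  Exchanging the two products collects these occurrences.\<close>

lemma prod_step_det:
  "\<exists>s\<in>{1, -1}. (\<Prod>\<alpha>\<in>V. step_det \<alpha>) = s * (\<Prod>(i, j)\<in>V. rat_var (i, j) ^ (j - i - 1) :: 'a::idom ratfun)"
proof -
  define A where "A \<alpha> = card {\<beta> \<in> prior \<alpha>. fst \<beta> = fst \<alpha>}" for \<alpha>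
  define B where "B \<alpha> = card {\<beta> \<in> prior \<alpha>. snd \<beta> = fst \<alpha>}" for \<alpha>
  define C where "C \<alpha> = card {\<beta> \<in> V. \<alpha> \<in> prior \<beta> \<and> snd \<alpha> = snd \<beta>}" for \<alpha>
  let ?x = "rat_var :: _ \<Rightarrow> 'a ratfun"
  have "(\<Prod>\<alpha>\<in>V. \<Prod>\<delta>\<in>{\<delta> \<in> prior \<alpha>. snd \<delta> = snd \<alpha>}. ?x \<delta>) =
      (\<Prod>\<alpha>\<in>V. \<Prod>\<delta>\<in>{\<delta> \<in> V. \<delta> \<in> prior \<alpha> \<and> snd \<delta> = snd \<alpha>}. ?x \<delta>)"
    by (intro prod.cong refl) (auto dest: prior_V)
  also have "\<dots> = (\<Prod>\<delta>\<in>V. \<Prod>\<alpha>\<in>{\<alpha> \<in> V. \<delta> \<in> prior \<alpha> \<and> snd \<delta> = snd \<alpha>}. ?x \<delta>)"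
    by (rule prod.swap_restrict[OF finite_V finite_V])
  also have "\<dots> = (\<Prod>\<delta>\<in>V. ?x \<delta> ^ C \<delta>)" by (simp add: C_def)
  finally have swap: "(\<Prod>\<alpha>\<in>V. \<Prod>\<delta>\<in>{\<delta> \<in> prior \<alpha>. snd \<delta> = snd \<alpha>}. ?x \<delta>) = (\<Prod>\<delta>\<in>V. ?x \<delta> ^ C \<delta>)" .
  have "(\<Prod>\<alpha>\<in>V. step_det \<alpha>) = (\<Prod>\<alpha>\<in>V. ?x \<alpha> ^ C \<alpha> * (- ?x \<alpha>) ^ A \<alpha> * (- inverse (?x \<alpha>)) ^ B \<alpha>)"
    unfolding step_det_def prod.distrib swap A_def B_def ..
  also have "\<dots> = (\<Prod>\<alpha>\<in>V. (-1) ^ (A \<alpha> + B \<alpha>) * ?x \<alpha> ^ (snd \<alpha> - fst \<alpha> - 1))"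
  proof (rule prod.cong[OF refl])
    fix \<alpha> assume "\<alpha> \<in> V"
    then have e: "C \<alpha> + A \<alpha> = (snd \<alpha> - fst \<alpha> - 1) + B \<alpha>"
      using exponent_count[of "fst \<alpha>" "snd \<alpha>"] by (simp add: A_def B_def C_def)
    have "?x \<alpha> ^ C \<alpha> * (- ?x \<alpha>) ^ A \<alpha> * (- inverse (?x \<alpha>)) ^ B \<alpha> =
        (-1) ^ (A \<alpha> + B \<alpha>) * (?x \<alpha> ^ (C \<alpha> + A \<alpha>) * inverse (?x \<alpha>) ^ B \<alpha>)"
      by (simp add: power_minus[of "?x \<alpha>"] power_minus[of "inverse (?x \<alpha>)"] power_add mult_ac)
    also have "?x \<alpha> ^ (C \<alpha> + A \<alpha>) * inverse (?x \<alpha>) ^ B \<alpha> = ?x \<alpha> ^ (snd \<alpha> - fst \<alpha> - 1)"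
      unfolding e by (simp add: power_add power_inverse mult.assoc)
    finally show "?x \<alpha> ^ C \<alpha> * (- ?x \<alpha>) ^ A \<alpha> * (- inverse (?x \<alpha>)) ^ B \<alpha> =
        (-1) ^ (A \<alpha> + B \<alpha>) * ?x \<alpha> ^ (snd \<alpha> - fst \<alpha> - 1)" .
  qed
  also have "\<dots> = (\<Prod>\<alpha>\<in>V. (-1) ^ (A \<alpha> + B \<alpha>)) * (\<Prod>(i, j)\<in>V. ?x (i, j) ^ (j - i - 1))"
    by (simp add: prod.distrib case_prod_beta)
  finally have "(\<Prod>\<alpha>\<in>V. step_det \<alpha>) = (\<Prod>\<alpha>\<in>V. (-1) ^ (A \<alpha> + B \<alpha>)) * (\<Prod>(i, j)\<in>V. ?x (i, j) ^ (j - i - 1))" .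
  moreover have "(\<Prod>\<alpha>\<in>V. (-1) ^ (A \<alpha> + B \<alpha>)) \<in> {1, -1 :: 'a ratfun}"
    using minus_one_power_iff[of "\<Sum>\<alpha>\<in>V. A \<alpha> + B \<alpha>", where 'a="'a ratfun"]
    by (simp add: power_sum split: if_splits)
  ultimately show ?thesis by blast
qed

section \<open>Values at a point with nonzero coordinates\<close>

lemma sweep_values:
  fixes z :: "nat \<times> nat \<Rightarrow> 'a::field"
  assumes z: "\<And>\<alpha>. \<alpha> \<in> V \<Longrightarrow> z \<alpha> \<noteq> 0"
  shows "rat_regular id z (sweep_cols r rat_var \<beta>) \<and> rat_eval id z (sweep_cols r rat_var \<beta>) = sweep_cols r z \<beta>"
proof -
  define Q where "Q P u v \<longleftrightarrow> (\<forall>\<beta>. rat_regular id z (u \<beta>)) \<and> v = (\<lambda>\<beta>. rat_eval id z (u \<beta>)) \<and>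
     (\<forall>\<beta>. \<beta> \<notin> P \<longrightarrow> u \<beta> = rat_var \<beta>)" for P :: "(nat \<times> nat) set" and u and v :: "nat \<times> nat \<Rightarrow> 'a"
  have "Q V (sweep_cols r rat_var) (sweep_cols r z)"
  proof (rule sweep_cols_induct[of Q])
    show "Q {} rat_var z" by (simp add: Q_def eval_id.regular_var)
  next
    fix \<alpha> u and v :: "nat \<times> nat \<Rightarrow> 'a" assume \<alpha>: "\<alpha> \<in> V" and Q: "Q (prior \<alpha>) u v"
    have reg: "u \<beta> \<in> {f. rat_regular id z f}" for \<beta> using Q unfolding Q_def by blast
    have v: "v = (\<lambda>\<beta>. rat_eval id z (u \<beta>))" using Q unfolding Q_def by blast
    have fr: "u \<beta> = rat_var \<beta>" if "\<beta> \<notin> prior \<alpha>" for \<beta> using Q that unfolding Q_def by blast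
    have "u \<alpha> = rat_var \<alpha>" using fr prior_irrefl by blast
    then have i: "inverse (u \<alpha>) \<in> {f. rat_regular id z f}"
      "rat_eval id z (inverse (u \<alpha>)) = inverse (rat_eval id z (u \<alpha>))"
      using eval_id.regular_inverse[of z "u \<alpha>"] reg[of \<alpha>] z[OF \<alpha>] by (simp_all add: eval_id.regular_var)
    have s: "step \<alpha> u \<beta> \<in> {f. rat_regular id z f} \<and>
        rat_eval id z (step \<alpha> u \<beta>) = step \<alpha> (\<lambda>\<beta>. rat_eval id z (u \<beta>)) \<beta>" for \<beta>
      by (rule step_hom[OF eval_id.regular_hom_on[of z] \<alpha>, of u \<beta>, OF reg i])
    have "step \<alpha> u \<beta> = rat_var \<beta>" if "\<beta> \<notin> insert \<alpha> (prior \<alpha>)" for \<beta>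
      using that fr[of \<beta>] step_outside[of \<beta> \<alpha> u] by simp
    then show "Q (insert \<alpha> (prior \<alpha>)) (step \<alpha> u) (step \<alpha> v)"
      using s unfolding Q_def v by (intro conjI) auto
  qed
  then have "(\<forall>\<beta>. rat_regular id z (sweep_cols r rat_var \<beta>)) \<and>
      sweep_cols r z = (\<lambda>\<beta>. rat_eval id z (sweep_cols r rat_var \<beta>))" unfolding Q_def by blast
  then show ?thesis by (simp del: split_paired_All)
qed

lemma jacobian_invertible_at:
  fixes z :: "nat \<times> nat \<Rightarrow> 'a::field"
  assumes z: "\<And>\<alpha>. \<alpha> \<in> V \<Longrightarrow> z \<alpha> \<noteq> 0"
  shows "invertible_mat (map_mat (rat_eval id z) (jacobian V (sweep_cols r rat_var)))"
proof -
  let ?J = "jacobian V (sweep_cols r (rat_var :: _ \<Rightarrow> 'a ratfun))"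
  have reg: "rat_regular id z (?J $$ (i, j))" if "i < card V" "j < card V" for i j
    using that sweep_values[OF z] by (simp add: jacobian_def Let_def eval_id.regular_pderiv)
  have ev: "rat_eval id z (det ?J) = det (map_mat (rat_eval id z) ?J)"
    using eval_id.det_regular[OF jacobian_carrier reg] by blast
  obtain s where s: "s \<in> {1, -1}" "det ?J = s * (\<Prod>(i, j)\<in>V. rat_var (i, j) ^ (j - i - 1))"
    using prod_step_det[where 'a='a] unfolding det_jacobian_sweep by blast
  have P: "rat_regular id z (\<Prod>(i, j)\<in>V. rat_var (i, j) ^ (j - i - 1)) \<and>
      rat_eval id z (\<Prod>(i, j)\<in>V. rat_var (i, j) ^ (j - i - 1)) = (\<Prod>\<alpha>\<in>V. rat_eval id z (rat_var \<alpha> ^ (snd \<alpha> - fst \<alpha> - 1)))"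
    unfolding case_prod_beta by (simp add: eval_id.regular_prod eval_id.regular_power eval_id.regular_var)
  have nz: "(\<Prod>\<alpha>\<in>V. rat_eval id z (rat_var \<alpha> ^ (snd \<alpha> - fst \<alpha> - 1))) \<noteq> 0"
    using z finite_V by (simp add: eval_id.regular_power eval_id.regular_var)
  have s': "rat_regular id z s \<and> rat_eval id z s \<noteq> 0"
    using s(1) eval_id.regular_one[of z] eval_id.regular_diff[of z 0 1] eval_id.regular_zero[of z] by auto
  have "det (map_mat (rat_eval id z) ?J) =
      rat_eval id z s * (\<Prod>\<alpha>\<in>V. rat_eval id z (rat_var \<alpha> ^ (snd \<alpha> - fst \<alpha> - 1)))"
    unfolding ev[symmetric] s(2) using P s' by (simp add: eval_id.regular_mult)
  then have "det (map_mat (rat_eval id z) ?J) \<noteq> 0"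
    using nz s' by (simp only: mult_eq_0_iff not_False_eq_True simp_thms)
  then show ?thesis
    by (intro invertible_mat_of_det[of _ "card V"]) (use jacobian_carrier in auto)
qed

lemma entry_diag [simp]: "entry P u a a = 1"
  by (simp add: entry_def)

lemma entry_lower: "b < a \<Longrightarrow> entry (prior \<alpha>) u a b = 0"
  by (auto simp: entry_def V_iff dest: prior_V)

lemma entry_nonzero: "entry (prior \<alpha>) u a b \<noteq> 0 \<Longrightarrow> \<rho> b \<le> \<rho> a"
  by (auto simp: entry_def V_iff dest: prior_V split: if_splits)

text \<open>Column \<open>p\<close> vanishes above its pivot.  Clearing preserves this: a column \<open>d\<close> with an entry in row \<open>c\<close>
  has its own pivot no lower than row \<open>c\<close>, hence above row \<open>p\<close>, and is used with coefficient \<open>0\<close> by induction.\<close>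

lemma elim_above:
  assumes "\<rho> c < \<rho> p" "k \<le> p"
  shows "elim (entry (prior \<alpha>) u) p k (entry (prior \<alpha>) u c) = 0"
  using assms
proof (induction k arbitrary: c)
  case 0
  then show ?case using entry_nonzero[of \<alpha> u c p] by auto
next
  case (Suc k)
  have 1: "elim (entry (prior \<alpha>) u) p k (entry (prior \<alpha>) u c) = 0" using Suc by simp
  have "entry (prior \<alpha>) u c (p - Suc k) = 0 \<or>
      elim (entry (prior \<alpha>) u) p k (entry (prior \<alpha>) u (p - Suc k)) = 0"
    using entry_nonzero[of \<alpha> u c "p - Suc k"] Suc.prems Suc.IH[of "p - Suc k"] by fastforce
  with 1 show ?case by auto
qed

section \<open>A step is a row operation followed by column operations\<close>

definition col_op :: "nat \<times> nat \<Rightarrow> (nat \<times> nat \<Rightarrow> 'b::field) \<Rightarrow> (nat \<Rightarrow> 'b) \<Rightarrow> nat \<Rightarrow> 'b" where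
  "col_op \<alpha> u v b = (if b = fst \<alpha> then - inverse (u \<alpha>) * v b
     else if b < fst \<alpha> then v b + entry (prior \<alpha>) u (row_above \<alpha>) b * elim (entry (prior \<alpha>) u) (fst \<alpha>) (fst \<alpha> - Suc b) v
     else v b)"

lemma col_op_expand:
  fixes u :: "nat \<times> nat \<Rightarrow> 'b::field"
  assumes "fst \<alpha> \<le> j" "b \<in> {1..j}"
  shows "col_op \<alpha> u v b = (\<Sum>d\<in>{1..j}. v d * col_op \<alpha> u (\<lambda>x. if x = d then 1 else 0) b)"
proof -
  let ?e = "\<lambda>d x. if x = d then 1 else 0 :: 'b"
  have v: "v b = (\<Sum>d\<in>{1..j}. v d * ?e d b)"
    using assms by (simp add: if_distrib[of "\<lambda>x. _ * x"] cong: if_cong)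
  consider "b = fst \<alpha>" | "b < fst \<alpha>" | "b > fst \<alpha>" by linarith
  then show ?thesis
  proof cases
    case 1
    have "col_op \<alpha> u v b = - inverse (u \<alpha>) * (\<Sum>d\<in>{1..j}. v d * ?e d b)"
      using 1 v by (simp add: col_op_def)
    also have "\<dots> = (\<Sum>d\<in>{1..j}. v d * col_op \<alpha> u (?e d) b)"
      using 1 unfolding sum_distrib_left by (intro sum.cong) (auto simp: col_op_def)
    finally show ?thesis .
  next
    case 2
    then have l: "fst \<alpha> - Suc b < fst \<alpha>" using assms by auto
    let ?x = "entry (prior \<alpha>) u (row_above \<alpha>) b" and ?el = "elim (entry (prior \<alpha>) u) (fst \<alpha>) (fst \<alpha> - Suc b)"
    have "col_op \<alpha> u v b = v b + ?x * ?el v" using 2 by (simp add: col_op_def)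
    also have "\<dots> = (\<Sum>d\<in>{1..j}. v d * ?e d b) + ?x * (\<Sum>d\<in>{1..j}. v d * ?el (?e d))"
      using v elim_expand[OF l assms(1), of "entry (prior \<alpha>) u" v] by simp
    also have "\<dots> = (\<Sum>d\<in>{1..j}. v d * col_op \<alpha> u (?e d) b)"
      using 2 unfolding sum_distrib_left sum.distrib[symmetric]
      by (intro sum.cong) (auto simp: col_op_def algebra_simps)
    finally show ?thesis .
  next
    case 3
    then show ?thesis using v by (simp add: col_op_def)
  qed
qed

text \<open>A column receives multiples of columns on its right only, so the matrix of the operation is lower triangular.\<close>

lemma col_op_unit:
  assumes "d \<le> b"
  shows "col_op \<alpha> u (\<lambda>x. if x = d then 1 else 0) b =
    (if d = b then (if b = fst \<alpha> then - inverse (u \<alpha>) else 1) else 0)"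
proof (cases "b < fst \<alpha>")
  case True
  then have "elim (entry (prior \<alpha>) u) (fst \<alpha>) (fst \<alpha> - Suc b) (\<lambda>x. if x = d then 1 else 0) = 0"
    using assms by (intro elim_zero) auto
  then show ?thesis using True by (simp add: col_op_def)
next
  case False
  then show ?thesis by (simp add: col_op_def)
qed

text \<open>At a position that is not free the correction has to vanish.  Left of the pivot, row \<open>c\<close> either has been cleared or vanishes up to column \<open>p\<close>;
  elsewhere, either row \<open>row_above \<alpha>\<close> has a zero there or row \<open>c\<close> stands above row \<open>p\<close>.\<close>

lemma step_other_row:
  assumes \<alpha>: "(p, j) \<in> V" and c: "1 \<le> c" "c \<le> j" "c \<noteq> p" and b: "1 \<le> b" "b \<le> j"
  shows "entry (insert (p, j) (prior (p, j))) (step (p, j) u) c b = col_op (p, j) u (entry (prior (p, j)) u c) b"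
proof -
  let ?P = "prior (p, j)" and ?q = "row_above (p, j)"
  let ?E = "entry ?P u" and ?E' = "entry (insert (p, j) ?P) (step (p, j) u)"
  have pj: "p < j" "j \<le> r" using \<alpha> by (auto simp: V_iff)
  have q: "\<rho> ?q < \<rho> p" using row_above(4)[OF \<alpha>] .
  consider "b = p" | "p < b" | "b < p" by linarith
  then show ?thesis
  proof cases
    case 1
    then show ?thesis using c by (auto simp: entry_def col_op_def step_def scale_def shift_def)
  next
    case 2
    then show ?thesis using c by (auto simp: entry_def col_op_def step_def scale_def shift_def)
  next
    case 3
    let ?l = "?E ?q b * elim ?E p (p - Suc b) (?E c)"
    have co: "col_op (p, j) u (?E c) b = ?E c b + ?l" using 3 by (simp add: col_op_def)
    have inP: "(c, b) \<in> ?P \<longleftrightarrow> (c, b) \<in> V" using 3 pj by (simp add: prior_iff)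
    have Eq: "\<rho> b \<le> \<rho> ?q" if "?E ?q b \<noteq> 0" using entry_nonzero[OF that] .
    show ?thesis
    proof (cases "(c, b) \<in> V")
      case True
      have "step (p, j) u (c, b) = u (c, b) + (if \<rho> p < \<rho> c then ?l else 0)"
        using 3 True inP c pj by (simp add: step_def scale_def shift_def)
      moreover have "elim ?E p (p - Suc b) (?E c) = 0" if "\<not> \<rho> p < \<rho> c"
      proof -
        have "\<rho> c < \<rho> p" using that c by (cases "\<rho> c" "\<rho> p" rule: linorder_cases) auto
        then show ?thesis by (rule elim_above) simp
      qed
      ultimately have "step (p, j) u (c, b) = ?E c b + ?l"
        using True inP by (auto simp: entry_def V_iff)
      then show ?thesis using True inP co by (auto simp: entry_def V_iff)
    next
      case notV: False
      have "?l = 0"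
      proof (cases "b < c")
        case True
        have "elim ?E p (p - Suc b) (?E c) = 0"
        proof (cases "c < p")
          case True
          then show ?thesis using \<open>b < c\<close>
            by (intro elim_eliminated) (auto simp: entry_lower)
        next
          case False
          then show ?thesis using c by (intro elim_zero) (auto simp: entry_lower)
        qed
        then show ?thesis by simp
      next
        case False
        then have "\<rho> c \<le> \<rho> b" using notV c b pj by (cases "c = b") (auto simp: V_iff)
        then have "?E ?q b = 0 \<or> \<rho> c < \<rho> p" using Eq q by linarith
        then show ?thesis using elim_above[of c p "p - Suc b" "(p, j)" u] by auto
      qed
      moreover have "?E' c b = ?E c b" using notV inP c by (auto simp: entry_def)
      ultimately show ?thesis using co by simp
    qed
  qed
qed

text \<open>The cleared column \<open>p\<close> has the entry \<open>0\<close> in row \<open>row_above \<alpha>\<close> and \<open>1\<close> in row \<open>p\<close>, so the entries left of the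
  pivot cancel exactly.\<close>

lemma step_own_row:
  assumes \<alpha>: "(p, j) \<in> V" and b: "1 \<le> b" "b \<le> j" and u: "u (p, j) \<noteq> 0"
  shows "entry (insert (p, j) (prior (p, j))) (step (p, j) u) p b =
    col_op (p, j) u (\<lambda>d. u (p, j) * (entry (prior (p, j)) u (row_above (p, j)) d - entry (prior (p, j)) u p d)) b"
proof -
  let ?P = "prior (p, j)" and ?q = "row_above (p, j)" and ?m = "u (p, j)"
  let ?E = "entry ?P u" and ?E' = "entry (insert (p, j) ?P) (step (p, j) u)"
  have pj: "1 \<le> p" "p < j" "j \<le> r" using \<alpha> by (auto simp: V_iff)
  note q = row_above[OF \<alpha>]
  consider "b = p" | "b < p" | "p < b" "b < j" | "b = j" using b by linarith
  then show ?thesis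
  proof cases
    case 1
    have "?E ?q p = 0" using entry_nonzero[of "(p, j)" u ?q p] q(4) by fastforce
    then show ?thesis using 1 u by (simp add: col_op_def)
  next
    case 2
    have "elim ?E p (p - Suc b) (?E ?q) = 0" by (rule elim_above[OF q(4)]) simp
    moreover have "elim ?E p (p - Suc b) (?E p) = 1"
      by (rule elim_pivot) (auto simp: entry_lower)
    moreover have "?E p b = 0" "?E' p b = 0"
      using 2 pj by (auto simp: entry_def V_iff dest: prior_V)
    ultimately show ?thesis using 2 by (simp add: col_op_def elim_times elim_diff)
  next
    case 3
    have inP: "(p, b) \<in> ?P \<longleftrightarrow> (p, b) \<in> V" using 3 by (simp add: prior_iff)
    show ?thesis
    proof (cases "(p, b) \<in> V")
      case True
      then show ?thesis using 3 inP by (simp add: entry_def col_op_def step_def scale_def shift_def algebra_simps)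
    next
      case False
      then have "\<rho> p < \<rho> b" using 3 pj rho_inj[of p b] by (auto simp: V_iff not_less le_less)
      then have "?E ?q b = 0" using entry_nonzero[of "(p, j)" u ?q b] q(4) by fastforce
      then show ?thesis using 3 False inP by (simp add: entry_def col_op_def)
    qed
  next
    case 4
    have "?E p j = 0" using pj prior_irrefl[of "(p, j)"] by (simp add: entry_def)
    moreover have "step (p, j) u (p, j) = ?E ?q j * ?m"
      using prior_irrefl[of "(p, j)"] by (simp add: step_def scale_def shift_def)
    ultimately show ?thesis using 4 pj by (simp add: entry_def[of "insert _ _"] col_op_def mult.commute)
  qed
qed

section \<open>The effect of a whole column\<close>

definition mult_upto :: "nat \<Rightarrow> (nat \<Rightarrow> nat \<Rightarrow> 'b::field) \<Rightarrow> (nat \<Rightarrow> nat \<Rightarrow> 'b) \<Rightarrow> nat \<Rightarrow> nat \<Rightarrow> 'b" where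
  "mult_upto j A B a b = (\<Sum>d\<in>{1..j}. A a d * B d b)"

lemma mult_upto_assoc:
  "(\<Sum>d\<in>{1..j}. mult_upto j A B a d * C d b) = mult_upto j A (mult_upto j B C) a b"
  unfolding mult_upto_def sum_distrib_left sum_distrib_right
  by (subst sum.swap) (simp add: mult.assoc)

text \<open>The accumulated column operations form a lower triangular matrix \<open>D\<close>.  A processed row enters the second relation instead
  of the first: its own row operation, read backwards, expresses the old row by two new ones.  The steps that follow change lower rows and
  otherwise only apply further column operations, which preserve linear relations between rows.\<close>

lemma column_transformation:
  fixes z :: "nat \<times> nat \<Rightarrow> 'b::field" and j :: nat
  assumes z: "\<And>\<alpha>. \<alpha> \<in> V \<Longrightarrow> z \<alpha> \<noteq> 0"
  defines "J \<equiv> Suc j"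
  defines "E0 \<equiv> entry (swept J 0) (sweep_cols j z)"
  shows "\<exists>D. (\<forall>d b. 1 \<le> d \<longrightarrow> d < b \<longrightarrow> b \<le> J \<longrightarrow> D d b = 0) \<and>
    (\<forall>d\<in>{1..J}. D d d = (if (d, J) \<in> swept J s then - inverse (z (d, J)) else 1)) \<and>
    (\<forall>c\<in>{1..J}. (c, J) \<notin> swept J s \<longrightarrow> (\<forall>b\<in>{1..J}.
       entry (swept J s) (sweep J s (sweep_cols j z)) c b = mult_upto J E0 D c b)) \<and>
    (\<forall>c. (c, J) \<in> swept J s \<longrightarrow> (\<forall>b\<in>{1..J}.
       entry (swept J s) (sweep J s (sweep_cols j z)) (row_above (c, J)) b -
       inverse (z (c, J)) * entry (swept J s) (sweep J s (sweep_cols j z)) c b = mult_upto J E0 D c b))"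
    (is "?C s")
proof (induction s)
  case 0
  have no: "(d, J) \<notin> swept J 0" for d using rho_bounds[of d J] by (auto simp: swept_def)
  have "mult_upto J E0 (\<lambda>d b. if d = b then 1 else 0) c b = E0 c b" if "b \<in> {1..J}" for c b
    using that by (simp add: mult_upto_def if_distrib[of "\<lambda>x. _ * x"] cong: if_cong)
  then show ?case using no
    by (intro exI[of _ "\<lambda>d b. if d = b then 1 else 0"]) (simp add: E0_def)
next
  case (Suc s)
  let ?p = "\<pi> (Suc s)"
  show ?case
  proof (cases "(?p, J) \<in> V")
    case False
    then show ?thesis using Suc by (simp add: swept_step)
  next
    case True
    define p where "p = ?p"
    define u where "u = sweep J s (sweep_cols j z)"
    let ?P = "prior (p, J)" and ?q = "row_above (p, J)"
    let ?E = "entry ?P u" and ?E' = "entry (insert (p, J) ?P) (step (p, J) u)"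
    have \<alpha>: "(p, J) \<in> V" using True by (simp add: p_def)
    have P: "swept J s = ?P" "swept J (Suc s) = insert (p, J) ?P" "sweep J (Suc s) (sweep_cols j z) = step (p, J) u"
      using True by (simp_all add: p_def u_def swept_step)
    have pj: "1 \<le> p" "p < J" using \<alpha> by (auto simp: V_iff)
    have "column_form z (swept J s) u"
      unfolding u_def J_def by (rule sweep_induct[of "\<lambda>P u v. column_form z P u" z z])
        (auto intro: column_form_init column_form_step)
    then have up: "u (p, J) = z (p, J)" unfolding P by (rule column_formD(1)) (rule prior_irrefl)
    then have unz: "u (p, J) \<noteq> 0" using z[OF \<alpha>] by simp
    obtain D where D: "\<And>d b. 1 \<le> d \<Longrightarrow> d < b \<Longrightarrow> b \<le> J \<Longrightarrow> D d b = 0"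
      "\<And>d. d \<in> {1..J} \<Longrightarrow> D d d = (if (d, J) \<in> ?P then - inverse (z (d, J)) else 1)"
      "\<And>c b. c \<in> {1..J} \<Longrightarrow> (c, J) \<notin> ?P \<Longrightarrow> b \<in> {1..J} \<Longrightarrow> ?E c b = mult_upto J E0 D c b"
      "\<And>c b. (c, J) \<in> ?P \<Longrightarrow> b \<in> {1..J} \<Longrightarrow>
         ?E (row_above (c, J)) b - inverse (z (c, J)) * ?E c b = mult_upto J E0 D c b"
      using Suc[folded u_def] unfolding P by blast
    define \<Delta> where "\<Delta> d b = col_op (p, J) u (\<lambda>x. if x = d then 1 else 0) b" for d b
    define D' where "D' = mult_upto J D \<Delta>"
    have op: "col_op (p, J) u v b = (\<Sum>d\<in>{1..J}. v d * \<Delta> d b)" if "b \<in> {1..J}" for v b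
      unfolding \<Delta>_def using pj that by (intro col_op_expand) auto
    have E0D': "(\<Sum>d\<in>{1..J}. mult_upto J E0 D c d * \<Delta> d b) = mult_upto J E0 D' c b" for c b
      unfolding D'_def by (rule mult_upto_assoc)
    have other: "?E' c b = (\<Sum>d\<in>{1..J}. ?E c d * \<Delta> d b)" if "c \<in> {1..J}" "c \<noteq> p" "b \<in> {1..J}" for c b
      using step_other_row[OF \<alpha>, of c b u] that op[of b "?E c"] by auto
    have own: "?E' p b = (\<Sum>d\<in>{1..J}. (u (p, J) * (?E ?q d - ?E p d)) * \<Delta> d b)" if "b \<in> {1..J}" for b
      using step_own_row[OF \<alpha>, of b u] that unz op[of b "\<lambda>d. u (p, J) * (?E ?q d - ?E p d)"] by auto
    have tri: "D' d b = 0" if db: "1 \<le> d" "d < b" "b \<le> J" for d b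
    proof -
      have "D d e * \<Delta> e b = 0" if "e \<in> {1..J}" for e
        using D(1)[of d e] col_op_unit[of e b "(p, J)" u] that db by (cases "d < e") (auto simp: \<Delta>_def)
      then show ?thesis unfolding D'_def mult_upto_def by (intro sum.neutral) blast
    qed
    have diag: "D' d d = (if (d, J) \<in> insert (p, J) ?P then - inverse (z (d, J)) else 1)" if d: "d \<in> {1..J}" for d
    proof -
      have "D d e * \<Delta> e d = (if e = d then D d d * \<Delta> d d else 0)" if "e \<in> {1..J}" for e
        using D(1)[of d e] col_op_unit[of e d "(p, J)" u] that d by (cases e d rule: linorder_cases) (auto simp: \<Delta>_def)
      then have "D' d d = (\<Sum>e\<in>{1..J}. if e = d then D d d * \<Delta> d d else 0)"
        unfolding D'_def mult_upto_def by (intro sum.cong refl)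
      also have "\<dots> = D d d * \<Delta> d d" using d by simp
      also have "\<Delta> d d = (if d = p then - inverse (z (p, J)) else 1)"
        using col_op_unit[of d d "(p, J)" u] up by (simp add: \<Delta>_def)
      finally show ?thesis using D(2)[OF d] prior_irrefl[of "(p, J)"] by auto
    qed
    have untouched: "?E' c b = mult_upto J E0 D' c b"
      if "c \<in> {1..J}" "(c, J) \<notin> insert (p, J) ?P" "b \<in> {1..J}" for c b
    proof -
      have "?E' c b = (\<Sum>d\<in>{1..J}. ?E c d * \<Delta> d b)" using other that by auto
      also have "\<dots> = (\<Sum>d\<in>{1..J}. mult_upto J E0 D c d * \<Delta> d b)"
        using D(3)[of c] that by (intro sum.cong) auto
      finally show ?thesis unfolding E0D' .
    qed
    have touched: "?E' (row_above (c, J)) b - inverse (z (c, J)) * ?E' c b = mult_upto J E0 D' c b"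
      if c: "(c, J) \<in> insert (p, J) ?P" and b: "b \<in> {1..J}" for c b
    proof (cases "c = p")
      case True
      have q: "?q \<in> {1..J}" "?q \<noteq> p" using row_above[OF \<alpha>] by auto
      have "inverse (z (p, J)) * ?E' p b = (\<Sum>d\<in>{1..J}. (?E ?q d - ?E p d) * \<Delta> d b)"
        unfolding own[OF b] sum_distrib_left using unz by (intro sum.cong) (auto simp: up)
      then have "?E' ?q b - inverse (z (p, J)) * ?E' p b = (\<Sum>d\<in>{1..J}. ?E p d * \<Delta> d b)"
        unfolding other[OF q b] by (simp add: sum_subtractf[symmetric] left_diff_distrib)
      also have "\<dots> = (\<Sum>d\<in>{1..J}. mult_upto J E0 D p d * \<Delta> d b)"
        using D(3)[of p] pj prior_irrefl[of "(p, J)"] by (intro sum.cong) auto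
      finally show ?thesis unfolding E0D' True .
    next
      case False
      then have cP: "(c, J) \<in> ?P" using c by simp
      then have cV: "(c, J) \<in> V" by (rule prior_V)
      have c': "c \<in> {1..J}" using cV by (auto simp: V_iff)
      have "\<rho> c < \<rho> p" using cP by (simp add: prior_iff)
      then have q: "row_above (c, J) \<in> {1..J}" "row_above (c, J) \<noteq> p" using row_above[OF cV] by auto
      have "?E' (row_above (c, J)) b - inverse (z (c, J)) * ?E' c b =
          (\<Sum>d\<in>{1..J}. (?E (row_above (c, J)) d - inverse (z (c, J)) * ?E c d) * \<Delta> d b)"
        unfolding other[OF q b] other[OF c' False b]
        by (simp add: sum_subtractf sum_distrib_left left_diff_distrib mult.assoc)
      also have "\<dots> = (\<Sum>d\<in>{1..J}. mult_upto J E0 D c d * \<Delta> d b)"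
        using D(4)[OF cP] by (intro sum.cong) auto
      finally show ?thesis unfolding E0D' .
    qed
    show ?thesis unfolding P
      by (intro exI[of _ D'] conjI allI ballI impI) (simp_all add: tri diag untouched touched)
  qed
qed

section \<open>Ranks and levels\<close>

text \<open>The position, counted from the top, of row \<open>a\<close> among the rows with labels up to \<open>j\<close>.\<close>

definition row_rank :: "nat \<Rightarrow> nat \<Rightarrow> nat" where
  "row_rank j a = card {c \<in> {1..j}. \<rho> c \<le> \<rho> a}"

lemma row_rank_mono:
  assumes "a' \<in> {1..j}" "\<rho> a < \<rho> a'" shows "row_rank j a < row_rank j a'"
proof -
  have "{c \<in> {1..j}. \<rho> c \<le> \<rho> a} \<subseteq> {c \<in> {1..j}. \<rho> c \<le> \<rho> a'}" using assms(2) by auto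
  moreover have "a' \<in> {c \<in> {1..j}. \<rho> c \<le> \<rho> a'}" "a' \<notin> {c \<in> {1..j}. \<rho> c \<le> \<rho> a}" using assms by auto
  ultimately have "{c \<in> {1..j}. \<rho> c \<le> \<rho> a} \<subset> {c \<in> {1..j}. \<rho> c \<le> \<rho> a'}" by blast
  then show ?thesis unfolding row_rank_def by (intro psubset_card_mono) auto
qed

lemma row_rank_less_iff:
  assumes "a \<in> {1..j}" "a' \<in> {1..j}" shows "row_rank j a < row_rank j a' \<longleftrightarrow> \<rho> a < \<rho> a'"
  using row_rank_mono[OF assms(1), of a'] row_rank_mono[OF assms(2), of a]
  by (cases "\<rho> a" "\<rho> a'" rule: linorder_cases) auto

lemma row_rank_inj:
  assumes "a \<in> {1..j}" "a' \<in> {1..j}" "row_rank j a = row_rank j a'" shows "a = a'"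
  using row_rank_less_iff[OF assms(1,2)] row_rank_less_iff[OF assms(2,1)] assms(3)
  by (cases "\<rho> a" "\<rho> a'" rule: linorder_cases) auto

lemma row_rank_le: "row_rank j a \<le> j"
proof -
  have "row_rank j a \<le> card {1..j}" unfolding row_rank_def by (rule card_mono) auto
  then show ?thesis by simp
qed

lemma row_rank_pos: "a \<in> {1..j} \<Longrightarrow> 1 \<le> row_rank j a"
proof -
  assume "a \<in> {1..j}"
  then have "{c \<in> {1..j}. \<rho> c \<le> \<rho> a} \<noteq> {}" by blast
  then have "row_rank j a \<noteq> 0" by (simp add: row_rank_def card_eq_0_iff)
  then show ?thesis by simp
qed

lemma row_rank_surj:
  assumes "i \<in> {1..j}" obtains a where "a \<in> {1..j}" "row_rank j a = i"
proof -
  have "row_rank j ` {1..j} \<subseteq> {1..j}" using row_rank_le row_rank_pos by auto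
  moreover have "inj_on (row_rank j) {1..j}" using row_rank_inj by (intro inj_onI) blast
  ultimately have "row_rank j ` {1..j} = {1..j}" by (intro endo_inj_surj) auto
  then have "i \<in> row_rank j ` {1..j}" using assms by simp
  then show thesis using that by auto
qed

lemma row_rank_Suc: "row_rank (Suc j) a = row_rank j a + (if \<rho> (Suc j) \<le> \<rho> a then 1 else 0)"
proof -
  have "{c \<in> {1..Suc j}. \<rho> c \<le> \<rho> a} = {c \<in> {1..j}. \<rho> c \<le> \<rho> a} \<union> (if \<rho> (Suc j) \<le> \<rho> a then {Suc j} else {})"
    by (auto simp: le_Suc_eq)
  then show ?thesis unfolding row_rank_def by (simp add: card_insert_if)
qed

lemma row_rank_pre:
  assumes "(p, j) \<in> V" shows "row_rank j p = Suc (row_rank j (row_above (p, j)))"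
proof -
  note q = row_above[OF assms]
  have "p \<in> {1..j}" using assms by (auto simp: V_iff)
  then have "{c \<in> {1..j}. \<rho> c \<le> \<rho> p} = insert p {c \<in> {1..j}. \<rho> c \<le> \<rho> (row_above (p, j))}"
    using q(4) q(5) by (auto simp: le_less)
  moreover have "p \<notin> {c \<in> {1..j}. \<rho> c \<le> \<rho> (row_above (p, j))}" using q(4) by simp
  ultimately show ?thesis unfolding row_rank_def by simp
qed

lemma card_rho_le: "s \<le> r \<Longrightarrow> card {c \<in> {1..r}. \<rho> c \<le> s} = s"
proof -
  assume s: "s \<le> r"
  have "{c \<in> {1..r}. \<rho> c \<le> s} = \<pi> ` {1..s}"
  proof (rule Set.set_eqI)
    fix c
    show "c \<in> {c \<in> {1..r}. \<rho> c \<le> s} \<longleftrightarrow> c \<in> \<pi> ` {1..s}"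
    proof
      assume "c \<in> {c \<in> {1..r}. \<rho> c \<le> s}"
      then have "\<rho> c \<in> {1..s}" using rho_range[of c] by simp
      then show "c \<in> \<pi> ` {1..s}" by (intro image_eqI[of _ _ "\<rho> c"]) simp_all
    next
      assume "c \<in> \<pi> ` {1..s}"
      then obtain t where "c = \<pi> t" "t \<in> {1..s}" by blast
      then show "c \<in> {c \<in> {1..r}. \<rho> c \<le> s}" using pi_range[of t] s by simp
    qed
  qed
  moreover have "inj_on \<pi> {1..s}" using permutes_inj[OF perm] by (auto simp: inj_on_def)
  ultimately show ?thesis by (simp add: card_image)
qed

lemma row_rank_pi: "s \<in> {1..r} \<Longrightarrow> row_rank r (\<pi> s) = s"
  using card_rho_le[of s] by (simp add: row_rank_def)

text \<open>Of the \<open>\<rho> a\<close> rows from the top down to row \<open>a\<close>, the level discards those with labels beyond \<open>b\<close>.\<close>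

lemma level_eq_row_rank:
  assumes "(a, b) \<in> V" shows "level r \<pi> (a, b) = int (row_rank b a)"
proof -
  have ab: "1 \<le> a" "a < b" "b \<le> r" using assms by (auto simp: V_iff)
  have "\<rho> a \<le> r" using rho_bounds[OF assms] by simp
  then have "\<rho> a = card {c \<in> {1..r}. \<rho> c \<le> \<rho> a}" using card_rho_le by simp
  also have "{c \<in> {1..r}. \<rho> c \<le> \<rho> a} = {c \<in> {1..b}. \<rho> c \<le> \<rho> a} \<union> {c \<in> {b<..r}. \<rho> c \<le> \<rho> a}"
    using ab by auto
  also have "card \<dots> = row_rank b a + card {c \<in> {b<..r}. \<rho> c \<le> \<rho> a}"
    unfolding row_rank_def by (rule card_Un_disjoint) auto
  finally have 1: "\<rho> a = row_rank b a + card {c \<in> {b<..r}. \<rho> c \<le> \<rho> a}" .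
  have "{c \<in> {b<..r}. \<rho> c \<le> \<rho> a} \<union> {c \<in> {1..r}. c > b \<and> \<rho> c > \<rho> a} = {b<..r}" by auto
  moreover have "card ({c \<in> {b<..r}. \<rho> c \<le> \<rho> a} \<union> {c \<in> {1..r}. c > b \<and> \<rho> c > \<rho> a}) =
      card {c \<in> {b<..r}. \<rho> c \<le> \<rho> a} + card {c \<in> {1..r}. c > b \<and> \<rho> c > \<rho> a}"
    by (rule card_Un_disjoint) auto
  ultimately have "card {c \<in> {b<..r}. \<rho> c \<le> \<rho> a} + h_count r \<pi> (\<rho> a) b = r - b"
    unfolding h_count_def by simp
  with 1 ab show ?thesis unfolding level_def by simp
qed

lemma Bw_eq: "Bw r \<pi> i = {\<alpha> \<in> V. row_rank (snd \<alpha>) (fst \<alpha>) = i}"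
  unfolding Bw_def using level_eq_row_rank by auto

lemma row_rank_ge_2: "(a, b) \<in> V \<Longrightarrow> 2 \<le> row_rank b a"
  using row_rank_mono[of a b b] row_rank_pos[of b b] by (simp add: V_iff)

lemma Bw_partition: "disjoint_family_on (Bw r \<pi>) {2..r}" "(\<Union>i\<in>{2..r}. Bw r \<pi> i) = V"
proof -
  show "disjoint_family_on (Bw r \<pi>) {2..r}" by (auto simp: disjoint_family_on_def Bw_eq)
  have "row_rank b a \<in> {2..r}" if "(a, b) \<in> V" for a b
    using row_rank_ge_2[OF that] row_rank_le[of b a] that by (auto simp: V_iff)
  then show "(\<Union>i\<in>{2..r}. Bw r \<pi> i) = V" by (auto simp: Bw_eq)
qed

section \<open>The factorisation\<close>

definition level_sum :: "(nat \<times> nat \<Rightarrow> 'b::field) \<Rightarrow> nat \<Rightarrow> nat \<Rightarrow> 'b" where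
  "level_sum z j i = (\<Sum>\<alpha>\<in>{\<alpha> \<in> V. snd \<alpha> \<le> j \<and> row_rank (snd \<alpha>) (fst \<alpha>) = i}. inverse (z \<alpha>))"

lemma level_sum_beyond: "j < i \<Longrightarrow> level_sum z j i = 0"
proof -
  assume i: "j < i"
  have "\<not> (snd \<alpha> \<le> j \<and> row_rank (snd \<alpha>) (fst \<alpha>) = i)" for \<alpha> :: "nat \<times> nat"
    using i row_rank_le[of "snd \<alpha>" "fst \<alpha>"] by linarith
  then have "{\<alpha> \<in> V. snd \<alpha> \<le> j \<and> row_rank (snd \<alpha>) (fst \<alpha>) = i} = {}" by blast
  then show ?thesis unfolding level_sum_def by (simp only: sum.empty)
qed

lemma level_sum_Suc_none:
  assumes "\<And>c. (c, Suc j) \<in> V \<Longrightarrow> row_rank (Suc j) c \<noteq> i"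
  shows "level_sum z (Suc j) i = level_sum z j i"
proof -
  have "\<alpha> \<in> {\<alpha> \<in> V. snd \<alpha> \<le> Suc j \<and> row_rank (snd \<alpha>) (fst \<alpha>) = i} \<longleftrightarrow>
      \<alpha> \<in> {\<alpha> \<in> V. snd \<alpha> \<le> j \<and> row_rank (snd \<alpha>) (fst \<alpha>) = i}" for \<alpha>
    using assms[of "fst \<alpha>"] by (cases \<alpha>; cases "snd \<alpha> = Suc j") auto
  then show ?thesis unfolding level_sum_def by (intro sum.cong) blast+
qed

lemma level_sum_Suc_one:
  assumes "(c, Suc j) \<in> V" "row_rank (Suc j) c = i"
  shows "level_sum z (Suc j) i = inverse (z (c, Suc j)) + level_sum z j i"
proof -
  have uniq: "c' = c" if "(c', Suc j) \<in> V" "row_rank (Suc j) c' = i" for c'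
    using that assms row_rank_inj[of c' "Suc j" c] by (simp add: V_iff)
  let ?S = "{\<alpha> \<in> V. snd \<alpha> \<le> j \<and> row_rank (snd \<alpha>) (fst \<alpha>) = i}"
  have "\<alpha> \<in> {\<alpha> \<in> V. snd \<alpha> \<le> Suc j \<and> row_rank (snd \<alpha>) (fst \<alpha>) = i} \<longleftrightarrow> \<alpha> \<in> insert (c, Suc j) ?S" for \<alpha>
    using uniq[of "fst \<alpha>"] assms by (cases \<alpha>; cases "snd \<alpha> = Suc j") auto
  then have e: "{\<alpha> \<in> V. snd \<alpha> \<le> Suc j \<and> row_rank (snd \<alpha>) (fst \<alpha>) = i} = insert (c, Suc j) ?S" by blast
  have "(c, Suc j) \<notin> ?S" "finite ?S" using finite_V by simp_all
  then show ?thesis unfolding level_sum_def e by (rule sum.insert[rotated])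
qed

text \<open>The diagonal entries of \<open>b\<close> once \<open>j\<close> columns have been processed.\<close>

definition pivot :: "(nat \<times> nat \<Rightarrow> 'b::field) \<Rightarrow> nat \<Rightarrow> nat \<Rightarrow> 'b" where
  "pivot z j c = (-1) ^ (c + row_rank j c) *
     ((\<Prod>a\<in>{a. (a, c) \<in> V}. - z (a, c)) / (\<Prod>e\<in>{e. (c, e) \<in> V \<and> e \<le> j}. z (c, e)))"

lemma finite_sections: "finite {a. (a, c) \<in> V}" "finite {e. (c, e) \<in> V \<and> X e}"
  by (rule finite_subset[of _ "{..r}"]; force simp: V_iff)+

lemma pivot_Suc:
  assumes "c \<in> {1..j}" "Suc j \<le> r"
  shows "pivot z (Suc j) c = pivot z j c * (if (c, Suc j) \<in> V then - inverse (z (c, Suc j)) else 1)"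
proof (cases "(c, Suc j) \<in> V")
  case True
  have "{e. (c, e) \<in> V \<and> e \<le> Suc j} = insert (Suc j) {e. (c, e) \<in> V \<and> e \<le> j}"
    using True by (auto simp: le_Suc_eq)
  then have "(\<Prod>e\<in>{e. (c, e) \<in> V \<and> e \<le> Suc j}. z (c, e)) = z (c, Suc j) * (\<Prod>e\<in>{e. (c, e) \<in> V \<and> e \<le> j}. z (c, e))"
    by (simp add: finite_sections)
  moreover have "row_rank (Suc j) c = Suc (row_rank j c)" using True by (simp add: row_rank_Suc V_iff)
  ultimately show ?thesis using True by (simp add: pivot_def divide_inverse)
next
  case False
  then have "{e. (c, e) \<in> V \<and> e \<le> Suc j} = {e. (c, e) \<in> V \<and> e \<le> j}" by (auto simp: le_Suc_eq)
  moreover have "row_rank (Suc j) c = row_rank j c"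
    using False assms by (auto simp: row_rank_Suc V_iff le_less)
  ultimately show ?thesis using False by (simp add: pivot_def)
qed

lemma pivot_new:
  fixes z :: "nat \<times> nat \<Rightarrow> 'b::field"
  assumes "1 \<le> j" "j \<le> r"
  shows "pivot z j j = (\<Prod>a\<in>{a. (a, j) \<in> V}. z (a, j))"
proof -
  have e: "{e. (j, e) \<in> V \<and> e \<le> j} = {}" by (auto simp: V_iff)
  have "{c \<in> {1..j}. \<rho> c \<le> \<rho> j} \<union> {a. (a, j) \<in> V} = {1..j}"
  proof (rule Set.set_eqI)
    show "x \<in> {c \<in> {1..j}. \<rho> c \<le> \<rho> j} \<union> {a. (a, j) \<in> V} \<longleftrightarrow> x \<in> {1..j}" for x
      using assms by (cases "x = j"; cases "\<rho> x" "\<rho> j" rule: linorder_cases) (auto simp: V_iff)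
  qed
  moreover have "card ({c \<in> {1..j}. \<rho> c \<le> \<rho> j} \<union> {a. (a, j) \<in> V}) = row_rank j j + card {a. (a, j) \<in> V}"
    unfolding row_rank_def by (rule card_Un_disjoint) (auto simp: finite_sections V_iff)
  ultimately have "j = row_rank j j + card {a. (a, j) \<in> V}" by simp
  then have n: "j + row_rank j j = 2 * row_rank j j + card {a. (a, j) \<in> V}" by linarith
  have "(-1 :: 'b) ^ (j + row_rank j j) = (-1) ^ card {a. (a, j) \<in> V}" unfolding n by (simp add: power_add)
  moreover have "(-1 :: 'b) ^ k * (-1) ^ k = 1" for k by (simp flip: power_mult_distrib)
  ultimately have "(-1) ^ (j + row_rank j j) * (\<Prod>a\<in>{a. (a, j) \<in> V}. - z (a, j)) = (\<Prod>a\<in>{a. (a, j) \<in> V}. z (a, j))"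
    by (simp add: prod_uminus mult.assoc[symmetric])
  then show ?thesis unfolding pivot_def e by simp
qed

text \<open>Row \<open>row_rank j a\<close> of the unipotent factor is \<open>y a\<close>.  For the bottom row the superdiagonal entry lies outside the matrix, and the clause about it says \<open>0 = 0\<close>.\<close>

definition factored :: "(nat \<times> nat \<Rightarrow> 'b::field) \<Rightarrow> nat \<Rightarrow> (nat \<Rightarrow> nat \<Rightarrow> 'b) \<Rightarrow> (nat \<Rightarrow> nat \<Rightarrow> 'b) \<Rightarrow> bool" where
  "factored z j y b \<longleftrightarrow>
    (\<forall>a\<in>{1..j}. (\<forall>c\<in>{1..j}. entry (swept j r) (sweep_cols j z) a c = (\<Sum>t\<in>{1..j}. y a t * b t c)) \<and>
       y a (row_rank j a) = 1 \<and> (\<forall>t. t < row_rank j a \<or> j < t \<longrightarrow> y a t = 0) \<and>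
       y a (Suc (row_rank j a)) = level_sum z j (Suc (row_rank j a))) \<and>
    (\<forall>t\<in>{1..j}. \<forall>c\<in>{1..j}. t < c \<longrightarrow> b t c = 0) \<and>
    (\<forall>c\<in>{1..j}. b c c = pivot z j c)"

lemma factoredD:
  assumes "factored z j y b"
  shows "a \<in> {1..j} \<Longrightarrow> c \<in> {1..j} \<Longrightarrow> entry (swept j r) (sweep_cols j z) a c = (\<Sum>t\<in>{1..j}. y a t * b t c)"
    "a \<in> {1..j} \<Longrightarrow> y a (row_rank j a) = 1"
    "a \<in> {1..j} \<Longrightarrow> t < row_rank j a \<or> j < t \<Longrightarrow> y a t = 0"
    "a \<in> {1..j} \<Longrightarrow> y a (Suc (row_rank j a)) = level_sum z j (Suc (row_rank j a))"
    "t \<in> {1..j} \<Longrightarrow> c \<in> {1..j} \<Longrightarrow> t < c \<Longrightarrow> b t c = 0"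
    "c \<in> {1..j} \<Longrightarrow> b c c = pivot z j c"
  using assms unfolding factored_def by blast+

lemma column_form_sweep: "column_form z (swept (Suc j) s) (sweep (Suc j) s (sweep_cols j z))"
  by (rule sweep_induct[of "\<lambda>P u v. column_form z P u" z z])
     (auto intro: column_form_init column_form_step)

text \<open>Rows above the new pivot keep their row of \<open>y\<close>.  For the others, starting from the bottom, \<open>column_transformation\<close>
  gives row \<open>a\<close> as \<open>1 / n\<close> times the next row \<open>c\<close> plus the old row \<open>c\<close>, whose rank among the old rows is that of \<open>a\<close> among the
  new ones.  So \<open>y\<close> is multiplied by elementary matrices, and the superdiagonal entry grows by \<open>1 / n\<close>.\<close>

lemma factored_Suc:
  fixes z :: "nat \<times> nat \<Rightarrow> 'b::field"
  assumes z: "\<And>\<alpha>. \<alpha> \<in> V \<Longrightarrow> z \<alpha> \<noteq> 0" and J: "Suc j \<le> r" and F: "factored z j y b"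
  shows "\<exists>y b. factored z (Suc j) y b"
proof -
  let ?J = "Suc j"
  define E0 where "E0 = entry (swept j r) (sweep_cols j z)"
  define E where "E = entry (swept ?J r) (sweep_cols ?J z)"
  have sw: "(c, ?J) \<in> swept ?J r \<longleftrightarrow> (c, ?J) \<in> V" for c by (simp add: swept_full)
  obtain D where D: "\<And>d b. 1 \<le> d \<Longrightarrow> d < b \<Longrightarrow> b \<le> ?J \<Longrightarrow> D d b = 0"
    "\<And>d. d \<in> {1..?J} \<Longrightarrow> D d d = (if (d, ?J) \<in> V then - inverse (z (d, ?J)) else 1)"
    "\<And>c b. c \<in> {1..?J} \<Longrightarrow> (c, ?J) \<notin> V \<Longrightarrow> b \<in> {1..?J} \<Longrightarrow> E c b = mult_upto ?J E0 D c b"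
    "\<And>c b. (c, ?J) \<in> V \<Longrightarrow> b \<in> {1..?J} \<Longrightarrow>
       E (row_above (c, ?J)) b - inverse (z (c, ?J)) * E c b = mult_upto ?J E0 D c b"
    using column_transformation[of z j r, OF z] unfolding sw swept_Suc
    unfolding E_def[unfolded sweep_cols.simps, symmetric] E0_def[symmetric] by blast
  note Fy = factoredD[OF F, folded E0_def]
  have E0_fac: "E0 a c = (\<Sum>t\<in>{1..j}. y a t * b t c)" if "a \<in> {1..j}" "c \<in> {1..j}" for a c
    using Fy(1) that .
  have E0_new: "E0 a ?J = 0" if "a \<in> {1..j}" for a
    using that by (auto simp: E0_def entry_def swept_full)
  \<comment> \<open>All rows of the new \<open>b\<close> but the last are rows of the old \<open>b\<close> times \<open>D\<close>; the last is the bottom row \<open>l\<close> itself.\<close>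
  obtain l where l: "l \<in> {1..?J}" "row_rank ?J l = ?J" by (rule row_rank_surj[of ?J ?J]) auto
  define b' where "b' t c = (if t = ?J then E l c else (\<Sum>e\<in>{1..j}. b t e * D e c))" for t c
  have row: "mult_upto ?J E0 D a c = (\<Sum>t\<in>{1..?J}. y a t * b' t c)" if a: "a \<in> {1..j}" and c: "c \<in> {1..?J}" for a c
  proof -
    have yJ: "y a ?J = 0" by (rule Fy(3)[OF a]) simp
    have "mult_upto ?J E0 D a c = (\<Sum>d\<in>{1..j}. E0 a d * D d c)"
      using E0_new[OF a] by (simp add: mult_upto_def)
    also have "\<dots> = (\<Sum>d\<in>{1..j}. \<Sum>t\<in>{1..j}. y a t * (b t d * D d c))"
      by (intro sum.cong) (simp_all add: E0_fac[OF a] sum_distrib_right mult.assoc)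
    also have "\<dots> = (\<Sum>t\<in>{1..j}. y a t * (\<Sum>d\<in>{1..j}. b t d * D d c))"
      by (subst sum.swap) (simp add: sum_distrib_left)
    also have "\<dots> = (\<Sum>t\<in>{1..?J}. y a t * b' t c)"
      using yJ by (simp add: b'_def)
    finally show ?thesis .
  qed
  have rk_old: "row_rank ?J a = row_rank j a" if "\<rho> a < \<rho> ?J" for a
    using that by (simp add: row_rank_Suc)
  have rows: "\<exists>Y. (\<forall>c\<in>{1..?J}. E a c = (\<Sum>t\<in>{1..?J}. Y t * b' t c)) \<and>
      Y (row_rank ?J a) = 1 \<and> (\<forall>t. t < row_rank ?J a \<or> ?J < t \<longrightarrow> Y t = 0) \<and>
      Y (Suc (row_rank ?J a)) = level_sum z ?J (Suc (row_rank ?J a))" if "a \<in> {1..?J}" for a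
    using that
  proof (induction "?J - row_rank ?J a" arbitrary: a rule: less_induct)
    case less
    have aJ: "a \<in> {1..?J}" using less.prems .
    consider "\<rho> a < \<rho> ?J" | "row_rank ?J a = ?J" | "\<rho> ?J \<le> \<rho> a" "row_rank ?J a < ?J"
      using row_rank_le[of ?J a] by linarith
    then show ?case
    proof cases
      case 1
      then have a: "a \<in> {1..j}" using aJ by (auto simp: le_Suc_eq)
      have none: "(a, ?J) \<notin> V" using 1 by (simp add: V_iff)
      \<comment> \<open>The row of the new pivot lies strictly between row \<open>a\<close> and row \<open>c\<close>.\<close>
      have "row_rank ?J c \<noteq> Suc (row_rank ?J a)" if "(c, ?J) \<in> V" for c
      proof -
        have "row_rank ?J a < row_rank ?J ?J" using 1 by (intro row_rank_mono) auto
        moreover have "row_rank ?J ?J < row_rank ?J c" using that by (intro row_rank_mono) (auto simp: V_iff)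
        ultimately show ?thesis by linarith
      qed
      then have "level_sum z ?J (Suc (row_rank ?J a)) = level_sum z j (Suc (row_rank ?J a))"
        by (rule level_sum_Suc_none)
      moreover have "E a c = (\<Sum>t\<in>{1..?J}. y a t * b' t c)" if "c \<in> {1..?J}" for c
        using D(3)[OF aJ none that] row[OF a that] by simp
      moreover have "y a t = 0" if "t < row_rank j a \<or> ?J < t" for t
        using Fy(3)[OF a, of t] that by auto
      ultimately show ?thesis using Fy(2,4)[OF a] unfolding rk_old[OF 1]
        by (intro exI[of _ "y a"]) (simp only:, blast)
    next
      case 2
      then have "a = l" using l row_rank_inj[OF aJ, of l] by simp
      then have "E a c = (\<Sum>t\<in>{1..?J}. (if t = ?J then 1 else 0) * b' t c)" for c
        by (simp add: b'_def)
      then show ?thesis using 2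
        by (intro exI[of _ "\<lambda>t. if t = ?J then 1 else 0"]) (simp add: level_sum_beyond)
    next
      case 3
      \<comment> \<open>The row directly below row \<open>a\<close>.\<close>
      obtain c where c: "c \<in> {1..?J}" "row_rank ?J c = Suc (row_rank ?J a)"
        by (rule row_rank_surj[of "Suc (row_rank ?J a)" ?J]) (use 3 in auto)
      have "\<rho> a < \<rho> c" using row_rank_less_iff[OF aJ c(1)] c(2) by simp
      then have "\<rho> ?J < \<rho> c" using 3 by simp
      moreover from this have "c \<noteq> ?J" by auto
      ultimately have cV: "(c, ?J) \<in> V" and cj: "c \<in> {1..j}" using c J by (auto simp: V_iff)
      have pJ: "row_above (c, ?J) \<in> {1..?J}" using row_above(1,2)[OF cV] by simp
      have "row_rank ?J (row_above (c, ?J)) = row_rank ?J a" using row_rank_pre[OF cV] c(2) by simp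
      then have "row_above (c, ?J) = a" by (rule row_rank_inj[OF pJ aJ])
      then have E: "E a k = inverse (z (c, ?J)) * E c k + mult_upto ?J E0 D c k" if "k \<in> {1..?J}" for k
        using D(4)[OF cV that] by (simp add: algebra_simps)
      have "?J - row_rank ?J c < ?J - row_rank ?J a" using c 3 by simp
      from less.hyps[OF this c(1)] obtain Y where Y:
        "\<And>k. k \<in> {1..?J} \<Longrightarrow> E c k = (\<Sum>t\<in>{1..?J}. Y t * b' t k)"
        "Y (row_rank ?J c) = 1" "\<And>t. t < row_rank ?J c \<or> ?J < t \<Longrightarrow> Y t = 0" by blast
      have rkc: "row_rank j c = row_rank ?J a" using c(2) \<open>\<rho> ?J < \<rho> c\<close> by (simp add: row_rank_Suc[of j c])
      have yc: "y c (row_rank ?J a) = 1" "\<And>t. t < row_rank ?J a \<or> j < t \<Longrightarrow> y c t = 0"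
        "y c (Suc (row_rank ?J a)) = level_sum z j (Suc (row_rank ?J a))"
        using Fy(2-4)[OF cj] unfolding rkc by blast+
      let ?Y = "\<lambda>t. inverse (z (c, ?J)) * Y t + y c t"
      have "E a k = (\<Sum>t\<in>{1..?J}. ?Y t * b' t k)" if "k \<in> {1..?J}" for k
        unfolding E[OF that] Y(1)[OF that] row[OF cj that]
        by (simp only: sum_distrib_left sum.distrib[symmetric] distrib_right mult.assoc)
      moreover have "?Y (row_rank ?J a) = 1" using Y(3)[of "row_rank ?J a"] yc(1) c(2) by simp
      moreover have "?Y t = 0" if "t < row_rank ?J a \<or> ?J < t" for t
        using Y(3)[of t] yc(2)[of t] that c(2) by auto
      moreover have "?Y (Suc (row_rank ?J a)) = level_sum z ?J (Suc (row_rank ?J a))"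
        using Y(2) yc(3) level_sum_Suc_one[OF cV c(2), of z] c(2) by simp
      ultimately show ?thesis by (intro exI[of _ ?Y]) blast
    qed
  qed
  define ok where "ok a Y \<longleftrightarrow> (\<forall>c\<in>{1..?J}. E a c = (\<Sum>t\<in>{1..?J}. Y t * b' t c)) \<and>
      Y (row_rank ?J a) = 1 \<and> (\<forall>t. t < row_rank ?J a \<or> ?J < t \<longrightarrow> Y t = 0) \<and>
      Y (Suc (row_rank ?J a)) = level_sum z ?J (Suc (row_rank ?J a))" for a Y
  have "\<forall>a\<in>{1..?J}. \<exists>Y. ok a Y" unfolding ok_def using rows by (intro ballI)
  then have "\<exists>y'. \<forall>a\<in>{1..?J}. ok a (y' a)" by (rule bchoice)
  then obtain y' where y': "\<forall>a\<in>{1..?J}. ok a (y' a)" by blast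
  have b_low: "b t e = 0" if "t \<in> {1..j}" "e \<in> {1..j}" "t < e" for t e using Fy(5) that .
  have tri: "b' t c = 0" if t: "t \<in> {1..?J}" and c: "c \<in> {1..?J}" and tc: "t < c" for t c
  proof -
    have tj: "t \<in> {1..j}" using t c tc by auto
    have "b t e * D e c = 0" if "e \<in> {1..j}" for e
      using b_low[OF tj that] D(1)[of e c] that c tc by (cases "t < e") auto
    then have "(\<Sum>e\<in>{1..j}. b t e * D e c) = 0" by (intro sum.neutral) blast
    then show ?thesis using tj by (simp add: b'_def)
  qed
  have diag: "b' c c = pivot z ?J c" if c: "c \<in> {1..?J}" for c
  proof (cases "c = ?J")
    case True
    have "E l ?J = (\<Prod>a\<in>{a. (a, ?J) \<in> V}. z (a, ?J))"
    proof (cases "l = ?J")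
      case True
      have "{a. (a, ?J) \<in> V} = {}"
        using row_rank_mono[of _ ?J ?J] l True row_rank_le[of ?J] by (force simp: V_iff not_le[symmetric])
      then show ?thesis using True by (simp add: E_def entry_def)
    next
      case False
      have top: "\<rho> a \<le> \<rho> l" if "a \<in> {1..?J}" for a
        using row_rank_mono[OF that, of l] row_rank_le[of ?J a] l(2) by (force simp: not_le[symmetric])
      have "\<rho> ?J \<le> \<rho> l" by (rule top) simp
      moreover have "\<rho> ?J \<noteq> \<rho> l" using False by simp
      ultimately have "\<rho> ?J < \<rho> l" by linarith
      then have lV: "(l, ?J) \<in> V" using l False J by (simp add: V_iff)
      have "sweep_cols ?J z (l, ?J) = (\<Prod>\<delta>\<in>{\<delta> \<in> swept ?J r. snd \<delta> = ?J \<and> \<rho> (fst \<delta>) \<le> \<rho> l}. z \<delta>)"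
        using column_formD(2)[OF column_form_sweep[of z j r], of ?J l] lV
        by (auto simp: swept_full)
      also have "{\<delta> \<in> swept ?J r. snd \<delta> = ?J \<and> \<rho> (fst \<delta>) \<le> \<rho> l} = (\<lambda>a. (a, ?J)) ` {a. (a, ?J) \<in> V}"
        using top by (auto simp: swept_full V_iff)
      also have "(\<Prod>\<delta>\<in>\<dots>. z \<delta>) = (\<Prod>a\<in>{a. (a, ?J) \<in> V}. z (a, ?J))"
        by (subst prod.reindex) (auto simp: inj_on_def)
      finally show ?thesis using lV False by (simp add: E_def entry_def swept_full)
    qed
    then show ?thesis using True J by (simp add: b'_def pivot_new)
  next
    case False
    then have cj: "c \<in> {1..j}" using c by auto
    have "b c e * D e c = (if e = c then b c c * D c c else 0)" if "e \<in> {1..j}" for e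
      using b_low[OF cj that] D(1)[of e c] that cj by (cases e c rule: linorder_cases) auto
    then have "(\<Sum>e\<in>{1..j}. b c e * D e c) = (\<Sum>e\<in>{1..j}. if e = c then b c c * D c c else 0)"
      by (intro sum.cong refl)
    also have "\<dots> = b c c * D c c" using cj by simp
    finally have "b' c c = b c c * D c c" using False by (simp add: b'_def)
    then show ?thesis using Fy(6)[OF cj] D(2)[OF c] pivot_Suc[OF cj J, of z] by simp
  qed
  have "factored z ?J y' b'"
    unfolding factored_def E_def[symmetric] using y'[unfolded ok_def] tri diag by (intro conjI ballI impI) simp_all
  then show ?thesis by blast
qed

lemma factored_exists:
  fixes z :: "nat \<times> nat \<Rightarrow> 'b::field"
  assumes z: "\<And>\<alpha>. \<alpha> \<in> V \<Longrightarrow> z \<alpha> \<noteq> 0"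
  shows "\<exists>y b. factored z r y b"
proof -
  have "\<exists>y b. factored z j y b" if "j \<le> r" for j
    using that
  proof (induction j)
    case 0
    show ?case by (simp add: factored_def)
  next
    case (Suc j)
    then obtain y b where "factored z j y b" by auto
    then show ?case using factored_Suc[of z j y b] z Suc.prems by blast
  qed
  then show ?thesis by blast
qed

lemma sweep_factorisation:
  fixes z :: "nat \<times> nat \<Rightarrow> 'b::field"
  assumes z: "\<And>\<alpha>. \<alpha> \<in> V \<Longrightarrow> z \<alpha> \<noteq> 0"
  shows "\<exists>x\<in>unipotent_upper r. \<exists>b\<in>borel_lower r.
    perm_matrix r \<pi> * n_matrix r \<pi> (sweep_cols r z) = x * b \<and>
    (\<forall>i\<in>{1..r-1}. x $$ (i - 1, i) = (\<Sum>\<alpha>\<in>Bw r \<pi> (i + 1). 1 / z \<alpha>)) \<and>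
    (\<Sum>i\<in>{1..r-1}. x $$ (i - 1, i)) = (\<Sum>\<alpha>\<in>V. 1 / z \<alpha>) \<and>
    (\<forall>i\<in>{1..r}. b $$ (i - 1, i - 1) =
       (-1) ^ (i + \<rho> i) * ((\<Prod>a\<in>{a. (a, i) \<in> V}. - z (a, i)) / (\<Prod>c\<in>{c. (i, c) \<in> V}. z (i, c))))"
proof -
  obtain y b where F: "factored z r y b" using factored_exists[of z] z by blast
  note Fy = factoredD[OF F, unfolded swept_all]
  define X where "X = mat r r (\<lambda>(i, k). y (\<pi> (i + 1)) (k + 1))"
  define B where "B = mat r r (\<lambda>(i, k). b (i + 1) (k + 1))"
  have pr: "\<pi> (Suc i) \<in> {1..r}" if "i < r" for i using pi_range[of "Suc i"] that by simp
  have rkp: "row_rank r (\<pi> (Suc i)) = Suc i" if "i < r" for i using row_rank_pi[of "Suc i"] that by simp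
  have yrow: "y (\<pi> (Suc i)) (Suc i) = 1" "\<And>t. t < Suc i \<Longrightarrow> y (\<pi> (Suc i)) t = 0"
    "y (\<pi> (Suc i)) (Suc (Suc i)) = level_sum z r (Suc (Suc i))" if "i < r" for i
    using Fy(2-4)[OF pr[OF that]] unfolding rkp[OF that] by blast+
  have X: "X \<in> unipotent_upper r"
    unfolding unipotent_upper_def using yrow by (auto simp: X_def)
  have diag: "B $$ (i, i) = pivot z r (Suc i)" if "i < r" for i
    using Fy(6)[of "Suc i"] that by (simp add: B_def)
  have pz: "pivot z r c \<noteq> 0" for c
    using z by (auto simp: pivot_def finite_sections)
  have B: "B \<in> borel_lower r"
  proof -
    have c: "B \<in> carrier_mat r r" by (simp add: B_def)
    have low: "B $$ (i, k) = 0" if "i < k" "k < r" for i k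
      using Fy(5)[of "Suc i" "Suc k"] that by (simp add: B_def)
    have "det B = prod_list (diag_mat B)" by (rule det_lower_triangular[OF low c])
    moreover have "0 \<notin> set (diag_mat B)" using diag pz c by (auto simp: diag_mat_def)
    ultimately have "invertible_mat B" using c by (intro invertible_mat_of_det[OF c]) (simp add: prod_list_zero_iff)
    moreover have "upper_triangular (transpose_mat B)" using low c by (auto simp: upper_triangular_def)
    ultimately show ?thesis using c by (simp add: borel_lower_def)
  qed
  have "perm_matrix r \<pi> * n_matrix r \<pi> (sweep_cols r z) = X * B"
  proof (rule eq_matI)
    fix i k assume "i < dim_row (X * B)" "k < dim_col (X * B)"
    then have ik: "i < r" "k < r" by (simp_all add: X_def B_def)
    let ?E = "entry V (sweep_cols r z)"
    have pi': "\<pi> (Suc i) - 1 < r" "Suc (\<pi> (Suc i) - 1) = \<pi> (Suc i)" using pr[OF ik(1)] by auto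
    have "(perm_matrix r \<pi> * n_matrix r \<pi> (sweep_cols r z)) $$ (i, k) =
        (\<Sum>l<r. (if Suc l = \<pi> (Suc i) then 1 else 0) * ?E (Suc l) (Suc k))"
      using ik by (auto simp: perm_matrix_def n_matrix_def scalar_prod_def entry_def atLeast0LessThan intro!: sum.cong)
    also have "\<dots> = (\<Sum>l<r. if l = \<pi> (Suc i) - 1 then ?E (\<pi> (Suc i)) (Suc k) else 0)"
      using pi'(2) by (intro sum.cong) auto
    also have "\<dots> = ?E (\<pi> (Suc i)) (Suc k)" using pi'(1) by simp
    also have "\<dots> = (\<Sum>t\<in>{1..r}. y (\<pi> (Suc i)) t * b t (Suc k))"
      using Fy(1)[OF pr[OF ik(1)], of "Suc k"] ik(2) by simp
    also have "\<dots> = (\<Sum>t<r. y (\<pi> (Suc i)) (Suc t) * b (Suc t) (Suc k))"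
      by (rule sum.reindex_bij_witness[of _ Suc "\<lambda>t. t - 1"]) auto
    also have "\<dots> = (X * B) $$ (i, k)"
      using ik by (simp add: X_def B_def scalar_prod_def atLeast0LessThan)
    finally show "(perm_matrix r \<pi> * n_matrix r \<pi> (sweep_cols r z)) $$ (i, k) = (X * B) $$ (i, k)" .
  qed (simp_all add: X_def B_def perm_matrix_def n_matrix_def)
  moreover have ls: "level_sum z r i = (\<Sum>\<alpha>\<in>Bw r \<pi> i. 1 / z \<alpha>)" for i
    unfolding level_sum_def Bw_eq by (intro sum.cong) (auto simp: V_iff divide_inverse)
  have sup: "X $$ (i - 1, i) = (\<Sum>\<alpha>\<in>Bw r \<pi> (i + 1). 1 / z \<alpha>)" if i: "i \<in> {1..r-1}" for i
  proof -
    obtain k where k: "i = Suc k" "Suc k < r" using i by (cases i) auto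
    then show ?thesis using yrow(3)[of k] by (simp add: X_def ls)
  qed
  moreover have "(\<Sum>i\<in>{1..r-1}. X $$ (i - 1, i)) = (\<Sum>\<alpha>\<in>V. 1 / z \<alpha>)"
  proof -
    have "(\<Sum>i\<in>{1..r-1}. X $$ (i - 1, i)) = (\<Sum>i\<in>{1..r-1}. \<Sum>\<alpha>\<in>Bw r \<pi> (i + 1). 1 / z \<alpha>)"
      using sup by (intro sum.cong refl)
    also have "\<dots> = (\<Sum>i\<in>{2..r}. \<Sum>\<alpha>\<in>Bw r \<pi> i. 1 / z \<alpha>)"
      by (rule sum.reindex_bij_witness[of _ "\<lambda>i. i - 1" "\<lambda>i. i + 1"]) auto
    also have "\<dots> = (\<Sum>\<alpha>\<in>(\<Union>i\<in>{2..r}. Bw r \<pi> i). 1 / z \<alpha>)"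
      using Bw_partition(1) finite_V
      by (intro sum.UNION_disjoint[symmetric]) (auto simp: disjoint_family_on_def Bw_eq)
    finally show ?thesis unfolding Bw_partition(2) .
  qed
  moreover have "B $$ (i - 1, i - 1) =
      (-1) ^ (i + \<rho> i) * ((\<Prod>a\<in>{a. (a, i) \<in> V}. - z (a, i)) / (\<Prod>c\<in>{c. (i, c) \<in> V}. z (i, c)))"
    if "i \<in> {1..r}" for i
  proof -
    have "row_rank r i = \<rho> i" using row_rank_pi[of "\<rho> i"] rho_range[of i] that by simp
    moreover have "{e. (i, e) \<in> V \<and> e \<le> r} = {e. (i, e) \<in> V}" by (auto simp: V_iff)
    moreover have "i - 1 < r" "Suc (i - 1) = i" using that by auto
    then have "B $$ (i - 1, i - 1) = pivot z r i" using diag[of "i - 1"] by simp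
    ultimately show ?thesis unfolding pivot_def by simp
  qed
  ultimately show ?thesis using X B by blast
qed

end

theorem theorem1p9:
  fixes r :: nat and \<pi> :: "nat \<Rightarrow> nat"
  assumes "r \<ge> 2" and "\<pi> permutes {1..r}"
  shows "disjoint_family_on (Bw r \<pi>) {2..r} \<and> (\<Union>i\<in>{2..r}. Bw r \<pi> i) = Vw r \<pi> \<and>
    (\<exists>R :: nat \<times> nat \<Rightarrow> 'a::field_char_0 ratfun.
      birational_map (Vw r \<pi>) R \<and>
      (\<forall>z :: nat \<times> nat \<Rightarrow> 'a. (\<forall>\<alpha>\<in>Vw r \<pi>. z \<alpha> \<noteq> 0) \<longrightarrow>
        (\<forall>\<beta>\<in>Vw r \<pi>. rat_regular id z (R \<beta>)) \<and>
        invertible_mat (map_mat (rat_eval id z) (jacobian (Vw r \<pi>) R)) \<and>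
        (\<exists>x\<in>unipotent_upper r. \<exists>b\<in>borel_lower r.
          perm_matrix r \<pi> * n_matrix r \<pi> (\<lambda>\<alpha>. rat_eval id z (R \<alpha>)) = x * b \<and>
          (\<forall>i\<in>{1..r-1}. x $$ (i - 1, i) = (\<Sum>\<alpha>\<in>Bw r \<pi> (i + 1). 1 / z \<alpha>)) \<and>
          (\<Sum>i\<in>{1..r-1}. x $$ (i - 1, i)) = (\<Sum>\<alpha>\<in>Vw r \<pi>. 1 / z \<alpha>) \<and>
          (\<forall>i\<in>{1..r}. b $$ (i - 1, i - 1) =
             (-1) ^ (i + inv \<pi> i) *
               ((\<Prod>a\<in>{a. (a, i) \<in> Vw r \<pi>}. - z (a, i)) /
                (\<Prod>c\<in>{c. (i, c) \<in> Vw r \<pi>}. z (i, c)))))) \<and>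
      (\<exists>s\<in>{1, -1}. det (jacobian (Vw r \<pi>) R) =
         s * (\<Prod>(i, j)\<in>Vw r \<pi>. rat_var (i, j) ^ (j - i - 1))) \<and>
      (\<forall>\<alpha>\<in>Vw r \<pi>. \<forall>\<beta>\<in>Vw r \<pi>.
        \<exists>(m::nat) c f.
          (\<forall>k<m. c k \<in> int_adjoin
              (\<Union>\<delta>\<in>{\<delta>\<in>Vw r \<pi>. idx_less \<pi> \<delta> \<alpha>}. {rat_var \<delta>, inverse (rat_var \<delta>)}) \<and>
            f k \<in> int_adjoin (R ` Vw r \<pi>)) \<and>
          rat_var \<alpha> * rat_pderiv \<alpha> (R \<beta>) = (\<Sum>k<m. c k * f k)))"
proof -
  interpret perm r \<pi> by unfold_locales (rule assms(2))
  let ?R = "sweep_cols r (rat_var :: _ \<Rightarrow> 'a ratfun)"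
  have 1: "birational_map V ?R"
    using sweep_cols_aut[where 'a='a] birational_map_of_aut by auto
  have 2: "(\<forall>\<beta>\<in>V. rat_regular id z (?R \<beta>)) \<and> invertible_mat (map_mat (rat_eval id z) (jacobian V ?R)) \<and>
      (\<exists>x\<in>unipotent_upper r. \<exists>b\<in>borel_lower r.
          perm_matrix r \<pi> * n_matrix r \<pi> (\<lambda>\<alpha>. rat_eval id z (?R \<alpha>)) = x * b \<and>
          (\<forall>i\<in>{1..r-1}. x $$ (i - 1, i) = (\<Sum>\<alpha>\<in>Bw r \<pi> (i + 1). 1 / z \<alpha>)) \<and>
          (\<Sum>i\<in>{1..r-1}. x $$ (i - 1, i)) = (\<Sum>\<alpha>\<in>V. 1 / z \<alpha>) \<and>
          (\<forall>i\<in>{1..r}. b $$ (i - 1, i - 1) = (-1) ^ (i + inv \<pi> i) *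
               ((\<Prod>a\<in>{a. (a, i) \<in> V}. - z (a, i)) / (\<Prod>c\<in>{c. (i, c) \<in> V}. z (i, c)))))"
    if z: "\<forall>\<alpha>\<in>V. z \<alpha> \<noteq> 0" for z :: "nat \<times> nat \<Rightarrow> 'a"
  proof -
    have z': "z \<alpha> \<noteq> 0" if "\<alpha> \<in> V" for \<alpha> using z that by blast
    have e: "(\<lambda>\<alpha>. rat_eval id z (?R \<alpha>)) = sweep_cols r z" using sweep_values[of z, OF z'] by (intro ext) blast
    show ?thesis unfolding e
      using sweep_values[of z, OF z'] jacobian_invertible_at[of z, OF z'] sweep_factorisation[of z, OF z'] by blast
  qed
  have 3: "\<exists>s\<in>{1, -1}. det (jacobian V ?R) = s * (\<Prod>(i, j)\<in>V. rat_var (i, j) ^ (j - i - 1))"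
    unfolding det_jacobian_sweep by (rule prod_step_det)
  have 4: "\<exists>(m::nat) c f. (\<forall>k<m. c k \<in> int_adjoin
              (\<Union>\<delta>\<in>{\<delta>\<in>V. idx_less \<pi> \<delta> \<alpha>}. {rat_var \<delta>, inverse (rat_var \<delta>)}) \<and>
            f k \<in> int_adjoin (?R ` V)) \<and>
          rat_var \<alpha> * rat_pderiv \<alpha> (?R \<beta>) = (\<Sum>k<m. c k * f k)" if "\<alpha> \<in> V" "\<beta> \<in> V" for \<alpha> \<beta>
    using log_closed_sweep[OF that(1), where 'a='a] that(2)
    unfolding log_closed_def units_below_def by (intro int_adjoin_Un) blast
  show ?thesis
    by (intro conjI exI[of _ ?R])
      (rule Bw_partition 1 3 | (intro allI impI, rule 2, assumption) | (intro ballI, rule 4; assumption))+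
qed

end
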